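(* The $\mathbb{R}$-span $\mathfrak{C}(q)=\mathbb{R}[\Omega(q)]\subseteq C(q)$ is stable under $m$, $m^*$, $e$, $e^*$, and with the restricted operations and the basis $\Omega(q)$, the pair $(\mathfrak{C}(q),\Omega(q))$ is a real PSH algebra which is non-descending.
   Context: Let $q$ be a prime power. For $n\ge0$ let $G_n^F=\mathrm{GL}_n(\mathbb{F}_q)$, $\mathcal{G}_n^F=\mathfrak{gl}_n(\mathbb{F}_q)$ ($\mathfrak{gl}_0(\mathbb{F}_q)=\{0\}$), and $C_n(q)$ the complex functions on $\mathfrak{gl}_n(\mathbb{F}_q)$ invariant under conjugation by $\mathrm{GL}_n(\mathbb{F}_q)$, with hermitian form $(f,g)=|G_n^F|^{-1}\sum_{x}f(x)\overline{g(x)}$. $C(q)=\bigoplus_n C_n(q)$ is the connected graded Hopf algebra over $\mathbb{C}$ whose multiplication on $C_k(q)\otimes C_l(q)$ is Harish-Chandra induction $R^{k+l}_{k,l}$ from the block-diagonal Levi $\mathfrak{gl}_k\times\mathfrak{gl}_l$ (identifying $C(\mathfrak{gl}_k(\mathbb{F}_q)\times\mathfrak{gl}_l(\mathbb{F}_q))\cong C_k(q)\otimes C_l(q)$), whose co-multiplication on $C_n(q)$ is $\sum_{k+l=n}{}^*R^n_{k,l}$ (Harish-Chandra restrictions), unit the inclusion of $C_0(q)=\mathbb{C}$ and co-unit the projection to $C_0(q)$. Here for a standard parabolic $P=L\ltimes U_P$, ${}^*R(f)(x)=\frac{1}{|U_P^F|}\sum_{y\in\mathcal{U}_P^F}f(x+y)$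 and $R(f)(x)=\frac{1}{|P^F|}\sum_{g\in G_n^F,\,gxg^{-1}\in\mathcal{P}^F}f(\pi_{\mathcal{L}}(gxg^{-1}))$. An invariant character of $\mathcal{G}_n^F$ is a character of the additive group $\mathcal{G}_n^F$ invariant under conjugation by $G_n^F$; it is irreducible if it is not a sum of two nonzero invariant characters; the irreducible ones form an orthogonal basis of $C_n(q)$. Extend the forms on the $C_n(q)$ to a form $(-,-)$ on $C(q)$ making different degrees orthogonal. $\Omega(q)$ is the set of $\chi/\sqrt{(\chi,\chi)}$ for $\chi$ ranging over all irreducible invariant characters of all $\mathcal{G}_n^F$, $n\ge0$; it is a homogeneous orthonormal set. A real PSH algebra is a pair $(\mathcal{H},\Omega)$ with $\mathcal{H}=\bigoplus_{n\ge0}\mathcal{H}_n$ a connected graded Hopf algebra over $\mathbb{R}$ and $\Omega$ a homogeneous $\mathbb{R}$-basis such that (P) unit, co-unit, multiplication, co-multiplication map nonnegative real combinations of $\Omega$ (resp. of $\Omega\otimes\Omega$) to nonnegative real combinations of $\Omega$ (resp. $\Omega\otimes\Omega$), and (S) unit/co-unit and multiplication/co-multiplication are adjoint pairs for the inner products making $\Omega$ and $\Omega\otimes\Omega$ orthonormal. A PSH algebra over $\mathbb{Z}$ (Zelevinsky) is the same notion with $\mathbb{R}$ replaced by $\mathbb{Z}$ (a connected graded Hopf algebra over $\mathbb{Z}$, free with homogeneous basis $\Psi$, satisfying the analogous positivity and self-adjointness). A real PSH algebra $(\mathcal{H},\Omega)$ is descending if there is a PSH algebra $(A,\Psi)$ over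 $\mathbb{Z}$ and an isomorphism of connected graded Hopf algebras $\iota:A\otimes_{\mathbb{Z}}\mathbb{R}\to\mathcal{H}$ with $\iota(\Psi)=\Omega$; otherwise non-descending. *)

theory Defs
  imports Complex_Main
begin

text \<open>A connected graded Hopf algebra over a commutative ring 'r which is a free
 'r-module with homogeneous basis B is encoded by its structure constants w.r.t. B:
 mc a b c = coefficient of c in a*b;  cc a b c = coefficient of a (x) b in Delta(c);
 un b = coefficient of b in the unit 1;  cu b = counit of b;  deg = degree of basis elements.
 Elements of the algebra are the finitely supported 'r-combinations of B (free module on B),
 and B (x) B = {a (x) b} is the basis of the tensor square.\<close>

definition based_hopf ::
  "'b set \<Rightarrow> ('b \<Rightarrow> nat) \<Rightarrow> ('b \<Rightarrow> 'b \<Rightarrow> 'b \<Rightarrow> 'r::comm_ring_1) \<Rightarrow>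
   ('b \<Rightarrow> 'b \<Rightarrow> 'b \<Rightarrow> 'r) \<Rightarrow> ('b \<Rightarrow> 'r) \<Rightarrow> ('b \<Rightarrow> 'r) \<Rightarrow> bool" where
  "based_hopf B deg mc cc un cu \<longleftrightarrow>
     \<comment> \<open>well-defined (finitely supported) linear structure maps on the free module over B\<close>
     (\<forall>a\<in>B. \<forall>b\<in>B. finite {c. mc a b c \<noteq> 0} \<and> {c. mc a b c \<noteq> 0} \<subseteq> B) \<and>
     (\<forall>c\<in>B. finite {p. cc (fst p) (snd p) c \<noteq> 0} \<and> {p. cc (fst p) (snd p) c \<noteq> 0} \<subseteq> B \<times> B) \<and>
     finite {b. un b \<noteq> 0} \<and> {b. un b \<noteq> 0} \<subseteq> B \<and>
     \<comment> \<open>grading\<close>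
     (\<forall>a\<in>B. \<forall>b\<in>B. \<forall>c\<in>B. mc a b c \<noteq> 0 \<longrightarrow> deg c = deg a + deg b) \<and>
     (\<forall>a\<in>B. \<forall>b\<in>B. \<forall>c\<in>B. cc a b c \<noteq> 0 \<longrightarrow> deg c = deg a + deg b) \<and>
     (\<forall>b\<in>B. un b \<noteq> 0 \<longrightarrow> deg b = 0) \<and>
     (\<forall>b\<in>B. cu b \<noteq> 0 \<longrightarrow> deg b = 0) \<and>
     \<comment> \<open>connected: the degree 0 part is free of rank one\<close>
     (\<exists>b0\<in>B. \<forall>b\<in>B. deg b = 0 \<longleftrightarrow> b = b0) \<and>
     \<comment> \<open>associativity and unit\<close>
     (\<forall>a\<in>B. \<forall>b\<in>B. \<forall>c\<in>B. \<forall>d\<in>B.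
        (\<Sum>x\<in>{x. mc a b x \<noteq> 0}. mc a b x * mc x c d) =
        (\<Sum>y\<in>{y. mc b c y \<noteq> 0}. mc b c y * mc a y d)) \<and>
     (\<forall>a\<in>B. \<forall>c\<in>B. (\<Sum>x\<in>{x. un x \<noteq> 0}. un x * mc x a c) = (if a = c then 1 else 0)) \<and>
     (\<forall>a\<in>B. \<forall>c\<in>B. (\<Sum>x\<in>{x. un x \<noteq> 0}. un x * mc a x c) = (if a = c then 1 else 0)) \<and>
     \<comment> \<open>coassociativity and counit\<close>
     (\<forall>a\<in>B. \<forall>b\<in>B. \<forall>c\<in>B. \<forall>d\<in>B.
        (\<Sum>x\<in>{x. cc x c d \<noteq> 0}. cc x c d * cc a b x) =
        (\<Sum>y\<in>{y. cc a y d \<noteq> 0}. cc a y d * cc b c y)) \<and>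
     (\<forall>a\<in>B. \<forall>c\<in>B. (\<Sum>x\<in>{x. cc x a c \<noteq> 0}. cu x * cc x a c) = (if a = c then 1 else 0)) \<and>
     (\<forall>a\<in>B. \<forall>c\<in>B. (\<Sum>x\<in>{x. cc a x c \<noteq> 0}. cc a x c * cu x) = (if a = c then 1 else 0)) \<and>
     \<comment> \<open>comultiplication and counit are algebra morphisms\<close>
     (\<forall>a\<in>B. \<forall>b\<in>B. \<forall>c1\<in>B. \<forall>c2\<in>B.
        (\<Sum>x\<in>{x. mc a b x \<noteq> 0}. mc a b x * cc c1 c2 x) =
        (\<Sum>p\<in>{p. cc (fst p) (snd p) a \<noteq> 0}. \<Sum>r\<in>{r. cc (fst r) (snd r) b \<noteq> 0}.
            cc (fst p) (snd p) a * cc (fst r) (snd r) b *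
            mc (fst p) (fst r) c1 * mc (snd p) (snd r) c2)) \<and>
     (\<forall>a\<in>B. \<forall>b\<in>B. (\<Sum>x\<in>{x. un x \<noteq> 0}. un x * cc a b x) = un a * un b) \<and>
     (\<forall>a\<in>B. \<forall>b\<in>B. (\<Sum>x\<in>{x. mc a b x \<noteq> 0}. mc a b x * cu x) = cu a * cu b) \<and>
     (\<Sum>x\<in>{x. un x \<noteq> 0}. un x * cu x) = 1 \<and>
     \<comment> \<open>existence of an antipode s (s b c = coefficient of c in S(b))\<close>
     (\<exists>s :: 'b \<Rightarrow> 'b \<Rightarrow> 'r.
        (\<forall>b\<in>B. finite {c. s b c \<noteq> 0} \<and> {c. s b c \<noteq> 0} \<subseteq> B) \<and>
        (\<forall>b\<in>B. \<forall>c\<in>B.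
           (\<Sum>p\<in>{p. cc (fst p) (snd p) b \<noteq> 0}. \<Sum>x\<in>{x. s (fst p) x \<noteq> 0}.
               cc (fst p) (snd p) b * s (fst p) x * mc x (snd p) c) = cu b * un c) \<and>
        (\<forall>b\<in>B. \<forall>c\<in>B.
           (\<Sum>p\<in>{p. cc (fst p) (snd p) b \<noteq> 0}. \<Sum>x\<in>{x. s (snd p) x \<noteq> 0}.
               cc (fst p) (snd p) b * s (snd p) x * mc (fst p) x c) = cu b * un c))"

text \<open>PSH algebra over an ordered ring 'r (real: 'r = real; Zelevinsky: 'r = int):
 (P) positivity of all structure maps on the basis, (S) self-adjointness for the
 inner product making B (resp. B x B) orthonormal.\<close>

definition based_psh ::
  "'b set \<Rightarrow> ('b \<Rightarrow> nat) \<Rightarrow> ('b \<Rightarrow> 'b \<Rightarrow> 'b \<Rightarrow> 'r::linordered_idom) \<Rightarrow>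
   ('b \<Rightarrow> 'b \<Rightarrow> 'b \<Rightarrow> 'r) \<Rightarrow> ('b \<Rightarrow> 'r) \<Rightarrow> ('b \<Rightarrow> 'r) \<Rightarrow> bool" where
  "based_psh B deg mc cc un cu \<longleftrightarrow>
     based_hopf B deg mc cc un cu \<and>
     (\<forall>a\<in>B. \<forall>b\<in>B. \<forall>c\<in>B. 0 \<le> mc a b c \<and> 0 \<le> cc a b c) \<and>
     (\<forall>b\<in>B. 0 \<le> un b \<and> 0 \<le> cu b) \<and>
     (\<forall>a\<in>B. \<forall>b\<in>B. \<forall>c\<in>B. mc a b c = cc a b c) \<and>
     (\<forall>b\<in>B. un b = cu b)"

abbreviation real_psh ::
  "'b set \<Rightarrow> ('b \<Rightarrow> nat) \<Rightarrow> ('b \<Rightarrow> 'b \<Rightarrow> 'b \<Rightarrow> real) \<Rightarrow>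
   ('b \<Rightarrow> 'b \<Rightarrow> 'b \<Rightarrow> real) \<Rightarrow> ('b \<Rightarrow> real) \<Rightarrow> ('b \<Rightarrow> real) \<Rightarrow> bool" where
  "real_psh \<equiv> based_psh"

abbreviation int_psh ::
  "'c set \<Rightarrow> ('c \<Rightarrow> nat) \<Rightarrow> ('c \<Rightarrow> 'c \<Rightarrow> 'c \<Rightarrow> int) \<Rightarrow>
   ('c \<Rightarrow> 'c \<Rightarrow> 'c \<Rightarrow> int) \<Rightarrow> ('c \<Rightarrow> int) \<Rightarrow> ('c \<Rightarrow> int) \<Rightarrow> bool" where
  "int_psh \<equiv> based_psh"

text \<open>Descending: there is a PSH algebra (A, Psi) over Z (basis indexed by a set of type 'c)
 and an isomorphism of connected graded Hopf algebras A (x) R -> H mapping Psi onto the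
 basis B. Such an isomorphism is the R-linear extension of a bijection phi : Psi -> B,
 and it is a graded Hopf algebra isomorphism iff phi preserves degrees and all structure
 constants (those of A (x) R being the images of the integer ones).\<close>

definition descending ::
  "'c itself \<Rightarrow> 'b set \<Rightarrow> ('b \<Rightarrow> nat) \<Rightarrow> ('b \<Rightarrow> 'b \<Rightarrow> 'b \<Rightarrow> real) \<Rightarrow>
   ('b \<Rightarrow> 'b \<Rightarrow> 'b \<Rightarrow> real) \<Rightarrow> ('b \<Rightarrow> real) \<Rightarrow> ('b \<Rightarrow> real) \<Rightarrow> bool" where
  "descending (_ :: 'c itself) B deg mc cc un cu \<longleftrightarrow>
     (\<exists>(Psi :: 'c set) degA mcA ccA unA cuA (phi :: 'c \<Rightarrow> 'b).
        int_psh Psi degA mcA ccA unA cuA \<and>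
        bij_betw phi Psi B \<and>
        (\<forall>a\<in>Psi. deg (phi a) = degA a) \<and>
        (\<forall>a\<in>Psi. \<forall>b\<in>Psi. \<forall>c\<in>Psi. mc (phi a) (phi b) (phi c) = of_int (mcA a b c)) \<and>
        (\<forall>a\<in>Psi. \<forall>b\<in>Psi. \<forall>c\<in>Psi. cc (phi a) (phi b) (phi c) = of_int (ccA a b c)) \<and>
        (\<forall>a\<in>Psi. un (phi a) = of_int (unA a)) \<and>
        (\<forall>a\<in>Psi. cu (phi a) = of_int (cuA a)))"

text \<open>n x n matrices over a finite field 'a (q = CARD('a)) are represented as functions
 nat => nat => 'a vanishing outside {0..<n} x {0..<n}.\<close>

type_synonym 'a mat = "nat \<Rightarrow> nat \<Rightarrow> 'a"

definition gl :: "nat \<Rightarrow> 'a::zero mat set" where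
  "gl n = {A. \<forall>i j. (n \<le> i \<or> n \<le> j) \<longrightarrow> A i j = 0}"

definition mmul :: "nat \<Rightarrow> 'a::comm_ring_1 mat \<Rightarrow> 'a mat \<Rightarrow> 'a mat" where
  "mmul n A B = (\<lambda>i j. if i < n \<and> j < n then \<Sum>k<n. A i k * B k j else 0)"

definition idm :: "nat \<Rightarrow> 'a::comm_ring_1 mat" where
  "idm n = (\<lambda>i j. if i < n \<and> i = j then 1 else 0)"

definition GL :: "nat \<Rightarrow> 'a::comm_ring_1 mat set" where
  "GL n = {g \<in> gl n. \<exists>h \<in> gl n. mmul n g h = idm n \<and> mmul n h g = idm n}"

definition minv :: "nat \<Rightarrow> 'a::comm_ring_1 mat \<Rightarrow> 'a mat" where
  "minv n g = (SOME h. h \<in> gl n \<and> mmul n g h = idm n \<and> mmul n h g = idm n)"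

definition conjm :: "nat \<Rightarrow> 'a::comm_ring_1 mat \<Rightarrow> 'a mat \<Rightarrow> 'a mat" where
  "conjm n g x = mmul n (mmul n g x) (minv n g)"

definition madd :: "'a::plus mat \<Rightarrow> 'a mat \<Rightarrow> 'a mat" where
  "madd x y = (\<lambda>i j. x i j + y i j)"

definition form :: "nat \<Rightarrow> ('a::{finite,field} mat \<Rightarrow> complex) \<Rightarrow> ('a mat \<Rightarrow> complex) \<Rightarrow> complex" where
  "form n f g = (\<Sum>x\<in>gl n. f x * cnj (g x)) / of_nat (card (GL n :: 'a mat set))"

text \<open>Characters of the additive group gl_n: nonnegative integer combinations
 (with multiplicities) of linear characters, i.e. characters of representations.\<close>
definition lin_char :: "nat \<Rightarrow> ('a::{finite,field} mat \<Rightarrow> complex) \<Rightarrow> bool" where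
  "lin_char n \<psi> \<longleftrightarrow> (\<forall>x. x \<notin> gl n \<longrightarrow> \<psi> x = 0) \<and> (\<forall>x\<in>gl n. \<psi> x \<noteq> 0) \<and>
     (\<forall>x\<in>gl n. \<forall>y\<in>gl n. \<psi> (madd x y) = \<psi> x * \<psi> y)"

definition is_char :: "nat \<Rightarrow> ('a::{finite,field} mat \<Rightarrow> complex) \<Rightarrow> bool" where
  "is_char n \<chi> \<longleftrightarrow> (\<exists>m :: ('a mat \<Rightarrow> complex) \<Rightarrow> nat.
      (\<forall>\<psi>. m \<psi> \<noteq> 0 \<longrightarrow> lin_char n \<psi>) \<and>
      \<chi> = (\<lambda>x. \<Sum>\<psi>\<in>{\<psi>. lin_char n \<psi>}. of_nat (m \<psi>) * \<psi> x))"

definition inv_char :: "nat \<Rightarrow> ('a::{finite,field} mat \<Rightarrow> complex) \<Rightarrow> bool" where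
  "inv_char n \<chi> \<longleftrightarrow> is_char n \<chi> \<and> (\<forall>g\<in>GL n. \<forall>x\<in>gl n. \<chi> (conjm n g x) = \<chi> x)"

definition irr_inv_char :: "nat \<Rightarrow> ('a::{finite,field} mat \<Rightarrow> complex) \<Rightarrow> bool" where
  "irr_inv_char n \<chi> \<longleftrightarrow> inv_char n \<chi> \<and> \<chi> \<noteq> (\<lambda>x. 0) \<and>
     \<not> (\<exists>\<chi>1 \<chi>2. inv_char n \<chi>1 \<and> inv_char n \<chi>2 \<and> \<chi>1 \<noteq> (\<lambda>x. 0) \<and> \<chi>2 \<noteq> (\<lambda>x. 0) \<and>
            \<chi> = (\<lambda>x. \<chi>1 x + \<chi>2 x))"

text \<open>Elements of C(q) = direct sum of the C_n(q): families F with F n a function on gl_n.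
 Elements of C(q) (x) C(q): families T k l of functions on gl_k x gl_l.\<close>
type_synonym 'a gr = "nat \<Rightarrow> 'a mat \<Rightarrow> complex"
type_synonym 'a gr2 = "nat \<Rightarrow> nat \<Rightarrow> 'a mat \<Rightarrow> 'a mat \<Rightarrow> complex"

definition tens :: "'a gr \<Rightarrow> 'a gr \<Rightarrow> 'a gr2" where
  "tens F G = (\<lambda>k l x y. F k x * G l y)"

definition gdeg :: "'a::zero gr \<Rightarrow> nat" where
  "gdeg F = (LEAST n. F n \<noteq> (\<lambda>x. 0))"

definition Omega :: "'a::{finite,field} gr set" where
  "Omega = {(\<lambda>k. if k = n then (\<lambda>x. \<chi> x / complex_of_real (sqrt (Re (form n \<chi> \<chi>))))
                   else (\<lambda>x. 0)) | n \<chi>. irr_inv_char n \<chi>}"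

definition parab :: "nat \<Rightarrow> nat \<Rightarrow> 'a::zero mat set" where
  "parab k l = {y \<in> gl (k + l). \<forall>i j. k \<le> i \<longrightarrow> j < k \<longrightarrow> y i j = 0}"

definition nilrad :: "nat \<Rightarrow> nat \<Rightarrow> 'a::zero mat set" where
  "nilrad k l = {y \<in> gl (k + l). \<forall>i j. y i j \<noteq> 0 \<longrightarrow> i < k \<and> k \<le> j}"

definition Pgrp :: "nat \<Rightarrow> nat \<Rightarrow> 'a::comm_ring_1 mat set" where
  "Pgrp k l = GL (k + l) \<inter> parab k l"

definition Ugrp :: "nat \<Rightarrow> nat \<Rightarrow> 'a::comm_ring_1 mat set" where
  "Ugrp k l = {g \<in> GL (k + l). (\<lambda>i j. g i j - idm (k + l) i j) \<in> nilrad k l}"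

definition blk1 :: "nat \<Rightarrow> 'a::zero mat \<Rightarrow> 'a mat" where
  "blk1 k y = (\<lambda>i j. if i < k \<and> j < k then y i j else 0)"

definition blk2 :: "nat \<Rightarrow> nat \<Rightarrow> 'a::zero mat \<Rightarrow> 'a mat" where
  "blk2 k l y = (\<lambda>i j. if i < l \<and> j < l then y (i + k) (j + k) else 0)"

definition bdiag :: "nat \<Rightarrow> nat \<Rightarrow> 'a::zero mat \<Rightarrow> 'a mat \<Rightarrow> 'a mat" where
  "bdiag k l x1 x2 = (\<lambda>i j. if i < k \<and> j < k then x1 i j
      else if k \<le> i \<and> k \<le> j \<and> i < k + l \<and> j < k + l then x2 (i - k) (j - k) else 0)"

definition hc_ind :: "nat \<Rightarrow> nat \<Rightarrow> ('a::{finite,field} mat \<Rightarrow> 'a mat \<Rightarrow> complex) \<Rightarrow> 'a mat \<Rightarrow> complex" where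
  "hc_ind k l f x = (if x \<in> gl (k + l) then
     (\<Sum>g\<in>{g \<in> GL (k + l). conjm (k + l) g x \<in> parab k l}.
         f (blk1 k (conjm (k + l) g x)) (blk2 k l (conjm (k + l) g x)))
       / of_nat (card (Pgrp k l :: 'a mat set))
     else 0)"

definition hc_res :: "nat \<Rightarrow> nat \<Rightarrow> ('a::{finite,field} mat \<Rightarrow> complex) \<Rightarrow> 'a mat \<Rightarrow> 'a mat \<Rightarrow> complex" where
  "hc_res k l f x1 x2 = (if x1 \<in> gl k \<and> x2 \<in> gl l then
     (\<Sum>y\<in>nilrad k l. f (madd (bdiag k l x1 x2) y)) / of_nat (card (Ugrp k l :: 'a mat set))
     else 0)"

definition hmult :: "'a::{finite,field} gr2 \<Rightarrow> 'a gr" where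
  "hmult T = (\<lambda>n x. \<Sum>k\<le>n. hc_ind k (n - k) (T k (n - k)) x)"

definition hcomult :: "'a::{finite,field} gr \<Rightarrow> 'a gr2" where
  "hcomult F = (\<lambda>k l x1 x2. hc_res k l (F (k + l)) x1 x2)"

definition hunit :: "complex \<Rightarrow> 'a::{finite,field} gr" where
  "hunit c = (\<lambda>n x. if n = 0 \<and> x \<in> gl 0 then c else 0)"

definition hcounit :: "'a::{finite,field} gr \<Rightarrow> complex" where
  "hcounit F = F 0 (\<lambda>i j. 0)"

text \<open>Real structure constants of the restricted operations on the R-span of Omega(q):
 they exist iff the R-span is stable under m, m*, e, e*.\<close>
definition real_coords ::
  "('a::{finite,field} gr \<Rightarrow> 'a gr \<Rightarrow> 'a gr \<Rightarrow> real) \<Rightarrow> ('a gr \<Rightarrow> 'a gr \<Rightarrow> 'a gr \<Rightarrow> real) \<Rightarrow>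
   ('a gr \<Rightarrow> real) \<Rightarrow> ('a gr \<Rightarrow> real) \<Rightarrow> bool" where
  "real_coords mc cc un cu \<longleftrightarrow>
     (\<forall>a\<in>Omega. \<forall>b\<in>Omega. finite {c. mc a b c \<noteq> 0} \<and> {c. mc a b c \<noteq> 0} \<subseteq> Omega \<and>
        (\<forall>n x. hmult (tens a b) n x = (\<Sum>c\<in>{c. mc a b c \<noteq> 0}. complex_of_real (mc a b c) * c n x))) \<and>
     (\<forall>c\<in>Omega. finite {p. cc (fst p) (snd p) c \<noteq> 0} \<and>
        {p. cc (fst p) (snd p) c \<noteq> 0} \<subseteq> Omega \<times> Omega \<and>
        (\<forall>k l x y. hcomult c k l x y =
           (\<Sum>p\<in>{p. cc (fst p) (snd p) c \<noteq> 0}.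
              complex_of_real (cc (fst p) (snd p) c) * tens (fst p) (snd p) k l x y))) \<and>
     finite {b. un b \<noteq> 0} \<and> {b. un b \<noteq> 0} \<subseteq> Omega \<and>
     (\<forall>n x. hunit 1 n x = (\<Sum>b\<in>{b. un b \<noteq> 0}. complex_of_real (un b) * b n x)) \<and>
     (\<forall>b\<in>Omega. hcounit b = complex_of_real (cu b))"

end

theory Submission
  imports Defs "HOL-Library.Function_Algebras" "HOL-Library.FuncSet" "HOL-Computational_Algebra.Primes"
begin

text \<open>The irreducible invariant characters are the sums over the GL-orbits of linear characters of
 the additive group, so the set Omega of their normalizations is a finite orthonormal basis of the
 class functions in each degree. Harish-Chandra induction and restriction are adjoint, hence
 multiplication and co-multiplication have the same structure constants c(a,b;x), namely the
 coefficient of a (x) b in the restriction of x; they are real and nonnegative because a restriction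
 of a character is a nonnegative combination of linear characters. Transitivity of restriction gives
 (co-)associativity. Compatibility of product and coproduct is the Mackey formula: the inner product
 of two induced functions is a sum over the relative positions of two subspaces W and W' of
 dimensions k and c, i.e. over double cosets of parabolics, and the contribution of dim (W meet W') = k1
 factorizes into four restrictions; the powers of q cancel without any explicit count, since the
 stabilizer of the pair is counted by the same factorization applied to indicator functions.
 The antipode is the geometric series of the convolution powers of id - unit o counit.

 If the algebra descended, all structure constants would be integers. But for the trivial characters
 of gl_1 and gl_2 the square of the structure constant is |GL_2| / (q^2 (q-1)^2) = (q+1)/q, which lies
 strictly between 1 and 4.\<close>

section \<open>Matrices\<close>

text \<open>The theorem quantifies over all tables of real coordinates, so besides one table
  \<open>Tc\<close> it requires that coordinates are unique. This follows from orthonormality of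
  \<open>Omega\<close> and of its products in the tensor square, and it turns one non-integral entry
  of \<open>Tc\<close> into an obstruction for every table. Adjunction by itself yields the product
  coefficients as complex conjugates of the coproduct coefficients; positivity, proved by splitting
  characters over blocks, makes the two equal. With a single table, coassociativity is
  associativity, and compatibility of product and coproduct is one identity, whose left side is by
  Parseval the inner product of two induced functions. The non-integrality argument brackets |GL_2|
  between q^2 (q-1)^2 and q^4, strictly on both sides; since q <= 2 (q-1), the upper bound is at
  most 4 q^2 (q-1)^2. The interval from 1 to 4 matters because it contains no perfect square in its
  interior.\<close>

lemma madd_eq_plus: "madd x y = x + (y :: 'a::plus mat)"
  by (simp add: madd_def fun_eq_iff)

lemma gl_iff: "A \<in> gl n \<longleftrightarrow> (\<forall>i j. A i j \<noteq> 0 \<longrightarrow> i < n \<and> j < n)"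
  by (auto simp: gl_def not_le[symmetric])

lemma finite_gl [simp]: "finite (gl n :: 'a::{finite,zero} mat set)"
proof -
  have "(gl n :: 'a mat set) \<subseteq> (\<lambda>f i j. if i < n \<and> j < n then f (i,j) else 0) ` PiE ({..<n}\<times>{..<n}) (\<lambda>_. UNIV :: 'a set)"
  proof
    fix A :: "'a mat" assume A: "A \<in> gl n"
    show "A \<in> (\<lambda>f i j. if i < n \<and> j < n then f (i,j) else 0) ` PiE ({..<n}\<times>{..<n}) (\<lambda>_. UNIV :: 'a set)"
      by (rule image_eqI[of _ _ "restrict (\<lambda>(i,j). A i j) ({..<n}\<times>{..<n})"])
         (use A in \<open>auto simp: gl_def fun_eq_iff not_less\<close>)
  qed
  then show ?thesis by (rule finite_subset) (simp add: finite_PiE)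
qed

lemma gl_add: "A \<in> gl n \<Longrightarrow> B \<in> gl n \<Longrightarrow> A + B \<in> gl n" for A B :: "'a::monoid_add mat"
  by (simp add: gl_def)
lemma gl_diff: "A \<in> gl n \<Longrightarrow> B \<in> gl n \<Longrightarrow> A - B \<in> gl n" for A B :: "'a::group_add mat"
  by (simp add: gl_def)
lemma gl_0 [simp]: "(\<lambda>i j. 0) \<in> gl n" "0 \<in> gl n"
  by (auto simp: gl_def)
lemma gl_0_eq: "gl 0 = {\<lambda>i j. 0}"
  by (auto simp: gl_def)

lemma mmul_gl [simp]: "mmul n A B \<in> gl n" by (auto simp: mmul_def gl_def)
lemma idm_gl [simp]: "idm n \<in> gl n" by (auto simp: idm_def gl_def)

lemma mmul_assoc: "mmul n (mmul n A B) C = mmul n A (mmul n B C)"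
proof (intro ext)
  fix i j
  show "mmul n (mmul n A B) C i j = mmul n A (mmul n B C) i j"
  proof (cases "i < n \<and> j < n")
    case True
    have "(\<Sum>k<n. (\<Sum>l<n. A i l * B l k) * C k j) = (\<Sum>k<n. \<Sum>l<n. A i l * (B l k * C k j))"
      by (simp add: sum_distrib_right mult.assoc)
    also have "\<dots> = (\<Sum>l<n. A i l * (\<Sum>k<n. B l k * C k j))"
      by (subst sum.swap) (simp add: sum_distrib_left)
    finally show ?thesis using True by (simp add: mmul_def)
  qed (auto simp: mmul_def)
qed

lemma sum_delta_mult:
  fixes f :: "'b \<Rightarrow> 'c::semiring_1"
  assumes "finite A"
  shows "(\<Sum>k\<in>A. (if a = k then 1 else 0) * f k) = (if a \<in> A then f a else 0)"
    "(\<Sum>k\<in>A. f k * (if a = k then 1 else 0)) = (if a \<in> A then f a else 0)"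
    "(\<Sum>k\<in>A. (if k = a then 1 else 0) * f k) = (if a \<in> A then f a else 0)"
    "(\<Sum>k\<in>A. f k * (if k = a then 1 else 0)) = (if a \<in> A then f a else 0)"
proof -
  have "(\<Sum>k\<in>A. (if a = k then 1 else 0) * f k) = (\<Sum>k\<in>A. if a = k then f k else 0)"
    "(\<Sum>k\<in>A. f k * (if a = k then 1 else 0)) = (\<Sum>k\<in>A. if a = k then f k else 0)"
    by (auto intro!: sum.cong)
  then show "(\<Sum>k\<in>A. (if a = k then 1 else 0) * f k) = (if a \<in> A then f a else 0)"
    "(\<Sum>k\<in>A. f k * (if a = k then 1 else 0)) = (if a \<in> A then f a else 0)" 
    using assms by simp_all
  then show "(\<Sum>k\<in>A. (if k = a then 1 else 0) * f k) = (if a \<in> A then f a else 0)"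
    "(\<Sum>k\<in>A. f k * (if k = a then 1 else 0)) = (if a \<in> A then f a else 0)"
    by (simp_all add: eq_commute[of _ a])
qed

lemma mmul_idm [simp]: "A \<in> gl n \<Longrightarrow> mmul n (idm n) A = A" "A \<in> gl n \<Longrightarrow> mmul n A (idm n) = A"
  by (auto simp: mmul_def idm_def gl_def fun_eq_iff if_distrib if_distribR not_less cong: if_cong)

lemma mmul_add: "mmul n A (B + C) = mmul n A B + mmul n A C" "mmul n (A + B) C = mmul n A C + mmul n B C"
  by (auto simp: mmul_def fun_eq_iff sum.distrib algebra_simps)
lemma mmul_diff: "mmul n A (B - C) = mmul n A B - mmul n A C" "mmul n (A - B) C = mmul n A C - mmul n B C"
  by (auto simp: mmul_def fun_eq_iff sum_subtractf algebra_simps)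

text \<open>Left multiplication by \<open>A\<close> is injective on the finite stable set
  \<open>X\<close>, since \<open>B\<close> cancels it; hence it is surjective and hits the identity.
  The set is a parameter because the choice \<open>parab k l\<close> later puts the inverse of a
  parabolic matrix back into the parabolic algebra.\<close>

lemma finite_right_inverse:
  fixes A :: "'a::{finite,comm_ring_1} mat"
  assumes "finite X" "idm n \<in> X" "X \<subseteq> gl n" "\<And>x. x \<in> X \<Longrightarrow> mmul n A x \<in> X"
    and B: "mmul n B A = idm n"
  shows "\<exists>x\<in>X. mmul n A x = idm n"
proof -
  have "inj_on (mmul n A) X"
  proof (rule inj_onI)
    fix x y assume xy: "x \<in> X" "y \<in> X" "mmul n A x = mmul n A y"
    then have "mmul n (mmul n B A) x = mmul n (mmul n B A) y" by (simp only: mmul_assoc)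
    then show "x = y" using B xy(1,2) assms(3) by (metis mmul_idm(1) subsetD)
  qed
  then have "mmul n A ` X = X" using assms by (metis endo_inj_surj image_subsetI)
  then show ?thesis using assms(2) by (metis imageE)
qed

lemma left_inverse_imp_right_inverse:
  fixes A :: "'a::{finite,comm_ring_1} mat"
  assumes "A \<in> gl n" "B \<in> gl n" "mmul n B A = idm n"
  shows "mmul n A B = idm n"
proof -
  obtain x where x: "x \<in> gl n" "mmul n A x = idm n"
    using finite_right_inverse[of "gl n" n A B] assms(3) by auto
  have "mmul n (mmul n B A) x = mmul n B (mmul n A x)" by (simp only: mmul_assoc)
  then have "x = B" using assms x by simp
  then show ?thesis using x by simp
qed

lemma GL_leftI:
  fixes A :: "'a::{finite,comm_ring_1} mat"
  assumes "A \<in> gl n" "B \<in> gl n" "mmul n B A = idm n"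
  shows "A \<in> GL n" "B \<in> GL n"
  using left_inverse_imp_right_inverse[OF assms] assms unfolding GL_def by auto

lemma GL_gl: "g \<in> GL n \<Longrightarrow> g \<in> gl n" by (simp add: GL_def)

lemma minv:
  assumes "g \<in> GL n"
  shows minv_gl: "minv n g \<in> gl n" and minv_r: "mmul n g (minv n g) = idm n"
    and minv_l: "mmul n (minv n g) g = idm n"
proof -
  have "\<exists>h. h \<in> gl n \<and> mmul n g h = idm n \<and> mmul n h g = idm n"
    using assms by (auto simp: GL_def)
  from someI_ex[OF this, folded minv_def]
  show "minv n g \<in> gl n" "mmul n g (minv n g) = idm n" "mmul n (minv n g) g = idm n" by auto
qed

lemma minv_GL: "g \<in> GL n \<Longrightarrow> minv n g \<in> GL n"
  using minv[of g n] GL_gl unfolding GL_def by auto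

lemma minv_unique:
  assumes "g \<in> GL n" "h \<in> gl n" "mmul n g h = idm n \<or> mmul n h g = idm n"
  shows "minv n g = h"
proof -
  have "mmul n (mmul n (minv n g) g) h = mmul n (minv n g) (mmul n g h)"
       "mmul n (mmul n h g) (minv n g) = mmul n h (mmul n g (minv n g))"
    by (simp_all only: mmul_assoc)
  then show ?thesis using minv[OF assms(1)] assms by auto
qed

lemma minv_minv: "g \<in> GL n \<Longrightarrow> minv n (minv n g) = g"
  by (rule minv_unique) (auto simp: minv_GL GL_gl minv_l)

lemma mmul_cancel:
  assumes "g \<in> GL n" "x \<in> gl n"
  shows "mmul n g (mmul n (minv n g) x) = x" "mmul n (minv n g) (mmul n g x) = x"
    "mmul n (mmul n x g) (minv n g) = x" "mmul n (mmul n x (minv n g)) g = x"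
  using minv[OF assms(1)] assms(2) by (simp_all add: mmul_assoc mmul_assoc[symmetric, of n g]
    mmul_assoc[symmetric, of n "minv n g" g])

lemma GL_mmul:
  assumes "g \<in> GL n" "h \<in> GL n" shows "mmul n g h \<in> GL n"
    and minv_mmul: "minv n (mmul n g h) = mmul n (minv n h) (minv n g)"
proof -
  have e: "mmul n (mmul n g h) (mmul n (minv n h) (minv n g)) = idm n"
    by (metis assms minv_r mmul_assoc mmul_cancel(3) GL_gl)
  have e2: "mmul n (mmul n (minv n h) (minv n g)) (mmul n g h) = idm n"
    by (metis assms minv_l mmul_assoc mmul_cancel(2) GL_gl)
  show "mmul n g h \<in> GL n" unfolding GL_def using e e2 mmul_gl by blast
  then show "minv n (mmul n g h) = mmul n (minv n h) (minv n g)"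
    using e by (intro minv_unique) auto
qed

lemma idm_GL [simp]: "idm n \<in> GL n" unfolding GL_def by (auto intro!: bexI[of _ "idm n"])
lemma minv_idm [simp]: "minv n (idm n) = idm n" by (rule minv_unique) auto

lemma finite_GL [simp]: "finite (GL n :: 'a::{finite,comm_ring_1} mat set)"
  by (rule finite_subset[OF _ finite_gl]) (auto simp: GL_def)

lemma card_GL_pos: "card (GL n :: 'a::{finite,comm_ring_1} mat set) > 0"
  by (metis card_gt_0_iff finite_GL idm_GL empty_iff)

lemma conjm_gl [simp]: "conjm n g x \<in> gl n" by (simp add: conjm_def)
lemma conjm_idm [simp]: "x \<in> gl n \<Longrightarrow> conjm n (idm n) x = x" by (simp add: conjm_def)
lemma conjm_mmul: "g \<in> GL n \<Longrightarrow> h \<in> GL n \<Longrightarrow> conjm n (mmul n g h) x = conjm n g (conjm n h x)"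
  by (simp add: conjm_def minv_mmul mmul_assoc)
lemma conjm_inv: "g \<in> GL n \<Longrightarrow> x \<in> gl n \<Longrightarrow> conjm n g (conjm n (minv n g) x) = x"
  "g \<in> GL n \<Longrightarrow> x \<in> gl n \<Longrightarrow> conjm n (minv n g) (conjm n g x) = x"
  by (simp_all add: conjm_mmul[symmetric] minv_GL minv_l minv_r)
lemma conjm_add: "conjm n g (x + y) = conjm n g x + conjm n g y"
  by (simp add: conjm_def mmul_add)
lemma conjm_bij: "g \<in> GL n \<Longrightarrow> bij_betw (conjm n g) (gl n) (gl n)"
  by (rule bij_betwI[of _ _ _ "conjm n (minv n g)"]) (auto simp: conjm_inv)

section \<open>Parabolic blocks\<close>

lemma parab_gl: "x \<in> parab k l \<Longrightarrow> x \<in> gl (k+l)" by (simp add: parab_def)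
lemma nilrad_parab: "x \<in> nilrad k l \<Longrightarrow> x \<in> parab k l"
proof -
  assume x: "x \<in> nilrad k l"
  have "x i j = 0" if "k \<le> i" for i j
  proof (rule ccontr)
    assume "x i j \<noteq> 0"
    then have "i < k" using x unfolding nilrad_def by blast
    then show False using that by simp
  qed
  then show ?thesis using x by (simp add: parab_def nilrad_def)
qed
lemma nilrad_gl: "x \<in> nilrad k l \<Longrightarrow> x \<in> gl (k+l)" by (simp add: nilrad_def)
lemma finite_parab [simp]: "finite (parab k l :: 'a::{finite,zero} mat set)"
  by (rule finite_subset[OF _ finite_gl]) (auto simp: parab_def)
lemma finite_nilrad [simp]: "finite (nilrad k l :: 'a::{finite,zero} mat set)"
  by (rule finite_subset[OF _ finite_gl]) (auto simp: nilrad_def)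
lemma blk_gl [simp]: "blk1 k x \<in> gl k" "blk2 k l x \<in> gl l"
  by (auto simp: blk1_def blk2_def gl_def)
lemma idm_parab [simp]: "idm (k+l) \<in> parab k l"
  by (auto simp: parab_def idm_def gl_def)
lemma bdiag_parab [simp]: "bdiag k l x y \<in> parab k l"
  by (auto simp: parab_def gl_def bdiag_def)
lemma bdiag_gl [simp]: "bdiag k l x y \<in> gl (k+l)"
  by (auto simp: gl_def bdiag_def)
lemma blk_idm [simp]: "blk1 k (idm (k+l)) = idm k" "blk2 k l (idm (k+l)) = idm l"
  by (auto simp: blk1_def blk2_def idm_def fun_eq_iff)
lemma blk_bdiag [simp]: "x \<in> gl k \<Longrightarrow> blk1 k (bdiag k l x y) = x" "y \<in> gl l \<Longrightarrow> blk2 k l (bdiag k l x y) = y"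
  by (auto simp: blk1_def blk2_def bdiag_def fun_eq_iff gl_def)
lemma blk_nilrad [simp]: "x \<in> nilrad k l \<Longrightarrow> blk1 k x = 0" "x \<in> nilrad k l \<Longrightarrow> blk2 k l x = 0"
  by (force simp: blk1_def blk2_def nilrad_def fun_eq_iff)+
lemma blk_add: "blk1 k (x + y) = blk1 k x + blk1 k (y :: 'a::comm_ring_1 mat)" "blk2 k l (x + y) = blk2 k l x + blk2 k l y"
  by (auto simp: blk1_def blk2_def fun_eq_iff)
lemma blk_diff: "blk1 k (x - y) = blk1 k x - blk1 k (y :: 'a::comm_ring_1 mat)" "blk2 k l (x - y) = blk2 k l x - blk2 k l y"
  by (auto simp: blk1_def blk2_def fun_eq_iff)
lemma parab_add: "x \<in> parab k l \<Longrightarrow> y \<in> parab k l \<Longrightarrow> x + y \<in> parab k l" for x y :: "'a::comm_ring_1 mat"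
  by (simp add: parab_def gl_add)
lemma parab_diff: "x \<in> parab k l \<Longrightarrow> y \<in> parab k l \<Longrightarrow> x - y \<in> parab k l" for x y :: "'a::comm_ring_1 mat"
  by (simp add: parab_def gl_diff)
lemma nilrad_add: "x \<in> nilrad k l \<Longrightarrow> y \<in> nilrad k l \<Longrightarrow> x + y \<in> nilrad k l" for x y :: "'a::comm_ring_1 mat"
  by (auto simp: nilrad_def gl_add) (metis add.right_neutral)+
lemma nilrad_minus: "x \<in> nilrad k l \<Longrightarrow> - x \<in> nilrad k l" for x :: "'a::comm_ring_1 mat"
  by (auto simp: nilrad_def gl_def)
lemma nilrad_0 [simp]: "0 \<in> nilrad k l"
  by (auto simp: nilrad_def)
lemma nilradI:
  fixes x :: "'a::comm_ring_1 mat"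
  assumes "x \<in> parab k l" "blk1 k x = 0" "blk2 k l x = 0" shows "x \<in> nilrad k l"
proof -
  have "x i j = 0" if "i < k" "j < k" for i j
    using fun_cong[OF fun_cong[OF assms(2)], of i j] that by (simp add: blk1_def)
  moreover have "x i j = 0" if "k \<le> i" "k \<le> j" for i j
  proof (cases "i < k+l \<and> j < k+l")
    case True
    then have "i - k < l" "j - k < l" using that by auto
    then show ?thesis
      using fun_cong[OF fun_cong[OF assms(3)], of "i-k" "j-k"] that by (simp add: blk2_def)
  next case False then show ?thesis using parab_gl[OF assms(1)] by (auto simp: gl_def)
  qed
  moreover have "x i j = 0" if "k \<le> i" "j < k" for i j using assms(1) that by (simp add: parab_def)
  ultimately show ?thesis using parab_gl[OF assms(1)] unfolding nilrad_def
    by (simp add: not_le[symmetric]) (metis not_le)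
qed

lemma sum_split_add: "(\<Sum>m<k+l. f m) = (\<Sum>m<k. f m) + (\<Sum>m<l. f (m+k))" for f :: "nat \<Rightarrow> 'a::comm_monoid_add"
  by (induction l) (auto simp: add_ac)

lemma parab_mmul:
  fixes x y :: "'a::comm_ring_1 mat"
  assumes "x \<in> parab k l" "y \<in> parab k l"
  shows "mmul (k+l) x y \<in> parab k l"
    and blk1_mmul: "blk1 k (mmul (k+l) x y) = mmul k (blk1 k x) (blk1 k y)"
    and blk2_mmul: "blk2 k l (mmul (k+l) x y) = mmul l (blk2 k l x) (blk2 k l y)"
proof -
  have x: "x i j = 0" if "k \<le> i" "j < k" for i j using assms that by (auto simp: parab_def)
  have y: "y i j = 0" if "k \<le> i" "j < k" for i j using assms that by (auto simp: parab_def)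
  show "mmul (k+l) x y \<in> parab k l"
    by (auto simp: parab_def) (auto simp: mmul_def sum_split_add x y)
  show "blk1 k (mmul (k+l) x y) = mmul k (blk1 k x) (blk1 k y)"
    by (auto simp: mmul_def blk1_def fun_eq_iff sum_split_add x y)
  show "blk2 k l (mmul (k+l) x y) = mmul l (blk2 k l x) (blk2 k l y)"
    by (auto simp: mmul_def blk2_def fun_eq_iff sum_split_add x y)
qed

lemma minv_parab:
  fixes g :: "'a::{finite,comm_ring_1} mat"
  assumes "g \<in> Pgrp k l" shows "minv (k+l) g \<in> parab k l"
proof -
  have g: "g \<in> GL (k+l)" "g \<in> parab k l" using assms by (auto simp: Pgrp_def)
  obtain x where "x \<in> parab k l" "mmul (k+l) g x = idm (k+l)"
    using finite_right_inverse[of "parab k l" "k+l" g "minv (k+l) g"] g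
    by (auto simp: parab_mmul minv_l subset_iff dest: parab_gl)
  then show ?thesis using minv_unique[of g "k+l" x] g parab_gl by metis
qed

lemma Pgrp_minv: "g \<in> Pgrp k l \<Longrightarrow> minv (k+l) g \<in> Pgrp k l" for g :: "'a::{finite,comm_ring_1} mat"
  using minv_parab minv_GL unfolding Pgrp_def by auto
lemma Pgrp_mmul: "g \<in> Pgrp k l \<Longrightarrow> h \<in> Pgrp k l \<Longrightarrow> mmul (k+l) g h \<in> Pgrp k l"
  by (auto simp: Pgrp_def GL_mmul parab_mmul)

lemma blk_Pgrp:
  fixes g :: "'a::{finite,comm_ring_1} mat"
  assumes "g \<in> Pgrp k l"
  shows "blk1 k g \<in> GL k" "blk2 k l g \<in> GL l"
    "minv k (blk1 k g) = blk1 k (minv (k+l) g)" "minv l (blk2 k l g) = blk2 k l (minv (k+l) g)"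
proof -
  have g: "g \<in> GL (k+l)" "g \<in> parab k l" using assms by (auto simp: Pgrp_def)
  have *: "mmul k (blk1 k (minv (k+l) g)) (blk1 k g) = idm k" "mmul l (blk2 k l (minv (k+l) g)) (blk2 k l g) = idm l"
    using g blk1_mmul[of "minv (k+l) g" k l g] blk2_mmul[of "minv (k+l) g" k l g]
    by (simp_all add: minv_parab assms minv_l)
  show 1: "blk1 k g \<in> GL k" "blk2 k l g \<in> GL l" using * GL_leftI[OF blk_gl(1) blk_gl(1)] GL_leftI[OF blk_gl(2) blk_gl(2)] by blast+
  show "minv k (blk1 k g) = blk1 k (minv (k+l) g)" "minv l (blk2 k l g) = blk2 k l (minv (k+l) g)"
    using * 1 by (auto intro: minv_unique)
qed

text \<open>Nonzero entries of \<open>u\<close> have row below \<open>k\<close> and column at least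
  \<open>k\<close>, so \<open>u\<close> squares to zero and \<open>idm (k+l) - u\<close> is an
  inverse.\<close>

lemma idm_add_nilrad_GL:
  fixes u :: "'a::{finite,comm_ring_1} mat"
  assumes "u \<in> nilrad k l" shows "idm (k+l) + u \<in> GL (k+l)"
proof -
  have 0: "mmul (k+l) u u = 0"
  proof (intro ext)
    fix i j
    have "\<forall>i j. u i j \<noteq> 0 \<longrightarrow> i < k \<and> k \<le> j" using assms by (simp add: nilrad_def)
    then have "u i m * u m j = 0" for m
      by (metis mult_zero_left mult_zero_right not_le)
    then show "mmul (k+l) u u i j = 0 i j" by (simp add: mmul_def)
  qed
  have u: "u \<in> gl (k+l)" using assms by (rule nilrad_gl)
  have "mmul (k+l) (idm (k+l) - u) (idm (k+l) + u) = idm (k+l)"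
    using u 0 by (simp add: mmul_add mmul_diff)
  then show ?thesis using u by (intro GL_leftI(1)[of _ _ "idm (k+l) - u"]) (auto intro: gl_add gl_diff)
qed

lemma card_Ugrp: "card (Ugrp k l :: 'a::{finite,comm_ring_1} mat set) = card (nilrad k l :: 'a mat set)"
proof -
  have "bij_betw (\<lambda>u. idm (k+l) + u) (nilrad k l) (Ugrp k l :: 'a mat set)"
    by (rule bij_betwI[of _ _ _ "\<lambda>g. g - idm (k+l)"])
       (auto simp: Ugrp_def idm_add_nilrad_GL fun_diff_def fun_eq_iff)
  then show ?thesis by (metis bij_betw_same_card)
qed

text \<open>Multiplying \<open>y\<close> by the block-diagonal matrix of the inverses of its
  diagonal blocks leaves the identity plus an element of \<open>nilrad\<close>, which is invertible.
  Membership in the parabolic group thereby becomes a condition on blocks that can be summed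
  blockwise.\<close>

lemma Pgrp_iff:
  fixes y :: "'a::{finite,comm_ring_1} mat"
  shows "y \<in> Pgrp k l \<longleftrightarrow> y \<in> parab k l \<and> blk1 k y \<in> GL k \<and> blk2 k l y \<in> GL l"
proof (intro iffI conjI)
  assume "y \<in> parab k l \<and> blk1 k y \<in> GL k \<and> blk2 k l y \<in> GL l"
  then have y: "y \<in> parab k l" "blk1 k y \<in> GL k" "blk2 k l y \<in> GL l" by auto
  define h where "h = bdiag k l (minv k (blk1 k y)) (minv l (blk2 k l y))"
  have h: "h \<in> parab k l" "blk1 k h = minv k (blk1 k y)" "blk2 k l h = minv l (blk2 k l y)"
    unfolding h_def using y by (auto simp: minv_gl)
  define u where "u = mmul (k+l) h y - idm (k+l)"
  have "u \<in> nilrad k l" unfolding u_def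
    by (rule nilradI) (auto simp: parab_diff parab_mmul h y blk_diff blk1_mmul blk2_mmul minv_l)
  from idm_add_nilrad_GL[OF this] have G: "mmul (k+l) h y \<in> GL (k+l)" by (simp add: u_def algebra_simps)
  have "mmul (k+l) (mmul (k+l) (minv (k+l) (mmul (k+l) h y)) h) y = idm (k+l)"
    using minv_l[OF G] by (simp only: mmul_assoc)
  then have "y \<in> GL (k+l)" using y parab_gl by (intro GL_leftI(1)[OF _ mmul_gl]) auto
  then show "y \<in> Pgrp k l" using y by (simp add: Pgrp_def)
qed (auto simp: blk_Pgrp, simp add: Pgrp_def)

lemma conjm_parab:
  fixes g :: "'a::{finite,comm_ring_1} mat"
  assumes "g \<in> Pgrp k l" "x \<in> parab k l"
  shows "conjm (k+l) g x \<in> parab k l"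
    "blk1 k (conjm (k+l) g x) = conjm k (blk1 k g) (blk1 k x)"
    "blk2 k l (conjm (k+l) g x) = conjm l (blk2 k l g) (blk2 k l x)"
proof -
  have g: "g \<in> parab k l" using assms by (auto simp: Pgrp_def)
  show "conjm (k+l) g x \<in> parab k l"
    "blk1 k (conjm (k+l) g x) = conjm k (blk1 k g) (blk1 k x)"
    "blk2 k l (conjm (k+l) g x) = conjm l (blk2 k l g) (blk2 k l x)"
    using g assms by (auto simp: conjm_def parab_mmul minv_parab blk1_mmul blk2_mmul blk_Pgrp)
qed

lemma bdiag_Pgrp: "g \<in> GL k \<Longrightarrow> h \<in> GL l \<Longrightarrow> bdiag k l g h \<in> Pgrp k l" for g :: "'a::{finite,comm_ring_1} mat"
  by (auto simp: Pgrp_iff GL_gl)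

lemma parab_decomp:
  fixes y :: "'a::comm_ring_1 mat"
  assumes "y \<in> parab k l" shows "y - bdiag k l (blk1 k y) (blk2 k l y) \<in> nilrad k l"
  by (rule nilradI) (auto simp: parab_diff assms blk_diff)

text \<open>The Levi decomposition as a reindexing of sums. Both the order of the parabolic group
  and the adjunction of induction and restriction come from it.\<close>

lemma sum_parab:
  fixes F :: "'a::{finite,comm_ring_1} mat \<Rightarrow> 'b::comm_monoid_add"
  shows "(\<Sum>y\<in>parab k l. F y) = (\<Sum>x1\<in>gl k. \<Sum>x2\<in>gl l. \<Sum>u\<in>nilrad k l. F (bdiag k l x1 x2 + u))"
proof -
  have "(\<Sum>y\<in>parab k l. F y) = (\<Sum>(x1,x2,u)\<in>gl k \<times> gl l \<times> nilrad k l. F (bdiag k l x1 x2 + u))"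
    by (rule sum.reindex_bij_witness[where j = "\<lambda>y. (blk1 k y, blk2 k l y, y - bdiag k l (blk1 k y) (blk2 k l y))"
          and i = "\<lambda>(x1,x2,u). bdiag k l x1 x2 + u"])
      (auto simp: parab_decomp blk_add nilrad_parab parab_add)
  then show ?thesis by (simp add: sum.cartesian_product)
qed

section \<open>Additive characters\<close>

abbreviation LC :: "nat \<Rightarrow> ('a::{finite,field} mat \<Rightarrow> complex) set" where "LC n \<equiv> {\<psi>. lin_char n \<psi>}"

text \<open>Choose a maximal proper additive subgroup H and t outside H. Every x is h + m t with h in H and m
 unique modulo the characteristic p, and x is sent to exp(2 pi i m / p).\<close>

lemma exists_nontrivial_additive_character:
  "\<exists>\<theta> :: 'a::{finite,field} \<Rightarrow> complex. (\<forall>x y. \<theta> (x + y) = \<theta> x * \<theta> y) \<and>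
     (\<forall>x. \<theta> x \<noteq> 0) \<and> (\<exists>x. \<theta> x \<noteq> 1)"
proof -
  define sg where "sg H \<longleftrightarrow> 0 \<in> H \<and> (\<forall>x\<in>H. \<forall>y\<in>H. x + y \<in> H)" for H :: "'a set"
  define p where "p = CHAR('a)"
  have p: "prime p" unfolding p_def by (rule prime_CHAR_semidom) (simp add: finite_imp_CHAR_pos)
  have p0: "of_nat p = (0::'a)" by (simp add: p_def)
  have mult_in: "of_nat m * x \<in> H" if "sg H" "x \<in> H" for H :: "'a set" and m and x :: 'a
    by (induction m) (use that in \<open>auto simp: sg_def algebra_simps\<close>)
  \<comment> \<open>\<open>sg\<close> demands closure under addition only; in characteristic
    \<open>p\<close> the negative of \<open>x\<close> is its \<open>(p - 1)\<close>-fold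
    sum.\<close>
  have neg_in: "- x \<in> H" if "sg H" "x \<in> H" for H :: "'a set" and x :: 'a
  proof -
    have "of_nat (p - 1) * x = - x"
      using p0 p prime_gt_0_nat[OF p] by (simp add: of_nat_diff)
    then show ?thesis using mult_in[OF that] by metis
  qed
  have "\<exists>H. (sg H \<and> H \<noteq> UNIV) \<and> (\<forall>K. sg K \<and> K \<noteq> UNIV \<longrightarrow> card K \<le> card H)"
  proof (rule ex_has_greatest_nat[where b = "card (UNIV :: 'a set)"])
    show "sg {0::'a} \<and> {0::'a} \<noteq> UNIV"
      by (auto simp: sg_def) (metis UNIV_I singletonD zero_neq_one)
    show "\<forall>K :: 'a set. sg K \<and> K \<noteq> UNIV \<longrightarrow> card K < card (UNIV :: 'a set)"
      by (auto intro!: psubset_card_mono)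
  qed
  then obtain H where H: "sg H" "H \<noteq> UNIV" and max: "\<And>K. sg K \<Longrightarrow> K \<noteq> UNIV \<Longrightarrow> card K \<le> card H"
    by blast
  obtain t where t: "t \<notin> H" using H by auto
  define K where "K = {h + of_nat m * t | h m. h \<in> H}"
  have "sg K" unfolding sg_def
  proof (intro conjI ballI)
    show "0 \<in> K" unfolding K_def using H by (auto simp: sg_def intro!: exI[of _ 0])
    fix x y assume "x \<in> K" "y \<in> K"
    then obtain h m h' m' where "x = h + of_nat m * t" "y = h' + of_nat m' * t" "h \<in> H" "h' \<in> H"
      by (auto simp: K_def)
    then have "x + y = (h + h') + of_nat (m + m') * t" "h + h' \<in> H"
      using H by (auto simp: algebra_simps sg_def)
    then show "x + y \<in> K" unfolding K_def by blast
  qed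
  moreover have "H \<subset> K"
  proof -
    have "h \<in> K" if "h \<in> H" for h unfolding K_def using that by (intro CollectI exI[of _ h] exI[of _ "0::nat"]) simp
    moreover have "t \<in> K" unfolding K_def using H
      by (intro CollectI exI[of _ "0::'a"] exI[of _ "1::nat"]) (simp add: sg_def)
    ultimately show ?thesis using t by auto
  qed
  then have "card H < card K" by (simp add: psubset_card_mono)
  ultimately have K: "K = UNIV" using max[of K] by force
  \<comment> \<open>Were the residues different, a Bezout combination of \<open>p\<close> and
    \<open>m - m'\<close> would exhibit \<open>t\<close> as an integer multiple of
    \<open>h' - h\<close>, which lies in \<open>H\<close>.\<close>
  have key: "m mod p = m' mod p"
    if "h + of_nat m * t = h' + of_nat m' * t" "h \<in> H" "h' \<in> H" for h h' m m'
  proof (rule ccontr)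
    assume ne: "m mod p \<noteq> m' mod p"
    define d where "d = int m - int m'"
    have "\<not> int p dvd d" using ne unfolding d_def by (metis mod_eq_dvd_iff of_nat_eq_iff zmod_int)
    then have "coprime (int p) d" using p by (simp add: prime_imp_coprime)
    then obtain u v where uv: "u * int p + v * d = 1" using bezout_int[of "int p" d] by auto
    have dt: "of_int d * t = h' - h" using that(1) by (simp add: d_def algebra_simps)
    have "h' - h \<in> H" using neg_in[OF H(1) that(2)] H that(3) unfolding sg_def by (metis add_uminus_conv_diff)
    then have dtH: "of_int d * t \<in> H" using dt by simp
    have "of_int v * x \<in> H" if "x \<in> H" for x
    proof (cases "v \<ge> 0")
      case True then show ?thesis using mult_in[OF H(1) that, of "nat v"] by simp
    next
      case False then show ?thesis using neg_in[OF H(1) mult_in[OF H(1) that, of "nat (-v)"]] by simp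
    qed
    then have "of_int v * (of_int d * t) \<in> H" using dtH by blast
    moreover have "of_int v * (of_int d * t) = t"
    proof -
      have "(of_int (u * int p + v * d) :: 'a) = 1" using uv by simp
      then have "of_int v * of_int d = (1::'a)" using p0 by simp
      then show ?thesis by (simp add: mult.assoc[symmetric])
    qed
    ultimately show False using t by simp
  qed
  define \<theta> where "\<theta> x = (SOME z. \<exists>h m. h \<in> H \<and> x = h + of_nat m * t \<and> z = cis (2 * pi * real m / real p))" for x
  have cis_mod: "cis (2 * pi * real m / real p) = cis (2 * pi * real (m mod p) / real p)" for m
  proof -
    have "real m = real (m div p) * real p + real (m mod p)"
      by (metis div_mult_mod_eq of_nat_add of_nat_mult)
    then have "2 * pi * real m / real p = 2 * pi * real (m div p) + 2 * pi * real (m mod p) / real p"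
      using prime_gt_0_nat[OF p] by (simp add: field_simps)
    then show ?thesis by (simp add: cis_mult[symmetric] cis_multiple_2pi)
  qed
  have th: "\<theta> (h + of_nat m * t) = cis (2 * pi * real m / real p)" if "h \<in> H" for h m
    unfolding \<theta>_def
  proof (rule some_equality)
    show "\<exists>h' m'. h' \<in> H \<and> h + of_nat m * t = h' + of_nat m' * t \<and>
        cis (2 * pi * real m / real p) = cis (2 * pi * real m' / real p)" using that by blast
    fix z assume "\<exists>h' m'. h' \<in> H \<and> h + of_nat m * t = h' + of_nat m' * t \<and> z = cis (2 * pi * real m' / real p)"
    then show "z = cis (2 * pi * real m / real p)" using key that cis_mod by metis
  qed
  have "\<theta> (x + y) = \<theta> x * \<theta> y" for x y
  proof -
    have "x \<in> K" "y \<in> K" using K by auto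
    then obtain h m h' m' where e: "x = h + of_nat m * t" "y = h' + of_nat m' * t" "h \<in> H" "h' \<in> H"
      unfolding K_def by blast
    then have "x + y = (h + h') + of_nat (m + m') * t" "h + h' \<in> H"
      using H by (auto simp: algebra_simps sg_def)
    then have "\<theta> (x + y) = cis (2 * pi * real (m + m') / real p)" using th by metis
    then show ?thesis using e th by (simp add: cis_mult ring_distribs add_divide_distrib)
  qed
  moreover have "\<theta> t \<noteq> 1"
  proof
    assume "\<theta> t = 1"
    moreover have "\<theta> t = cis (2 * pi / real p)" using th[of 0 1] H by (simp add: sg_def)
    ultimately have "cos (2 * pi / real p) = 1" by (simp add: complex_eq_iff)
    then obtain i :: int where "2 * pi / real p = of_int i * (2 * pi)" using cos_one_2pi_int by auto
    then have "real_of_int (i * int p) = 1" using prime_gt_0_nat[OF p] by (simp add: field_simps)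
    then have "i * int p = 1" by linarith
    then have "int p dvd 1" by (metis dvd_triv_right)
    then show False using prime_gt_1_nat[OF p] by simp
  qed
  moreover have "\<theta> x \<noteq> 0" for x
  proof -
    obtain h m where "x = h + of_nat m * t" "h \<in> H" using K unfolding K_def by blast
    then show ?thesis using th by simp
  qed
  ultimately show ?thesis by blast
qed

lemma lin_char_0: "lin_char n \<psi> \<Longrightarrow> \<psi> 0 = 1"
  unfolding lin_char_def by (metis (no_types) add_0 gl_0(2) madd_eq_plus mult_cancel_right2)

lemma lin_char_out: "lin_char n \<psi> \<Longrightarrow> x \<notin> gl n \<Longrightarrow> \<psi> x = 0" by (simp add: lin_char_def)
lemma lin_char_add: "lin_char n \<psi> \<Longrightarrow> x \<in> gl n \<Longrightarrow> y \<in> gl n \<Longrightarrow> \<psi> (x + y) = \<psi> x * \<psi> y"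
  by (simp add: lin_char_def madd_eq_plus)

lemma gl_mult_sum_in: "x \<in> gl n \<Longrightarrow> (\<lambda>i j. of_nat m * x i j) \<in> gl n"
  by (simp add: gl_def)

text \<open>Adding a matrix to itself \<open>CHAR('a)\<close> times gives zero. That the values are
  roots of unity yields both their norm and the finiteness of the set of characters.\<close>

lemma lin_char_pow_CHAR:
  fixes x :: "'a::{finite,field} mat"
  assumes "lin_char n \<psi>" "x \<in> gl n" shows "\<psi> x ^ CHAR('a) = 1"
proof -
  have "\<psi> (\<lambda>i j. of_nat m * x i j) = \<psi> x ^ m" for m
  proof (induction m)
    case 0 then show ?case using lin_char_0[OF assms(1)] by (simp add: zero_fun_def)
  next
    case (Suc m)
    have "(\<lambda>i j. of_nat (Suc m) * x i j) = x + (\<lambda>i j. of_nat m * x i j)"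
      by (simp add: fun_eq_iff algebra_simps)
    then show ?case using Suc lin_char_add[OF assms gl_mult_sum_in[OF assms(2)]] by simp
  qed
  from this[of "CHAR('a)"] show ?thesis using lin_char_0[OF assms(1)] by (simp add: zero_fun_def)
qed

lemma lin_char_norm:
  assumes "lin_char n \<psi>" "x \<in> gl n" shows "norm (\<psi> x) = 1"
proof -
  have "CHAR('a) > 0" by (simp add: finite_imp_CHAR_pos)
  moreover have "norm (\<psi> x) ^ CHAR('a) = 1"
    unfolding norm_power[symmetric] lin_char_pow_CHAR[OF assms] by simp
  ultimately show ?thesis
    using power_eq_imp_eq_base[of "norm (\<psi> x)" "CHAR('a)" 1] by simp
qed

lemma lin_char_cnj: "lin_char n \<psi> \<Longrightarrow> x \<in> gl n \<Longrightarrow> cnj (\<psi> x) * \<psi> x = 1"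
  using lin_char_norm[of n \<psi> x] complex_norm_square[of "\<psi> x"] by (simp add: mult.commute)

lemma finite_LC [simp]: "finite (LC n :: ('a::{finite,field} mat \<Rightarrow> complex) set)"
proof (rule finite_subset)
  let ?R = "insert 0 {z::complex. z ^ CHAR('a) = 1}"
  have "CHAR('a) > 0" by (simp add: finite_imp_CHAR_pos)
  then have "finite ?R" using finite_roots_unity[of "CHAR('a)"] by simp
  then show "finite {f :: 'a mat \<Rightarrow> complex. \<forall>x. (x \<in> gl n \<longrightarrow> f x \<in> ?R) \<and> (x \<notin> gl n \<longrightarrow> f x = 0)}"
    by (intro finite_set_of_finite_funs) auto
  show "LC n \<subseteq> {f :: 'a mat \<Rightarrow> complex. \<forall>x. (x \<in> gl n \<longrightarrow> f x \<in> ?R) \<and> (x \<notin> gl n \<longrightarrow> f x = 0)}"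
    by (simp add: subset_iff lin_char_out lin_char_pow_CHAR)
qed

lemma lin_char_mult:
  assumes "lin_char n \<psi>" "lin_char n \<phi>" shows "lin_char n (\<lambda>x. \<psi> x * \<phi> x)"
  using assms unfolding lin_char_def by auto

lemma lin_char_conj: "lin_char n \<psi> \<Longrightarrow> lin_char n (\<lambda>x. cnj (\<psi> x))"
  unfolding lin_char_def by auto

text \<open>Translation by an element \<open>a\<close> with \<open>\<psi> a \<noteq> 1\<close>
  permutes \<open>S\<close> and multiplies the sum by \<open>\<psi> a\<close>. The set is arbitrary
  because nilradicals are summed over in the same way when positivity is proved.\<close>

lemma sum_additive_char:
  fixes \<psi> :: "'b::ab_group_add \<Rightarrow> complex"
  assumes "finite S" "\<And>x y. x \<in> S \<Longrightarrow> y \<in> S \<Longrightarrow> x + y \<in> S"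
    "\<And>x y. x \<in> S \<Longrightarrow> y \<in> S \<Longrightarrow> \<psi> (x + y) = \<psi> x * \<psi> y"
  shows "sum \<psi> S = (if \<forall>x\<in>S. \<psi> x = 1 then of_nat (card S) else 0)"
proof (cases "\<forall>x\<in>S. \<psi> x = 1")
  case False
  then obtain a where a: "a \<in> S" "\<psi> a \<noteq> 1" by blast
  have "(+) a ` S = S" using assms a by (intro endo_inj_surj) auto
  then have "sum \<psi> S = sum \<psi> ((+) a ` S)" by simp
  also have "\<dots> = (\<Sum>x\<in>S. \<psi> (a + x))" by (subst sum.reindex) auto
  also have "\<dots> = \<psi> a * sum \<psi> S" using assms a by (simp add: sum_distrib_left)
  finally have "(1 - \<psi> a) * sum \<psi> S = 0" by (simp add: algebra_simps)
  then have "sum \<psi> S = 0" using a by simp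
  then show ?thesis using False by metis
qed simp

lemma sum_lin_char: "lin_char n \<psi> \<Longrightarrow>
   (\<Sum>x\<in>gl n. \<psi> x) = (if \<forall>x\<in>gl n. \<psi> x = 1 then of_nat (card (gl n :: 'a::{finite,field} mat set)) else 0)"
  for \<psi> :: "'a::{finite,field} mat \<Rightarrow> complex"
  by (rule sum_additive_char) (auto simp: gl_add lin_char_add)

lemma lin_char_orth:
  fixes \<psi> \<phi> :: "'a::{finite,field} mat \<Rightarrow> complex"
  assumes "lin_char n \<psi>" "lin_char n \<phi>"
  shows "(\<Sum>x\<in>gl n. \<psi> x * cnj (\<phi> x)) = (if \<psi> = \<phi> then of_nat (card (gl n :: 'a mat set)) else 0)"
proof -
  have "\<psi> x = \<phi> x" if "\<forall>x\<in>gl n. \<psi> x * cnj (\<phi> x) = 1" for x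
  proof (cases "x \<in> gl n")
    case True
    then have "\<psi> x * (cnj (\<phi> x) * \<phi> x) = \<phi> x" using that by (simp add: mult.assoc[symmetric])
    then show ?thesis using lin_char_cnj[OF assms(2) True] by simp
  qed (simp add: lin_char_out[OF assms(1)] lin_char_out[OF assms(2)])
  then have "(\<forall>x\<in>gl n. \<psi> x * cnj (\<phi> x) = 1) \<longleftrightarrow> \<psi> = \<phi>"
    using lin_char_cnj[OF assms(2)] by (auto simp: mult.commute)
  then show ?thesis using sum_lin_char[OF lin_char_mult[OF assms(1) lin_char_conj[OF assms(2)]]] by simp
qed

lemma lin_char_separate:
  fixes x :: "'a::{finite,field} mat"
  assumes "x \<in> gl n" "x \<noteq> 0" shows "\<exists>\<psi>. lin_char n \<psi> \<and> \<psi> x \<noteq> 1"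
proof -
  obtain i j where ij: "x i j \<noteq> 0" using assms(2) by (auto simp: fun_eq_iff)
  obtain \<theta> :: "'a \<Rightarrow> complex" and t where th: "\<And>x y. \<theta> (x + y) = \<theta> x * \<theta> y" "\<theta> t \<noteq> 1"
    and n0: "\<And>x. \<theta> x \<noteq> 0"
    using exists_nontrivial_additive_character by metis
  \<comment> \<open>The factor \<open>t / x i j\<close> moves the nonzero entry of \<open>x\<close>
    to \<open>t\<close>, where \<open>\<theta>\<close> is not 1.\<close>
  define \<psi> where "\<psi> y = (if y \<in> gl n then \<theta> (t / x i j * y i j) else 0)" for y
  have "lin_char n \<psi>" unfolding lin_char_def \<psi>_def
    using n0 by (auto simp: madd_eq_plus gl_add distrib_left th)
  moreover have "\<psi> x \<noteq> 1" using assms ij th by (simp add: \<psi>_def)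
  ultimately show ?thesis by blast
qed

lemma triv_lin_char: "lin_char n (\<lambda>x. if x \<in> gl n then 1 else 0)"
  by (auto simp: lin_char_def madd_eq_plus gl_add)

text \<open>The translation argument on the dual side: multiplication by a character
  \<open>\<phi>\<close> with \<open>\<phi> x \<noteq> 1\<close> permutes all characters and scales
  the sum by \<open>\<phi> x\<close>.\<close>

lemma LC_dual_orth_aux:
  fixes x :: "'a::{finite,field} mat"
  assumes "x \<in> gl n"
  shows "(\<Sum>\<psi>\<in>LC n. \<psi> x) = (if x = 0 then of_nat (card (LC n :: ('a mat \<Rightarrow> complex) set)) else 0)"
proof (cases "x = 0")
  case True then show ?thesis by (simp add: lin_char_0)
next
  case False
  then obtain \<phi> where phi: "lin_char n \<phi>" "\<phi> x \<noteq> 1" using lin_char_separate assms by blast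
  define m where "m \<psi> = (\<lambda>x. \<phi> x * \<psi> x)" for \<psi> :: "'a mat \<Rightarrow> complex"
  have "inj_on m (LC n)"
  proof (rule inj_onI)
    fix \<psi> \<psi>' assume *: "\<psi> \<in> LC n" "\<psi>' \<in> LC n" "m \<psi> = m \<psi>'"
    have "\<psi> y = \<psi>' y" for y
      using fun_cong[OF *(3), of y] * phi by (cases "y \<in> gl n") (auto simp: m_def lin_char_def)
    then show "\<psi> = \<psi>'" by auto
  qed
  moreover have "m ` LC n \<subseteq> LC n" using phi by (auto simp: m_def lin_char_mult)
  ultimately have eq: "m ` LC n = LC n" by (intro endo_inj_surj) auto
  have "(\<Sum>\<psi>\<in>LC n. \<psi> x) = (\<Sum>\<psi>\<in>m ` LC n. \<psi> x)" by (simp only: eq)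
  also have "\<dots> = (\<Sum>\<psi>\<in>LC n. m \<psi> x)" using \<open>inj_on m (LC n)\<close> by (subst sum.reindex) auto
  also have "\<dots> = \<phi> x * (\<Sum>\<psi>\<in>LC n. \<psi> x)" by (simp add: m_def sum_distrib_left)
  finally have "(1 - \<phi> x) * (\<Sum>\<psi>\<in>LC n. \<psi> x) = 0" by (simp add: algebra_simps)
  then show ?thesis using phi False by simp
qed

text \<open>The sum of \<open>\<psi> x\<close> over all matrices and all characters is evaluated in
  both orders: in one only \<open>x = 0\<close> contributes, in the other only the trivial
  character.\<close>

lemma card_LC: "card (LC n :: ('a::{finite,field} mat \<Rightarrow> complex) set) = card (gl n :: 'a mat set)"
proof -
  let ?t = "\<lambda>x :: 'a mat. if x \<in> gl n then 1 else 0 :: complex"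
  have t: "(\<forall>x\<in>gl n. \<psi> x = 1) \<longleftrightarrow> \<psi> = ?t" if "lin_char n \<psi>" for \<psi> :: "'a mat \<Rightarrow> complex"
    using that by (auto simp: lin_char_out)
  have "(of_nat (card (LC n :: ('a mat \<Rightarrow> complex) set)) :: complex) = (\<Sum>x\<in>gl n. \<Sum>\<psi>\<in>LC n. \<psi> (x :: 'a mat))"
    by (subst sum.cong[OF refl LC_dual_orth_aux]) (auto simp: sum.delta)
  also have "\<dots> = (\<Sum>\<psi>\<in>LC n. \<Sum>x\<in>gl n. \<psi> (x :: 'a mat))" by (rule sum.swap)
  also have "\<dots> = (\<Sum>\<psi>\<in>LC n. if \<psi> = ?t then of_nat (card (gl n :: 'a mat set)) else 0)"
    by (intro sum.cong) (simp_all add: sum_lin_char t)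
  also have "\<dots> = of_nat (card (gl n :: 'a mat set))"
    by (simp add: sum.delta triv_lin_char)
  finally show ?thesis by simp
qed

lemma lin_char_minus: "lin_char n \<psi> \<Longrightarrow> x \<in> gl n \<Longrightarrow> y \<in> gl n \<Longrightarrow> \<psi> (x - y) = \<psi> x * cnj (\<psi> y)"
  using lin_char_add[of n \<psi> "x - y" y] lin_char_cnj[of n \<psi> y]
  by (simp add: gl_diff mult.assoc) (metis mult.commute)

text \<open>Fourier inversion: \<open>\<psi> x * cnj (\<psi> y) = \<psi> (x - y)\<close> turns the
  sum over characters into a delta at \<open>y = x\<close>, and \<open>card_LC\<close> matches the
  normalizations.\<close>

lemma LC_expansion:
  fixes f :: "'a::{finite,field} mat \<Rightarrow> complex"
  assumes "\<And>x. x \<notin> gl n \<Longrightarrow> f x = 0"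
  shows "f x = (\<Sum>\<psi>\<in>LC n. (\<Sum>y\<in>gl n. f y * cnj (\<psi> y)) / of_nat (card (gl n :: 'a mat set)) * \<psi> x)"
proof (cases "x \<in> gl n")
  case True
  let ?N = "of_nat (card (gl n :: 'a mat set)) :: complex"
  have N: "?N \<noteq> 0" using card_gt_0_iff[of "gl n :: 'a mat set"] gl_0 by fastforce
  have "(\<Sum>\<psi>\<in>LC n. (\<Sum>y\<in>gl n. f y * cnj (\<psi> y)) / ?N * \<psi> x)
     = (\<Sum>\<psi>\<in>LC n. \<Sum>y\<in>gl n. f y / ?N * \<psi> (x - y))"
    using True by (intro sum.cong refl)
      (simp add: sum_divide_distrib sum_distrib_left sum_distrib_right lin_char_minus mult_ac cong: sum.cong)
  also have "\<dots> = (\<Sum>y\<in>gl n. f y / ?N * (\<Sum>\<psi>\<in>LC n. \<psi> (x - y)))"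
    by (subst sum.swap) (simp add: sum_distrib_left)
  also have "\<dots> = (\<Sum>y\<in>gl n. if x = y then f y else 0)"
    using True N by (intro sum.cong refl) (simp add: LC_dual_orth_aux gl_diff card_LC)
  also have "\<dots> = f x" using True by simp
  finally show ?thesis by simp
next
  case False then show ?thesis using assms by (simp add: lin_char_out)
qed

section \<open>Irreducible invariant characters\<close>

text \<open>The first clause identifies a function on gl_n with its extension by zero, so that
  equalities on gl_n become equalities of HOL functions.\<close>

definition classfun :: "nat \<Rightarrow> ('a::{finite,field} mat \<Rightarrow> complex) \<Rightarrow> bool" where
  "classfun n f \<longleftrightarrow> (\<forall>x. x \<notin> gl n \<longrightarrow> f x = 0) \<and> (\<forall>g\<in>GL n. \<forall>x\<in>gl n. f (conjm n g x) = f x)"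

definition cact :: "nat \<Rightarrow> 'a::{finite,field} mat \<Rightarrow> ('a mat \<Rightarrow> complex) \<Rightarrow> 'a mat \<Rightarrow> complex" where
  "cact n g \<psi> = (\<lambda>x. if x \<in> gl n then \<psi> (conjm n g x) else 0)"

definition orb :: "nat \<Rightarrow> ('a::{finite,field} mat \<Rightarrow> complex) \<Rightarrow> ('a mat \<Rightarrow> complex) set" where
  "orb n \<psi> = (\<lambda>g. cact n g \<psi>) ` GL n"

lemma cact_lin_char: "lin_char n \<psi> \<Longrightarrow> lin_char n (cact n g \<psi>)"
  unfolding lin_char_def cact_def by (auto simp: madd_eq_plus gl_add conjm_add)

text \<open>Precomposition is a right action, so the two factors change places.\<close>

lemma cact_cact: "g \<in> GL n \<Longrightarrow> h \<in> GL n \<Longrightarrow> cact n g (cact n h \<psi>) = cact n (mmul n h g) \<psi>"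
  by (simp add: cact_def fun_eq_iff conjm_mmul)

lemma cact_idm: "lin_char n \<psi> \<Longrightarrow> cact n (idm n) \<psi> = \<psi>"
  by (auto simp: cact_def fun_eq_iff lin_char_out)

lemma orb_subset: "lin_char n \<psi> \<Longrightarrow> orb n \<psi> \<subseteq> LC n"
  by (auto simp: orb_def cact_lin_char)

lemma orb_refl: "lin_char n \<psi> \<Longrightarrow> \<psi> \<in> orb n \<psi>"
  unfolding orb_def using cact_idm[of n \<psi>] idm_GL by (metis image_eqI)

lemma orb_cact: "\<phi> \<in> orb n \<psi> \<Longrightarrow> h \<in> GL n \<Longrightarrow> cact n h \<phi> \<in> orb n \<psi>"
  by (auto simp: orb_def cact_cact GL_mmul)

lemma orb_eq:
  assumes "lin_char n \<psi>" "\<phi> \<in> orb n \<psi>" shows "orb n \<phi> = orb n \<psi>"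
proof -
  obtain g where g: "g \<in> GL n" "\<phi> = cact n g \<psi>" using assms by (auto simp: orb_def)
  have "\<psi> = cact n (minv n g) \<phi>"
    using g by (simp add: cact_cact minv_GL minv_r cact_idm assms)
  then have "\<psi> \<in> orb n \<phi>" using g by (simp add: orb_def minv_GL)
  moreover have "orb n \<beta> \<subseteq> orb n \<alpha>" if "\<beta> \<in> orb n \<alpha>" for \<alpha> \<beta>
    using orb_cact[OF that] by (auto simp: orb_def[of n \<beta>])
  ultimately show ?thesis using assms(2) by blast
qed

lemma finite_orb [simp]: "finite (orb n \<psi>)" by (simp add: orb_def)

lemma orb_disjoint:
  "lin_char n \<psi> \<Longrightarrow> lin_char n \<phi> \<Longrightarrow> orb n \<psi> \<noteq> orb n \<phi> \<Longrightarrow> orb n \<psi> \<inter> orb n \<phi> = {}"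
  using orb_eq by blast

lemma sum_conjm:
  fixes F :: "'a::{finite,comm_ring_1} mat \<Rightarrow> 'b::comm_monoid_add"
  assumes "g \<in> GL n" shows "(\<Sum>x\<in>gl n. F (conjm n g x)) = (\<Sum>x\<in>gl n. F x)"
  by (rule sum.reindex_bij_betw[OF conjm_bij[OF assms]])

lemma classfun_cact_coeff:
  assumes "classfun n f" "g \<in> GL n"
  shows "(\<Sum>x\<in>gl n. f x * cnj (cact n g \<psi> x)) = (\<Sum>x\<in>gl n. f x * cnj (\<psi> x))"
proof -
  have "(\<Sum>x\<in>gl n. f x * cnj (cact n g \<psi> x)) = (\<Sum>x\<in>gl n. f (conjm n g x) * cnj (\<psi> (conjm n g x)))"
    using assms by (intro sum.cong) (auto simp: cact_def classfun_def)
  also have "\<dots> = (\<Sum>x\<in>gl n. f x * cnj (\<psi> x))"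
    using sum_conjm[OF assms(2), of "\<lambda>x. f x * cnj (\<psi> x)"] .
  finally show ?thesis .
qed

definition osum :: "('a mat \<Rightarrow> complex) set \<Rightarrow> 'a mat \<Rightarrow> complex" where
  "osum S x = (\<Sum>\<psi>\<in>S. \<psi> x)"

lemma classfun_orb:
  assumes "lin_char n \<psi>" shows "classfun n (osum (orb n \<psi>))"
  unfolding classfun_def
proof (intro conjI allI ballI impI)
  fix x :: "'a mat" assume "x \<notin> gl n"
  then show "osum (orb n \<psi>) x = 0" unfolding osum_def
    using orb_subset[OF assms] lin_char_out by (intro sum.neutral) blast
next
  fix g x :: "'a mat" assume g: "g \<in> GL n" and x: "x \<in> gl n"
  have inv: "cact n (minv n g) (cact n g \<phi>) = \<phi>" "cact n g (cact n (minv n g) \<phi>) = \<phi>" if "\<phi> \<in> orb n \<psi>" for \<phi>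
    using g that orb_subset[OF assms] by (auto simp: cact_cact minv_GL minv_r minv_l cact_idm)
  have "osum (orb n \<psi>) (conjm n g x) = (\<Sum>\<phi>\<in>orb n \<psi>. cact n g \<phi> x)"
    using x by (simp add: cact_def osum_def)
  also have "\<dots> = (\<Sum>\<phi>\<in>orb n \<psi>. \<phi> x)"
    by (rule sum.reindex_bij_witness[where i = "cact n (minv n g)" and j = "cact n g"])
       (auto simp: inv orb_cact g minv_GL)
  finally show "osum (orb n \<psi>) (conjm n g x) = osum (orb n \<psi>) x" by (simp add: osum_def)
qed

lemma coeff_comb:
  fixes m :: "('a::{finite,field} mat \<Rightarrow> complex) \<Rightarrow> complex"
  assumes "lin_char n \<phi>"
  shows "(\<Sum>x\<in>gl n. (\<Sum>\<psi>\<in>LC n. m \<psi> * \<psi> x) * cnj (\<phi> x)) = m \<phi> * of_nat (card (gl n :: 'a mat set))"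
proof -
  have "(\<Sum>x\<in>gl n. (\<Sum>\<psi>\<in>LC n. m \<psi> * \<psi> x) * cnj (\<phi> x)) = (\<Sum>\<psi>\<in>LC n. m \<psi> * (\<Sum>x\<in>gl n. \<psi> x * cnj (\<phi> x)))"
    by (simp add: sum_distrib_right sum_distrib_left mult.assoc) (rule sum.swap)
  also have "\<dots> = (\<Sum>\<psi>\<in>LC n. if \<psi> = \<phi> then m \<psi> * of_nat (card (gl n :: 'a mat set)) else 0)"
    by (intro sum.cong refl) (simp add: lin_char_orth assms)
  finally show ?thesis using assms by simp
qed

lemma card_gl_pos: "card (gl n :: 'a::{finite,zero} mat set) > 0"
  using card_gt_0_iff[of "gl n :: 'a mat set"] gl_0 by fastforce

lemma gl_nonempty [simp]: "gl n \<noteq> {}" using gl_0 by blast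
lemma GL_nonempty [simp]: "GL n \<noteq> {}" using idm_GL by blast

lemma sum_indicator_LC:
  assumes "S \<subseteq> LC n" shows "(\<Sum>\<psi>\<in>LC n. of_nat (if \<psi> \<in> S then 1 else 0) * \<psi> x) = osum S x"
proof -
  have "(\<Sum>\<psi>\<in>LC n. of_nat (if \<psi> \<in> S then 1 else 0) * \<psi> x) = (\<Sum>\<psi>\<in>S. of_nat (if \<psi> \<in> S then 1 else 0) * \<psi> x)"
    using assms by (intro sum.mono_neutral_right) auto
  then show ?thesis by (simp add: osum_def)
qed

lemma inv_charI:
  assumes "\<forall>\<psi>. m \<psi> \<noteq> 0 \<longrightarrow> lin_char n \<psi>" "\<And>x. f x = (\<Sum>\<psi>\<in>LC n. of_nat (m \<psi>) * \<psi> x)" "classfun n f"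
  shows "inv_char n f"
  using assms unfolding inv_char_def is_char_def classfun_def by (auto intro!: exI[of _ m])

text \<open>The multiplicities are, up to the factor |gl_n|, the Fourier coefficients of
  \<open>\<chi>\<close>. Invariance of \<open>\<chi>\<close> makes those constant along each orbit
  of linear characters.\<close>

lemma inv_charE:
  fixes \<chi> :: "'a::{finite,field} mat \<Rightarrow> complex"
  assumes "inv_char n \<chi>"
  obtains m where "\<forall>\<psi>. m \<psi> \<noteq> 0 \<longrightarrow> lin_char n \<psi>" "\<And>x. \<chi> x = (\<Sum>\<psi>\<in>LC n. of_nat (m \<psi>) * \<psi> x)"
    "classfun n \<chi>" "\<And>\<psi> \<phi>. lin_char n \<psi> \<Longrightarrow> \<phi> \<in> orb n \<psi> \<Longrightarrow> m \<phi> = m \<psi>"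
proof -
  obtain m where m: "\<forall>\<psi>. m \<psi> \<noteq> 0 \<longrightarrow> lin_char n \<psi>" "\<chi> = (\<lambda>x. \<Sum>\<psi>\<in>LC n. of_nat (m \<psi>) * \<psi> x)"
    using assms unfolding inv_char_def is_char_def by blast
  have c: "classfun n \<chi>" unfolding classfun_def
    using assms m by (auto simp: inv_char_def lin_char_out)
  have "m \<phi> = m \<psi>" if "lin_char n \<psi>" "\<phi> \<in> orb n \<psi>" for \<psi> \<phi>
  proof -
    obtain g where g: "g \<in> GL n" "\<phi> = cact n g \<psi>" using \<open>\<phi> \<in> orb n \<psi>\<close> unfolding orb_def by blast
    have phi: "lin_char n \<phi>" using that orb_subset by blast
    have "of_nat (m \<phi>) * of_nat (card (gl n :: 'a mat set)) = (of_nat (m \<psi>) * of_nat (card (gl n :: 'a mat set)) :: complex)"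
      using classfun_cact_coeff[OF c g(1), of \<psi>] coeff_comb[OF phi, of "\<lambda>\<psi>. of_nat (m \<psi>)"]
        coeff_comb[OF that(1), of "\<lambda>\<psi>. of_nat (m \<psi>)"] by (auto simp: m(2) g(2))
    moreover have "of_nat (card (gl n :: 'a mat set)) \<noteq> (0::complex)" using card_gl_pos[of n, where 'a = 'a] by simp
    ultimately show ?thesis by (metis mult_right_cancel of_nat_eq_iff)
  qed
  then show thesis using that[OF m(1) _ c] m(2) by simp
qed

lemma inv_char_orb: assumes "lin_char n \<psi>" shows "inv_char n (osum (orb n \<psi>))"
proof (rule inv_charI)
  show "\<forall>\<phi>. (if \<phi> \<in> orb n \<psi> then 1 else 0 :: nat) \<noteq> 0 \<longrightarrow> lin_char n \<phi>"
    using orb_subset[OF assms] by auto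
  show "osum (orb n \<psi>) x = (\<Sum>\<phi>\<in>LC n. of_nat (if \<phi> \<in> orb n \<psi> then 1 else 0) * \<phi> x)" for x
    using sum_indicator_LC[OF orb_subset[OF assms]] by metis
qed (rule classfun_orb[OF assms])

lemma osum_orb_0:
  assumes "lin_char n \<psi>" shows "osum (orb n \<psi>) 0 = of_nat (card (orb n \<psi>))"
proof -
  have "osum (orb n \<psi>) 0 = (\<Sum>\<phi>\<in>orb n \<psi>. 1)"
    unfolding osum_def using orb_subset[OF assms] lin_char_0 by (intro sum.cong) auto
  then show ?thesis by simp
qed

lemma card_orb_pos: "lin_char n \<psi> \<Longrightarrow> card (orb n \<psi>) > 0"
  using orb_refl by (auto simp: card_gt_0_iff)

lemma osum_orb_nonzero: "lin_char n \<psi> \<Longrightarrow> osum (orb n \<psi>) \<noteq> (\<lambda>x. 0)"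
proof
  assume "lin_char n \<psi>" "osum (orb n \<psi>) = (\<lambda>x. 0)"
  then show False using osum_orb_0[of n \<psi>] card_orb_pos[of n \<psi>] by simp
qed

text \<open>If \<open>\<psi>\<close> occurs in \<open>\<chi>\<close>, its whole orbit does, and
  subtracting the orbit sum leaves an invariant character, which irreducibility forces to vanish.
  Conversely, the multiplicities of two summands of an orbit sum add up to the indicator of the
  orbit; each is constant on the orbit, so if both summands are nonzero the total at
  \<open>\<psi>\<close> is at least 2.\<close>

lemma irr_inv_char_iff:
  fixes \<chi> :: "'a::{finite,field} mat \<Rightarrow> complex"
  shows "irr_inv_char n \<chi> \<longleftrightarrow> (\<exists>\<psi>. lin_char n \<psi> \<and> \<chi> = osum (orb n \<psi>))"
proof
  assume irr: "irr_inv_char n \<chi>"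
  then have inv: "inv_char n \<chi>" by (simp add: irr_inv_char_def)
  obtain m where m: "\<forall>\<psi>. m \<psi> \<noteq> 0 \<longrightarrow> lin_char n \<psi>" "\<And>x. \<chi> x = (\<Sum>\<psi>\<in>LC n. of_nat (m \<psi>) * \<psi> x)"
    "classfun n \<chi>" "\<And>\<psi> \<phi>. lin_char n \<psi> \<Longrightarrow> \<phi> \<in> orb n \<psi> \<Longrightarrow> m \<phi> = m \<psi>"
    by (rule inv_charE[OF inv]) (rule that, assumption+)
  have "\<exists>\<psi>. m \<psi> \<noteq> 0"
  proof (rule ccontr)
    assume "\<not> ?thesis"
    then have "\<chi> = (\<lambda>x. 0)" using m(2) by auto
    then show False using irr by (simp add: irr_inv_char_def)
  qed
  then obtain \<psi> where psi: "m \<psi> \<noteq> 0" "lin_char n \<psi>" using m by blast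
  define f where "f x = \<chi> x - osum (orb n \<psi>) x" for x
  \<comment> \<open>This natural subtraction never truncates: the multiplicity is nonzero at
    \<open>\<psi>\<close> and constant on its orbit.\<close>
  define m' where "m' \<phi> = m \<phi> - (if \<phi> \<in> orb n \<psi> then 1 else 0)" for \<phi>
  have ge: "(if \<phi> \<in> orb n \<psi> then 1 else 0) \<le> m \<phi>" for \<phi> using m(4)[OF psi(2)] psi(1) by auto
  have "inv_char n f"
  proof (rule inv_charI[where m = m'])
    show "\<forall>\<psi>. m' \<psi> \<noteq> 0 \<longrightarrow> lin_char n \<psi>" using m(1) by (auto simp: m'_def split: if_splits)
    show "classfun n f" using m(3) classfun_orb[OF psi(2)] by (auto simp: classfun_def f_def)
    fix x show "f x = (\<Sum>\<psi>\<in>LC n. of_nat (m' \<psi>) * \<psi> x)"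
      unfolding f_def m(2) sum_indicator_LC[OF orb_subset[OF psi(2)], symmetric] m'_def
      using ge by (simp only: of_nat_diff sum_subtractf[symmetric] left_diff_distrib)
  qed
  moreover have "\<chi> = (\<lambda>x. osum (orb n \<psi>) x + f x)" by (simp add: f_def)
  ultimately have "f = (\<lambda>x. 0)"
    using irr inv_char_orb[OF psi(2)] osum_orb_nonzero[OF psi(2)] unfolding irr_inv_char_def by blast
  then have "\<chi> = osum (orb n \<psi>)" by (auto simp: f_def fun_eq_iff)
  then show "\<exists>\<psi>. lin_char n \<psi> \<and> \<chi> = osum (orb n \<psi>)" using psi by blast
next
  assume "\<exists>\<psi>. lin_char n \<psi> \<and> \<chi> = osum (orb n \<psi>)"
  then obtain \<psi> where psi: "lin_char n \<psi>" and chi: "\<chi> = osum (orb n \<psi>)" by blast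
  have False if *: "inv_char n \<chi>1" "inv_char n \<chi>2" "\<chi>1 \<noteq> (\<lambda>x. 0)" "\<chi>2 \<noteq> (\<lambda>x. 0)" "\<chi> = (\<lambda>x. \<chi>1 x + \<chi>2 x)" for \<chi>1 \<chi>2
  proof -
    obtain m1 where m1: "\<forall>\<psi>. m1 \<psi> \<noteq> 0 \<longrightarrow> lin_char n \<psi>" "\<And>x. \<chi>1 x = (\<Sum>\<psi>\<in>LC n. of_nat (m1 \<psi>) * \<psi> x)"
      "\<And>\<psi> \<phi>. lin_char n \<psi> \<Longrightarrow> \<phi> \<in> orb n \<psi> \<Longrightarrow> m1 \<phi> = m1 \<psi>" by (rule inv_charE[OF *(1)]) (rule that, assumption+)
    obtain m2 where m2: "\<forall>\<psi>. m2 \<psi> \<noteq> 0 \<longrightarrow> lin_char n \<psi>" "\<And>x. \<chi>2 x = (\<Sum>\<psi>\<in>LC n. of_nat (m2 \<psi>) * \<psi> x)"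
      "\<And>\<psi> \<phi>. lin_char n \<psi> \<Longrightarrow> \<phi> \<in> orb n \<psi> \<Longrightarrow> m2 \<phi> = m2 \<psi>" by (rule inv_charE[OF *(2)]) (rule that, assumption+)
    have s: "m1 \<phi> + m2 \<phi> = (if \<phi> \<in> orb n \<psi> then 1 else 0)" if phi: "lin_char n \<phi>" for \<phi>
    proof -
      have "\<chi> x = (\<Sum>\<psi>\<in>LC n. of_nat (m1 \<psi> + m2 \<psi>) * \<psi> x)" for x
        by (simp add: *(5) m1(2) m2(2) sum.distrib[symmetric] distrib_right)
      moreover have "\<chi> x = (\<Sum>\<phi>\<in>LC n. of_nat (if \<phi> \<in> orb n \<psi> then 1 else 0) * \<phi> x)" for x
        unfolding sum_indicator_LC[OF orb_subset[OF psi]] by (simp add: chi)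
      ultimately have "of_nat (m1 \<phi> + m2 \<phi>) * of_nat (card (gl n :: 'a mat set)) =
         (of_nat (if \<phi> \<in> orb n \<psi> then 1 else 0) * of_nat (card (gl n :: 'a mat set)) :: complex)"
        using coeff_comb[OF phi, of "\<lambda>\<psi>. of_nat (m1 \<psi> + m2 \<psi>)"]
          coeff_comb[OF phi, of "\<lambda>\<phi>. of_nat (if \<phi> \<in> orb n \<psi> then 1 else 0)"] by presburger
      moreover have "complex_of_nat (card (gl n :: 'a mat set)) \<noteq> 0" by simp
      ultimately have "complex_of_nat (m1 \<phi> + m2 \<phi>) = of_nat (if \<phi> \<in> orb n \<psi> then 1 else 0)"
        by (rule mult_right_cancel[THEN iffD1, rotated])
      then show ?thesis by (simp only: of_nat_eq_iff)
    qed
    have ex: "\<exists>\<phi>. m1 \<phi> \<noteq> 0" "\<exists>\<phi>. m2 \<phi> \<noteq> 0" using *(3,4) m1(2) m2(2) by auto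
    then obtain \<phi>1 \<phi>2 where "m1 \<phi>1 \<noteq> 0" "m2 \<phi>2 \<noteq> 0" by blast
    moreover from this have "\<phi>1 \<in> orb n \<psi>" "\<phi>2 \<in> orb n \<psi>"
      using s[of \<phi>1] s[of \<phi>2] m1(1) m2(1) by (auto split: if_splits)
    ultimately have "m1 \<psi> \<noteq> 0" "m2 \<psi> \<noteq> 0" using m1(3)[OF psi] m2(3)[OF psi] by metis+
    then show False using s[OF psi] by (auto split: if_splits)
  qed
  note no_split = this
  show "irr_inv_char n \<chi>" unfolding irr_inv_char_def
  proof (intro conjI notI)
    show "inv_char n \<chi>" unfolding chi by (rule inv_char_orb[OF psi])
    show False if "\<chi> = (\<lambda>x. 0)" using that osum_orb_nonzero[OF psi] chi by simp
    show False if "\<exists>\<chi>1 \<chi>2. inv_char n \<chi>1 \<and> inv_char n \<chi>2 \<and> \<chi>1 \<noteq> (\<lambda>x. 0) \<and> \<chi>2 \<noteq> (\<lambda>x. 0) \<and>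
       \<chi> = (\<lambda>x. \<chi>1 x + \<chi>2 x)"
      using that by (elim exE conjE) (rule no_split)
  qed
qed

text \<open>The norm of an orbit sum: its \<open>card S\<close> characters are orthogonal to each
  other, each of square norm |gl_n| / |GL_n|, as the form divides by the order of the group and not
  of the algebra.\<close>

definition onrm :: "nat \<Rightarrow> ('a::{finite,field} mat \<Rightarrow> complex) set \<Rightarrow> real" where
  "onrm n S = sqrt (real (card (gl n :: 'a mat set)) * real (card S) / real (card (GL n :: 'a mat set)))"

definition nosum :: "nat \<Rightarrow> ('a::{finite,field} mat \<Rightarrow> complex) set \<Rightarrow> 'a mat \<Rightarrow> complex" where
  "nosum n S = (\<lambda>x. osum S x / complex_of_real (onrm n S))"

definition orbs :: "nat \<Rightarrow> ('a::{finite,field} mat \<Rightarrow> complex) set set" where "orbs n = orb n ` LC n"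

definition Om :: "nat \<Rightarrow> ('a::{finite,field} mat \<Rightarrow> complex) set" where "Om n = nosum n ` orbs n"

lemma finite_orbs [simp]: "finite (orbs n)" by (simp add: orbs_def)
lemma finite_Om [simp]: "finite (Om n)" by (simp add: Om_def)

lemma onrm_pos: "S \<in> orbs n \<Longrightarrow> onrm n S > 0"
  by (auto simp: orbs_def onrm_def card_orb_pos card_gl_pos card_GL_pos)

lemma orbs_coeff:
  fixes S T :: "('a::{finite,field} mat \<Rightarrow> complex) set"
  assumes "S \<in> orbs n" "T \<in> orbs n"
  shows "form n (osum S) (osum T) = (if S = T then complex_of_real ((onrm n S)\<^sup>2) else 0)"
proof -
  have ST: "S \<subseteq> LC n" "T \<subseteq> LC n" "finite S" "finite T" using assms orb_subset by (auto simp: orbs_def)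
  have dis: "S \<noteq> T \<Longrightarrow> S \<inter> T = {}" using assms orb_disjoint by (auto simp: orbs_def)
  have "(\<Sum>x\<in>gl n. osum S x * cnj (osum T x)) = (\<Sum>x\<in>gl n. \<Sum>\<psi>\<in>S. \<Sum>\<phi>\<in>T. \<psi> x * cnj (\<phi> x))"
    by (simp add: osum_def sum_product)
  also have "\<dots> = (\<Sum>\<psi>\<in>S. \<Sum>\<phi>\<in>T. \<Sum>x\<in>gl n. \<psi> x * cnj (\<phi> x))"
    by (subst sum.swap, rule sum.cong[OF refl], rule sum.swap)
  also have "\<dots> = (\<Sum>\<psi>\<in>S. \<Sum>\<phi>\<in>T. if \<psi> = \<phi> then of_nat (card (gl n :: 'a mat set)) else 0)"
    using ST by (intro sum.cong refl lin_char_orth) auto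
  also have "\<dots> = (if S = T then of_nat (card (gl n :: 'a mat set)) * of_nat (card S) else 0)"
    using ST dis by (auto simp: sum.delta' disjoint_iff intro!: sum.neutral)
  finally show ?thesis by (simp add: form_def onrm_def)
qed

lemma form_scale: "form n (\<lambda>x. f x / c) (\<lambda>x. g x / d) = form n f g / (c * cnj d)"
  by (simp add: form_def sum_divide_distrib mult_ac)

lemma form_nosum:
  assumes "S \<in> orbs n" "T \<in> orbs n"
  shows "form n (nosum n S) (nosum n T) = (if S = T then 1 else 0)"
  using onrm_pos[OF assms(1)] unfolding nosum_def form_scale orbs_coeff[OF assms]
  by (auto simp: power2_eq_square)

lemma inj_nosum: "inj_on (nosum n) (orbs n)"
  by (rule inj_onI) (metis form_nosum zero_neq_one)

lemma Om_orthonormal: "a \<in> Om n \<Longrightarrow> b \<in> Om n \<Longrightarrow> form n a b = (if a = b then 1 else 0)"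
  using inj_nosum[of n] by (auto simp: Om_def form_nosum inj_on_eq_iff)

lemma Om_classfun: assumes "a \<in> Om n" shows "classfun n a"
proof -
  obtain \<psi> where "lin_char n \<psi>" "a = nosum n (orb n \<psi>)" using assms by (auto simp: Om_def orbs_def)
  then show ?thesis using classfun_orb[of n \<psi>] by (simp add: classfun_def nosum_def)
qed

text \<open>Completeness of \<open>Om n\<close>: the Fourier coefficients of an invariant function
  are constant along orbits, so the terms of its Fourier expansion group into orbit sums.\<close>

lemma classfun_expansion:
  fixes f :: "'a::{finite,field} mat \<Rightarrow> complex"
  assumes "classfun n f" shows "f x = (\<Sum>a\<in>Om n. form n f a * a x)"
proof -
  let ?N = "of_nat (card (gl n :: 'a mat set)) :: complex"
  let ?G = "of_nat (card (GL n :: 'a mat set)) :: complex"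
  define c where "c \<psi> = (\<Sum>y\<in>gl n. f y * cnj (\<psi> y))" for \<psi>
  have N: "?N \<noteq> 0" "?G \<noteq> 0" using card_gl_pos[of n, where 'a = 'a] card_GL_pos[of n, where 'a = 'a] by auto
  have "f x = (\<Sum>\<psi>\<in>LC n. c \<psi> / ?N * \<psi> x)"
    using LC_expansion[of n f x] assms by (auto simp: classfun_def c_def)
  also have "LC n = \<Union> (orbs n)" unfolding orbs_def using orb_subset orb_refl by blast
  also have "(\<Sum>\<psi>\<in>\<Union> (orbs n). c \<psi> / ?N * \<psi> x) = (\<Sum>S\<in>orbs n. \<Sum>\<psi>\<in>S. c \<psi> / ?N * \<psi> x)"
  proof (subst sum.Union_disjoint)
    show "\<forall>A\<in>orbs n. finite A" by (auto simp: orbs_def)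
    show "\<forall>A\<in>orbs n. \<forall>B\<in>orbs n. A \<noteq> B \<longrightarrow> A \<inter> B = {}" using orb_disjoint by (fastforce simp: orbs_def)
  qed simp
  also have "\<dots> = (\<Sum>S\<in>orbs n. form n f (nosum n S) * nosum n S x)"
  proof (intro sum.cong refl)
    fix S :: "('a mat \<Rightarrow> complex) set" assume S: "S \<in> orbs n"
    then obtain \<psi> where psi: "lin_char n \<psi>" "S = orb n \<psi>" by (auto simp: orbs_def)
    have cc: "c \<phi> = c \<psi>" if "\<phi> \<in> S" for \<phi>
      using that psi classfun_cact_coeff[OF assms] by (auto simp: orb_def c_def)
    have 1: "(\<Sum>\<phi>\<in>S. c \<phi> / ?N * \<phi> x) = c \<psi> / ?N * osum S x"
      using cc by (simp add: osum_def sum_distrib_left)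
    have "(\<Sum>y\<in>gl n. f y * cnj (osum S y)) = (\<Sum>\<phi>\<in>S. c \<phi>)"
      unfolding c_def osum_def by (simp add: sum_distrib_left) (rule sum.swap)
    also have "\<dots> = of_nat (card S) * c \<psi>" using cc by simp
    finally have 2: "form n f (nosum n S) = of_nat (card S) * c \<psi> / (?G * complex_of_real (onrm n S))"
      by (simp add: form_def nosum_def sum_divide_distrib[symmetric])
    have o: "complex_of_real (onrm n S) * complex_of_real (onrm n S) = ?N * of_nat (card S) / ?G"
      unfolding of_real_mult[symmetric] onrm_def by simp
    have cS: "card S > 0" using psi card_orb_pos by simp
    have 3: "nosum n S x = osum S x / complex_of_real (onrm n S)" by (simp add: nosum_def)
    have "form n f (nosum n S) * nosum n S x =
       of_nat (card S) * c \<psi> * osum S x / (?G * (complex_of_real (onrm n S) * complex_of_real (onrm n S)))"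
      unfolding 2 3 by (simp add: mult_ac)
    also have "\<dots> = c \<psi> / ?N * osum S x" unfolding o using N cS by (simp add: field_simps)
    finally show "(\<Sum>\<phi>\<in>S. c \<phi> / ?N * \<phi> x) = form n f (nosum n S) * nosum n S x" using 1 by simp
  qed
  also have "\<dots> = (\<Sum>a\<in>Om n. form n f a * a x)"
    unfolding Om_def by (subst sum.reindex[OF inj_nosum]) simp
  finally show ?thesis .
qed

lemma nosum_orb:
  assumes "lin_char n \<psi>"
  shows "nosum n (orb n \<psi>) = (\<lambda>x. osum (orb n \<psi>) x /
     complex_of_real (sqrt (Re (form n (osum (orb n \<psi>)) (osum (orb n \<psi>))))))"
proof -
  have o: "orb n \<psi> \<in> orbs n" using assms by (simp add: orbs_def)
  show ?thesis unfolding orbs_coeff[OF o o] nosum_def using onrm_pos[OF o] by simp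
qed

lemma Om_eq:
  "(Om n :: ('a::{finite,field} mat \<Rightarrow> complex) set) =
     {(\<lambda>x. \<chi> x / complex_of_real (sqrt (Re (form n \<chi> \<chi>)))) | \<chi>. irr_inv_char n \<chi>}" (is "_ = {?N \<chi> | \<chi>. _}")
proof (intro equalityI subsetI)
  fix a :: "'a mat \<Rightarrow> complex" assume "a \<in> Om n"
  then obtain \<psi> where p: "lin_char n \<psi>" "a = nosum n (orb n \<psi>)" by (auto simp: Om_def orbs_def)
  then have "irr_inv_char n (osum (orb n \<psi>))" using irr_inv_char_iff by blast
  moreover have "a = ?N (osum (orb n \<psi>))" using nosum_orb p by simp
  ultimately show "a \<in> {?N \<chi> | \<chi>. irr_inv_char n \<chi>}" by blast
next
  fix a :: "'a mat \<Rightarrow> complex" assume "a \<in> {?N \<chi> | \<chi>. irr_inv_char n \<chi>}"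
  then obtain \<chi> where c: "irr_inv_char n \<chi>" "a = ?N \<chi>" by blast
  then obtain \<psi> where p: "lin_char n \<psi>" "\<chi> = osum (orb n \<psi>)" using irr_inv_char_iff by blast
  then have "a = nosum n (orb n \<psi>)" unfolding nosum_orb[OF p(1)] using c by simp
  then show "a \<in> Om n" using p(1) by (simp add: Om_def orbs_def)
qed

definition emb :: "nat \<Rightarrow> ('a::zero mat \<Rightarrow> complex) \<Rightarrow> 'a gr" where
  "emb n f = (\<lambda>k. if k = n then f else (\<lambda>x. 0))"

lemma Omega_eq: "Omega = (\<Union>n. emb n ` Om n)"
  unfolding Omega_def Om_eq emb_def by auto

lemma Om_nonzero: "a \<in> Om n \<Longrightarrow> a \<noteq> (\<lambda>x. 0)"
  using Om_orthonormal[of a n a] by (auto simp: form_def)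

lemma gdeg_emb [simp]: "a \<in> Om n \<Longrightarrow> gdeg (emb n a) = n"
  unfolding gdeg_def by (rule Least_equality) (auto simp: emb_def Om_nonzero split: if_splits)

lemma OmegaE:
  assumes "b \<in> Omega" obtains n a where "a \<in> Om n" "b = emb n a" "gdeg b = n"
  using assms unfolding Omega_eq by auto

lemma emb_Omega: "a \<in> Om n \<Longrightarrow> emb n a \<in> Omega" unfolding Omega_eq by blast

section \<open>Harish-Chandra induction and restriction\<close>

definition classfun2 :: "nat \<Rightarrow> nat \<Rightarrow> ('a::{finite,field} mat \<Rightarrow> 'a mat \<Rightarrow> complex) \<Rightarrow> bool" where
  "classfun2 k l f \<longleftrightarrow> (\<forall>x y. x \<notin> gl k \<or> y \<notin> gl l \<longrightarrow> f x y = 0) \<and>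
     (\<forall>g\<in>GL k. \<forall>h\<in>GL l. \<forall>x\<in>gl k. \<forall>y\<in>gl l. f (conjm k g x) (conjm l h y) = f x y)"

lemma classfun_conj: "classfun n f \<Longrightarrow> g \<in> GL n \<Longrightarrow> x \<in> gl n \<Longrightarrow> f (conjm n g x) = f x" by (simp add: classfun_def)

lemma classfun2_tens: "classfun k a \<Longrightarrow> classfun l b \<Longrightarrow> classfun2 k l (\<lambda>x y. a x * b y)"
  by (auto simp: classfun_def classfun2_def)

lemma classfun2_conj: "classfun2 k l f \<Longrightarrow> g \<in> GL k \<Longrightarrow> h \<in> GL l \<Longrightarrow> x \<in> gl k \<Longrightarrow> y \<in> gl l \<Longrightarrow>
   f (conjm k g x) (conjm l h y) = f x y" by (simp add: classfun2_def)

lemma classfun2_fst: "classfun2 k l f \<Longrightarrow> classfun k (\<lambda>x. f x y)"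
  unfolding classfun_def
proof (intro conjI allI impI ballI)
  assume f: "classfun2 k l f"
  show "f x y = 0" if "x \<notin> gl k" for x using f that by (simp add: classfun2_def)
  show "f (conjm k g x) y = f x y" if "g \<in> GL k" "x \<in> gl k" for g x
  proof (cases "y \<in> gl l")
    case True then show ?thesis using classfun2_conj[OF f that(1) idm_GL that(2) True] by simp
  qed (use f in \<open>simp add: classfun2_def\<close>)
qed

lemma classfun2_snd: "classfun2 k l f \<Longrightarrow> classfun l (\<lambda>y. f x y)"
  unfolding classfun_def
proof (intro conjI allI impI ballI)
  assume f: "classfun2 k l f"
  show "f x y = 0" if "y \<notin> gl l" for y using f that by (simp add: classfun2_def)
  show "f x (conjm l g y) = f x y" if "g \<in> GL l" "y \<in> gl l" for g y
  proof (cases "x \<in> gl k")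
    case True then show ?thesis using classfun2_conj[OF f idm_GL that(1) True that(2)] by simp
  qed (use f in \<open>simp add: classfun2_def\<close>)
qed

definition form2 :: "nat \<Rightarrow> nat \<Rightarrow> ('a::{finite,field} mat \<Rightarrow> 'a mat \<Rightarrow> complex) \<Rightarrow> ('a mat \<Rightarrow> 'a mat \<Rightarrow> complex) \<Rightarrow> complex" where
  "form2 k l f g = (\<Sum>x\<in>gl k. \<Sum>y\<in>gl l. f x y * cnj (g x y)) /
     (of_nat (card (GL k :: 'a mat set)) * of_nat (card (GL l :: 'a mat set)))"

text \<open>Expansion in the first variable leaves coefficients that are class functions of the
  second variable, to which the expansion applies again.\<close>

lemma classfun2_expansion:
  assumes "classfun2 k l f"
  shows "f x y = (\<Sum>a\<in>Om k. \<Sum>b\<in>Om l. form2 k l f (\<lambda>x y. a x * b y) * (a x * b y))"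
proof -
  have "f x y = (\<Sum>a\<in>Om k. form k (\<lambda>x. f x y) a * a x)"
    by (rule classfun_expansion) (rule classfun2_fst[OF assms])
  also have "\<dots> = (\<Sum>a\<in>Om k. (\<Sum>b\<in>Om l. form2 k l f (\<lambda>x y. a x * b y) * b y) * a x)"
  proof (intro sum.cong refl arg_cong2[where f = "(*)"])
    fix a :: "'a mat \<Rightarrow> complex"
    define h where "h y = form k (\<lambda>x. f x y) a" for y
    have "classfun l h" using classfun2_snd[OF assms] by (simp add: classfun_def h_def form_def)
    then have "h y = (\<Sum>b\<in>Om l. form l h b * b y)" by (rule classfun_expansion)
    moreover have "form l h b = form2 k l f (\<lambda>x y. a x * b y)" for b
    proof -
      have "(\<Sum>y\<in>gl l. (\<Sum>x\<in>gl k. f x y * cnj (a x)) * cnj (b y)) = (\<Sum>x\<in>gl k. \<Sum>y\<in>gl l. f x y * cnj (a x * b y))"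
        by (subst sum.swap) (simp add: sum_distrib_right sum_distrib_left mult_ac)
      then show ?thesis
        by (simp add: form_def h_def form2_def sum_divide_distrib[symmetric] mult_ac)
    qed
    ultimately show "form k (\<lambda>x. f x y) a = (\<Sum>b\<in>Om l. form2 k l f (\<lambda>x y. a x * b y) * b y)"
      by (simp add: h_def)
  qed
  also have "\<dots> = (\<Sum>a\<in>Om k. \<Sum>b\<in>Om l. form2 k l f (\<lambda>x y. a x * b y) * (a x * b y))"
    by (simp add: sum_distrib_left sum_distrib_right mult_ac)
  finally show ?thesis .
qed

lemma hc_res_alt: "hc_res k l f x1 x2 = (if x1 \<in> gl k \<and> x2 \<in> gl l then
     (\<Sum>u\<in>nilrad k l. f (bdiag k l x1 x2 + u)) / of_nat (card (nilrad k l :: 'a::{finite,field} mat set)) else 0)"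
  for f :: "'a::{finite,field} mat \<Rightarrow> complex"
  by (simp add: hc_res_def madd_eq_plus card_Ugrp)

lemma card_nilrad_pos: "card (nilrad k l :: 'a::{finite,comm_ring_1} mat set) > 0"
  using nilrad_0 by (metis card_gt_0_iff empty_iff finite_nilrad)

lemma nilrad_nonempty [simp]: "(nilrad k l :: 'a::{comm_ring_1} mat set) \<noteq> {}"
  using nilrad_0 by blast

text \<open>The factor \<open>f\<close> sees the diagonal blocks only, so the sum over the
  nilradical falls on \<open>\<phi>\<close> alone, where it is the restriction up to its
  normalization.\<close>

lemma sum_parab_hc_res:
  fixes \<phi> :: "'a::{finite,field} mat \<Rightarrow> complex"
  shows "(\<Sum>y\<in>parab k l. f (blk1 k y) (blk2 k l y) * \<phi> y) =
    of_nat (card (nilrad k l :: 'a mat set)) * (\<Sum>x1\<in>gl k. \<Sum>x2\<in>gl l. f x1 x2 * hc_res k l \<phi> x1 x2)"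
  unfolding sum_parab sum_distrib_left
  by (intro sum.cong refl) (simp add: hc_res_alt blk_add sum_distrib_left[symmetric])

lemma card_Pgrp: "card (Pgrp k l :: 'a::{finite,field} mat set) =
   card (nilrad k l :: 'a mat set) * card (GL k :: 'a mat set) * card (GL l :: 'a mat set)"
proof -
  have P: "(Pgrp k l :: 'a mat set) = {y \<in> parab k l. blk1 k y \<in> GL k \<and> blk2 k l y \<in> GL l}"
    by (auto simp: Pgrp_iff)
  have "card (Pgrp k l :: 'a mat set) = (\<Sum>y\<in>(parab k l :: 'a mat set). if blk1 k y \<in> GL k \<and> blk2 k l y \<in> GL l then 1 else 0)"
    unfolding P by (simp add: sum.If_cases Collect_conj_eq[symmetric] Int_def)
  also have "\<dots> = (\<Sum>x1\<in>(gl k :: 'a mat set). \<Sum>x2\<in>(gl l :: 'a mat set).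
      if x1 \<in> GL k \<and> x2 \<in> GL l then card (nilrad k l :: 'a mat set) else 0)"
    unfolding sum_parab by (intro sum.cong refl) (simp add: blk_add)
  also have "\<dots> = (\<Sum>x1\<in>(GL k :: 'a mat set). \<Sum>x2\<in>(GL l :: 'a mat set). card (nilrad k l :: 'a mat set))"
  proof -
    have G: "gl n \<inter> GL n = (GL n :: 'a mat set)" for n by (auto simp: GL_gl)
    have "(\<Sum>x2\<in>(gl l :: 'a mat set). if x1 \<in> GL k \<and> x2 \<in> GL l then c else 0) =
        (if x1 \<in> GL k then card (GL l :: 'a mat set) * c else 0)" for x1 :: "'a mat" and c :: nat
      by (simp add: sum.If_cases G)
    then show ?thesis by (simp add: sum.If_cases G)
  qed
  finally show ?thesis by simp
qed

lemma hc_ind_classfun: "classfun (k+l) (hc_ind k l f)"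
  unfolding classfun_def
proof (intro conjI allI impI ballI)
  fix g x :: "'a mat" assume g: "g \<in> GL (k+l)" and x: "x \<in> gl (k+l)"
  have "(\<Sum>h\<in>{h \<in> GL (k + l). conjm (k + l) h (conjm (k+l) g x) \<in> parab k l}.
         f (blk1 k (conjm (k + l) h (conjm (k+l) g x))) (blk2 k l (conjm (k + l) h (conjm (k+l) g x))))
      = (\<Sum>h\<in>{h \<in> GL (k + l). conjm (k + l) h x \<in> parab k l}.
         f (blk1 k (conjm (k + l) h x)) (blk2 k l (conjm (k + l) h x)))"
    by (rule sum.reindex_bij_witness[where i = "\<lambda>h. mmul (k+l) h (minv (k+l) g)" and j = "\<lambda>h. mmul (k+l) h g"])
      (auto simp: g minv_GL GL_mmul GL_gl mmul_cancel conjm_mmul conjm_inv x)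
  then show "hc_ind k l f (conjm (k+l) g x) = hc_ind k l f x" using x by (simp add: hc_ind_def)
qed (simp add: hc_ind_def)

lemma conj_nilrad:
  fixes p :: "'a::{finite,comm_ring_1} mat"
  assumes "p \<in> Pgrp k l" "u \<in> nilrad k l" shows "conjm (k+l) p u \<in> nilrad k l"
  using conjm_parab[OF assms(1) nilrad_parab[OF assms(2)]] assms(2)
  by (intro nilradI) (auto simp: conjm_def mmul_def fun_eq_iff)

lemma hc_res_classfun:
  assumes "classfun (k+l) f" shows "classfun2 k l (hc_res k l f)"
  unfolding classfun2_def
proof (intro conjI allI impI ballI)
  fix g h x y :: "'a mat" assume g: "g \<in> GL k" "h \<in> GL l" and x: "x \<in> gl k" "y \<in> gl l"
  define p where "p = bdiag k l g h"
  have p: "p \<in> Pgrp k l" using g by (simp add: p_def bdiag_Pgrp)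
  have pG: "p \<in> GL (k+l)" using p by (simp add: Pgrp_def)
  have pb: "blk1 k p = g" "blk2 k l p = h" using g by (simp_all add: p_def GL_gl)
  define c where "c = conjm (k+l) p (bdiag k l x y)"
  define b where "b = bdiag k l (conjm k g x) (conjm l h y)"
  \<comment> \<open>\<open>c\<close> and \<open>b\<close> have the same diagonal blocks, so their
    difference is a shift that the sum over \<open>nilrad\<close> absorbs.\<close>
  have cb: "c - b \<in> nilrad k l"
    by (rule nilradI) (simp_all add: c_def b_def parab_diff conjm_parab p blk_diff pb x)
  have "(\<Sum>u\<in>nilrad k l. f (b + u)) = (\<Sum>u\<in>nilrad k l. f (c + conjm (k+l) p u))"
  proof (rule sum.reindex_bij_witness[where j = "\<lambda>u. conjm (k+l) (minv (k+l) p) (u - (c - b))" and i = "\<lambda>u. c - b + conjm (k+l) p u"])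
    fix u :: "'a mat" assume u: "u \<in> nilrad k l"
    have 1: "u - (c - b) \<in> nilrad k l" using nilrad_add[OF u nilrad_minus[OF cb]] by (simp only: diff_conv_add_uminus)
    show "c - b + conjm (k+l) p (conjm (k+l) (minv (k+l) p) (u - (c - b))) = u"
      using 1 by (simp add: conjm_inv pG nilrad_gl)
    show "conjm (k+l) (minv (k+l) p) (u - (c - b)) \<in> nilrad k l"
      by (rule conj_nilrad[OF Pgrp_minv[OF p] 1])
    show "f (c + conjm (k + l) p (conjm (k + l) (minv (k + l) p) (u - (c - b)))) = f (b + u)"
      using conjm_inv(1)[OF pG nilrad_gl[OF 1]] by (simp add: add.commute)
    show "conjm (k+l) (minv (k+l) p) (c - b + conjm (k+l) p u - (c - b)) = u"
      using u by (simp add: conjm_inv pG nilrad_gl)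
    show "c - b + conjm (k+l) p u \<in> nilrad k l"
      by (rule nilrad_add[OF cb conj_nilrad[OF p u]])
  qed
  also have "\<dots> = (\<Sum>u\<in>nilrad k l. f (bdiag k l x y + u))"
    unfolding c_def conjm_add[symmetric]
    by (intro sum.cong refl classfun_conj[OF assms pG] gl_add bdiag_gl nilrad_gl)
  finally show "hc_res k l f (conjm k g x) (conjm l h y) = hc_res k l f x y"
    using x by (simp add: hc_res_alt b_def)
qed (auto simp: hc_res_def)

text \<open>By invariance of \<open>\<phi>\<close> every \<open>g\<close> in the definition of
  induction contributes the same sum over \<open>parab\<close>, and |GL_n| cancels against the form.
  The unrestricted sum is kept as a result of its own because the Mackey formula applies it with
  \<open>\<phi>\<close> itself induced.\<close>

lemma adjunction_sum:
  fixes f :: "'a::{finite,field} mat \<Rightarrow> 'a mat \<Rightarrow> complex"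
  assumes "classfun (k+l) \<phi>"
  shows "form (k+l) (hc_ind k l f) \<phi> = (\<Sum>y\<in>parab k l. f (blk1 k y) (blk2 k l y) * cnj (\<phi> y)) / of_nat (card (Pgrp k l :: 'a mat set))"
proof -
  let ?n = "k+l" let ?F = "\<lambda>y. f (blk1 k y) (blk2 k l y)"
  let ?h = "\<lambda>y. if y \<in> parab k l then ?F y else 0"
  have i: "hc_ind k l f x = (\<Sum>g\<in>GL ?n. ?h (conjm ?n g x)) / of_nat (card (Pgrp k l :: 'a mat set))" if "x \<in> gl ?n" for x
    using that by (simp add: hc_ind_def sum.inter_filter)
  have "(\<Sum>x\<in>gl ?n. hc_ind k l f x * cnj (\<phi> x)) =
      (\<Sum>x\<in>gl ?n. \<Sum>g\<in>GL ?n. ?h (conjm ?n g x) * cnj (\<phi> (conjm ?n g x))) / of_nat (card (Pgrp k l :: 'a mat set))"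
    by (simp add: i sum_divide_distrib sum_distrib_right classfun_conj[OF assms])
  also have "(\<Sum>x\<in>gl ?n. \<Sum>g\<in>GL ?n. ?h (conjm ?n g x) * cnj (\<phi> (conjm ?n g x))) =
     (\<Sum>g\<in>GL ?n. \<Sum>x\<in>gl ?n. ?h (conjm ?n g x) * cnj (\<phi> (conjm ?n g x)))" by (rule sum.swap)
  also have "\<dots> = (\<Sum>g\<in>(GL ?n :: 'a mat set). \<Sum>x\<in>gl ?n. ?h x * cnj (\<phi> x))"
    by (rule sum.cong[OF refl], rule sum_conjm[where F = "\<lambda>x. ?h x * cnj (\<phi> x)"])
  also have "(\<Sum>x\<in>gl ?n. ?h x * cnj (\<phi> x)) = (\<Sum>y\<in>parab k l. ?F y * cnj (\<phi> y))"
    by (rule sum.mono_neutral_cong_right) (auto simp: parab_gl)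
  finally show ?thesis by (simp add: form_def)
qed

lemma adjunction:
  fixes f :: "'a::{finite,field} mat \<Rightarrow> 'a mat \<Rightarrow> complex"
  assumes "classfun (k+l) \<phi>"
  shows "form (k+l) (hc_ind k l f) \<phi> = form2 k l f (hc_res k l \<phi>)"
proof -
  have c: "cnj (hc_res k l \<phi> x y) = hc_res k l (\<lambda>x. cnj (\<phi> x)) x y" for x y by (simp add: hc_res_def)
  have "(\<Sum>y\<in>parab k l. f (blk1 k y) (blk2 k l y) * cnj (\<phi> y)) =
      of_nat (card (nilrad k l :: 'a mat set)) * (\<Sum>x1\<in>gl k. \<Sum>x2\<in>gl l. f x1 x2 * hc_res k l (\<lambda>x. cnj (\<phi> x)) x1 x2)"
    by (rule sum_parab_hc_res)
  then show ?thesis unfolding adjunction_sum[OF assms] form2_def c card_Pgrp by simp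
qed

section \<open>Double cosets of parabolic subgroups\<close>

lemma card_supported:
  "card {v :: 'b \<Rightarrow> 'a::{finite,zero}. \<forall>i. i \<notin> S \<longrightarrow> v i = 0} = card (UNIV :: 'a set) ^ card S" if "finite S"
proof -
  have "bij_betw (\<lambda>v. restrict v S) {v :: 'b \<Rightarrow> 'a. \<forall>i. i \<notin> S \<longrightarrow> v i = 0} (PiE S (\<lambda>_. UNIV))"
    by (rule bij_betwI[of _ _ _ "\<lambda>f i. if i \<in> S then f i else 0"]) (auto simp: fun_eq_iff PiE_def extensional_def)
  then show ?thesis using card_PiE[OF that, of "\<lambda>_. UNIV :: 'a set"] by (simp add: bij_betw_same_card)
qed

interpretation vec: vector_space "\<lambda>(c::'a::field) (v::nat \<Rightarrow> 'a) i. c * v i"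
  by unfold_locales (auto simp: fun_eq_iff algebra_simps)

text \<open>Vectors are infinite sequences, so \<open>V k\<close> with \<open>k \<le> n\<close> is
  literally a subset of \<open>V n\<close> and these sets form the standard flag.\<close>

definition V :: "nat \<Rightarrow> (nat \<Rightarrow> 'a::zero) set" where "V n = {v. \<forall>i. n \<le> i \<longrightarrow> v i = 0}"

definition mv :: "nat \<Rightarrow> 'a::comm_ring_1 mat \<Rightarrow> (nat \<Rightarrow> 'a) \<Rightarrow> nat \<Rightarrow> 'a" where
  "mv n a v = (\<lambda>i. if i < n then \<Sum>j<n. a i j * v j else 0)"

lemma card_V: "card (V n :: (nat \<Rightarrow> 'a::{finite,zero}) set) = card (UNIV :: 'a set) ^ n"
  using card_supported[of "{..<n}", where 'a = 'a] by (simp add: V_def not_less)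

lemma finite_V: "finite (V n :: (nat \<Rightarrow> 'a::{finite,zero}) set)"
  by (rule card_ge_0_finite) (simp add: card_V card_gt_0_iff)

lemma V_mono: "k \<le> n \<Longrightarrow> V k \<subseteq> V n" by (auto simp: V_def)

lemma mv_V: "mv n a v \<in> V n" by (simp add: mv_def V_def)
lemma mv_mv: "mv n (mmul n a b) v = mv n a (mv n b v)"
proof
  fix i
  have "(\<Sum>j<n. (\<Sum>m<n. a i m * b m j) * v j) = (\<Sum>m<n. a i m * (\<Sum>j<n. b m j * v j))"
    unfolding sum_distrib_right sum_distrib_left mult.assoc by (rule sum.swap)
  then show "mv n (mmul n a b) v i = mv n a (mv n b v) i"
    by (simp add: mv_def mmul_def)
qed
lemma mv_idm: "v \<in> V n \<Longrightarrow> mv n (idm n) v = v"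
  by (auto simp: mv_def idm_def V_def fun_eq_iff sum_delta_mult)
lemma mv_add: "mv n a (v + w) = mv n a v + mv n a w"
  by (simp add: mv_def fun_eq_iff algebra_simps sum.distrib)
lemma mv_scale: "mv n a (\<lambda>i. c * v i) = (\<lambda>i. c * mv n a v i)"
  by (simp add: mv_def fun_eq_iff algebra_simps sum_distrib_left)
lemma mv_inv:
  assumes "a \<in> GL n" "v \<in> V n"
  shows "mv n (minv n a) (mv n a v) = v" "mv n a (mv n (minv n a) v) = v"
  using assms by (simp_all add: mv_mv[symmetric] minv_l minv_r mv_idm)

lemma subspace_V: "vec.subspace (V n)"
  by (auto simp: vec.subspace_def V_def)

lemma card_field_gt_1: "card (UNIV :: 'a::{finite,zero_neq_one} set) > 1"
proof -
  have "card {0, 1 :: 'a} \<le> card (UNIV :: 'a set)" by (rule card_mono) auto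
  then show ?thesis by simp
qed

lemma card_span:
  fixes B :: "(nat \<Rightarrow> 'a::{finite,field}) set"
  assumes "finite B" "vec.independent B"
  shows "card (vec.span B) = card (UNIV :: 'a set) ^ card B"
proof -
  let ?U = "{u :: (nat \<Rightarrow> 'a) \<Rightarrow> 'a. \<forall>v. v \<notin> B \<longrightarrow> u v = 0}"
  let ?f = "\<lambda>u. \<Sum>v\<in>B. (\<lambda>i. u v * v i)"
  have "vec.span B = ?f ` ?U"
  proof
    show "vec.span B \<subseteq> ?f ` ?U"
    proof
      fix x assume "x \<in> vec.span B"
      then obtain u where "x = ?f u" unfolding vec.span_finite[OF assms(1)] by auto
      then have "x = ?f (\<lambda>v. if v \<in> B then u v else 0)" by (auto intro!: sum.cong)
      then show "x \<in> ?f ` ?U" by (rule image_eqI[where f = ?f]) simp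
    qed
    show "?f ` ?U \<subseteq> vec.span B" by (auto simp: vec.span_finite[OF assms(1)])
  qed
  moreover have "inj_on ?f ?U"
  proof (rule inj_onI)
    fix u w assume *: "u \<in> ?U" "w \<in> ?U" "?f u = ?f w"
    have "(\<lambda>i. (u v - w v) * v i) = (\<lambda>i. u v * v i) - (\<lambda>i. w v * v i)" for v
      by (simp add: fun_eq_iff algebra_simps)
    then have "(\<Sum>v\<in>B. (\<lambda>i. (u v - w v) * v i)) = 0"
      using *(3) by (simp only: sum_subtractf) simp
    then have "\<forall>v\<in>B. u v - w v = 0"
      using vec.independentD[OF assms(2,1) subset_refl, of "\<lambda>v. u v - w v"] by blast
    then show "u = w" using * by (auto simp: fun_eq_iff)
  qed
  ultimately have "card (vec.span B) = card ?U" by (simp add: card_image)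
  then show ?thesis by (simp add: card_supported[OF assms(1)])
qed

lemma sum_fun_apply: "(\<Sum>x\<in>A. f x) i = (\<Sum>x\<in>A. f x i)" for f :: "'b \<Rightarrow> 'c \<Rightarrow> 'd::comm_monoid_add"
  by (induction A rule: infinite_finite_induct) auto

text \<open>Dimensions are read off from cardinalities: powers of the field size, which exceeds 1,
  determine their exponents.\<close>

lemma card_basis:
  fixes B :: "(nat \<Rightarrow> 'a::{finite,field}) set"
  assumes "finite B" "vec.independent B" "card (vec.span B) = card (UNIV :: 'a set) ^ m"
  shows "card B = m"
proof -
  show ?thesis using card_field_gt_1[where 'a = 'a] card_span[OF assms(1,2)] assms(3) by simp
qed

lemma GL_of_basis:
  fixes B :: "(nat \<Rightarrow> 'a::{finite,field}) set"
  assumes "bij_betw \<beta> {..<n} B" "V n \<subseteq> vec.span B" "B \<subseteq> V n"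
  shows "(\<lambda>i j. if j < n then \<beta> j i else 0) \<in> GL n"
proof -
  let ?b = "\<lambda>i j. if j < n then \<beta> j i else 0"
  have fin: "finite B" using assms(1) bij_betw_finite by blast
  have im: "\<beta> ` {..<n} = B" "inj_on \<beta> {..<n}" using assms(1) by (auto simp: bij_betw_def)
  have bg: "?b \<in> gl n" using assms(3) im by (auto simp: gl_def V_def)
  define e where "e j = (\<lambda>i. if i = j then 1 else 0 :: 'a)" for j :: nat
  have "\<exists>u. e j = (\<Sum>v\<in>B. (\<lambda>i. u v * v i))" if "j < n" for j
  proof -
    have "e j \<in> V n" using that by (auto simp: e_def V_def)
    then show ?thesis using assms(2) unfolding vec.span_finite[OF fin] by blast
  qed
  then obtain u where u: "\<And>j. j < n \<Longrightarrow> e j = (\<Sum>v\<in>B. (\<lambda>i. u j v * v i))" by metis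
  \<comment> \<open>Column \<open>j\<close> of \<open>h\<close> holds the coordinates of the unit
    vector \<open>e j\<close> in the basis, which makes \<open>h\<close> a right inverse.\<close>
  define h where "h = (\<lambda>m j. if m < n \<and> j < n then u j (\<beta> m) else 0)"
  have "mmul n ?b h = idm n"
  proof (intro ext)
    fix i j
    have "(\<Sum>m<n. \<beta> m i * u j (\<beta> m)) = e j i" if "j < n"
    proof -
      have "e j i = (\<Sum>v\<in>B. u j v * v i)" using fun_cong[OF u[OF that], of i] by (simp add: sum_fun_apply)
      also have "\<dots> = (\<Sum>m<n. u j (\<beta> m) * \<beta> m i)"
        using sum.reindex_bij_betw[OF assms(1), of "\<lambda>v. u j v * v i"] by simp
      finally show ?thesis by (simp add: mult.commute)
    qed
    then show "mmul n ?b h i j = idm n i j" by (auto simp: mmul_def h_def idm_def e_def)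
  qed
  moreover have "h \<in> gl n" by (auto simp: h_def gl_def)
  ultimately show ?thesis using GL_leftI(2)[of h n ?b] bg by blast
qed

section \<open>Block permutations and the relative position of two subspaces\<close>

text \<open>\<open>blkperm k1 k2 l1\<close> maps positions for the block order of sizes \<open>(k1,l1,k2,l2)\<close> to positions for \<open>(k1,k2,l1,l2)\<close>.\<close>
definition blkperm :: "nat \<Rightarrow> nat \<Rightarrow> nat \<Rightarrow> nat \<Rightarrow> nat" where
  "blkperm k1 k2 l1 i = (if i < k1 then i else if i < k1 + l1 then i + k2 else if i < k1 + l1 + k2 then i - l1 else i)"

definition wmat :: "nat \<Rightarrow> nat \<Rightarrow> nat \<Rightarrow> nat \<Rightarrow> 'a::comm_ring_1 mat" where
  "wmat k1 k2 l1 n = (\<lambda>i j. if i < n \<and> blkperm k1 k2 l1 i = j then 1 else 0)"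

lemma blkperm_lt: "k1 + k2 + l1 \<le> n \<Longrightarrow> blkperm k1 k2 l1 i < n \<longleftrightarrow> i < n" by (auto simp: blkperm_def)
lemma blkperm_blkperm: "blkperm k1 l1 k2 (blkperm k1 k2 l1 i) = i" by (auto simp: blkperm_def)
lemma blkperm_eq_iff: "blkperm k1 k2 l1 i = j \<longleftrightarrow> i = blkperm k1 l1 k2 j" using blkperm_blkperm by metis

lemma wmat_gl: "k1 + k2 + l1 \<le> n \<Longrightarrow> wmat k1 k2 l1 n \<in> gl n"
  by (auto simp: gl_def wmat_def) (metis blkperm_lt not_le)+

lemma wmat_mmul: "k1 + k2 + l1 \<le> n \<Longrightarrow>
   mmul n (wmat k1 k2 l1 n) y = (\<lambda>i j. if i < n \<and> j < n then y (blkperm k1 k2 l1 i) j else 0)"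
  by (auto simp: fun_eq_iff mmul_def wmat_def sum_delta_mult blkperm_lt)

lemma mmul_wmat: "k1 + k2 + l1 \<le> n \<Longrightarrow>
   mmul n y (wmat k1 k2 l1 n) = (\<lambda>i j. if i < n \<and> j < n then y i (blkperm k1 l1 k2 j) else 0)"
proof (intro ext)
  fix i j assume n: "k1 + k2 + l1 \<le> n"
  then have l: "blkperm k1 l1 k2 j < n \<longleftrightarrow> j < n" by (simp add: blkperm_lt)
  show "mmul n y (wmat k1 k2 l1 n) i j = (if i < n \<and> j < n then y i (blkperm k1 l1 k2 j) else 0)"
    using l by (simp add: mmul_def wmat_def blkperm_eq_iff sum_delta_mult if_distrib cong: if_cong)
qed

lemma wmat_inv:
  assumes "k1 + k2 + l1 \<le> n"
  shows "mmul n (wmat k1 k2 l1 n) (wmat k1 l1 k2 n) = idm n"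
  unfolding wmat_mmul[OF assms] using assms by (auto simp: wmat_def idm_def blkperm_blkperm blkperm_lt fun_eq_iff)

lemma wmat_GL: "k1 + k2 + l1 \<le> n \<Longrightarrow> (wmat k1 k2 l1 n :: 'a::{finite,comm_ring_1} mat) \<in> GL n"
  by (rule GL_leftI(2)[OF _ _ wmat_inv]) (auto intro: wmat_gl)

lemma minv_wmat: "k1 + k2 + l1 \<le> n \<Longrightarrow> minv n (wmat k1 k2 l1 n :: 'a::{finite,comm_ring_1} mat) = wmat k1 l1 k2 n"
  by (rule minv_unique) (auto simp: wmat_GL wmat_inv wmat_gl)

lemma conjm_wmat: "k1 + k2 + l1 \<le> n \<Longrightarrow> conjm n (wmat k1 k2 l1 n :: 'a::{finite,comm_ring_1} mat) y =
   (\<lambda>i j. if i < n \<and> j < n then y (blkperm k1 k2 l1 i) (blkperm k1 k2 l1 j) else 0)"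
  unfolding conjm_def by (subst minv_wmat) (auto simp: mmul_wmat wmat_mmul fun_eq_iff blkperm_lt)

text \<open>Extends an enumeration by a disjoint finite block. Iterated below, it lists an adapted
  basis block by block.\<close>

lemma bij_betw_append:
  assumes "bij_betw f {..<m} X" "finite Y" "card Y = r" "X \<inter> Y = {}"
  shows "\<exists>g. bij_betw g {..<m+r} (X \<union> Y) \<and> (\<forall>i<m. g i = f i) \<and> (\<forall>i. m \<le> i \<and> i < m+r \<longrightarrow> g i \<in> Y)"
proof -
  obtain h where h: "bij_betw h {0..<r} Y" using ex_bij_betw_nat_finite[OF assms(2)] assms(3) by auto
  have s: "bij_betw (\<lambda>i. i - m) {m..<m+r} {0..<r}"
    by (rule bij_betwI[of _ _ _ "\<lambda>i. i + m"]) auto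
  define g where "g = (\<lambda>i. if i \<in> {..<m} then f i else h (i - m))"
  have "bij_betw g ({..<m} \<union> {m..<m+r}) (X \<union> Y)" unfolding g_def
    by (rule bij_betw_disjoint_Un[OF assms(1) bij_betw_trans[OF s h, unfolded comp_def] _ assms(4)]) auto
  moreover have "{..<m} \<union> {m..<m+r} = {..<m+r}" by auto
  moreover have "h (i - m) \<in> Y" if "m \<le> i" "i < m + r" for i using h that by (auto simp: bij_betw_def)
  ultimately show ?thesis by (intro exI[of _ g]) (auto simp: g_def)
qed

lemma mv_parab:
  assumes "p \<in> parab k l" "v \<in> V k" shows "mv (k+l) p v \<in> V k"
proof -
  have "mv (k+l) p v i = 0" if "k \<le> i" for i
  proof (cases "i < k+l")
    case True
    have "p i j * v j = 0" for j using assms that by (cases "j < k") (auto simp: parab_def V_def)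
    then show ?thesis by (simp add: mv_def)
  qed (simp add: mv_def)
  then show ?thesis by (simp add: V_def)
qed

text \<open>With W = \<open>V k\<close> and W' the preimage of \<open>V c\<close> under
  \<open>a\<close>, take a basis of their intersection, extend it to W, then to W + W', then to the
  whole space. The matrix \<open>b\<close> of this basis preserves \<open>V k\<close>, and
  \<open>a b\<close>, up to a permutation of column blocks, preserves \<open>V c\<close>; so
  \<open>a\<close> is a product of an element of \<open>Pgrp c d\<close>, a block permutation and
  the inverse of \<open>b\<close>.\<close>

lemma bruhat_exists:
  fixes a :: "'a::{finite,field} mat"
  assumes a: "a \<in> GL n" and n: "n = k + l" "n = c + d"
  obtains k1 k2 l1 l2 p p' where "k = k1 + k2" "l = l1 + l2" "c = k1 + l1" "d = k2 + l2"
    "p \<in> Pgrp k l" "p' \<in> Pgrp c d" "a = mmul n (mmul n p' (wmat k1 k2 l1 n)) p"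
proof -
  define W' where "W' = {v \<in> V n. mv n a v \<in> V c}"
  have W'V: "W' \<subseteq> V n" by (auto simp: W'_def)
  have kn: "V k \<subseteq> V n" "V c \<subseteq> V n" using n by (auto intro!: V_mono)
  have subW': "vec.subspace W'"
    unfolding vec.subspace_def W'_def using subspace_V[of n, where 'a = 'a] subspace_V[of c, where 'a = 'a]
    by (auto simp: vec.subspace_def mv_add mv_scale) (simp add: mv_def V_def)
  have cardW': "card W' = card (UNIV :: 'a set) ^ c"
  proof -
    have "bij_betw (mv n a) W' (V c)"
      by (rule bij_betwI[of _ _ _ "mv n (minv n a)"]) (use a kn in \<open>auto simp: W'_def mv_inv mv_V\<close>)
    then show ?thesis by (simp add: bij_betw_same_card card_V)
  qed
  have fin: "finite X" if "X \<subseteq> V n" for X :: "(nat \<Rightarrow> 'a) set" using finite_subset[OF that finite_V] .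
  obtain B1 where B1: "B1 \<subseteq> V k \<inter> W'" "vec.independent B1" "V k \<inter> W' \<subseteq> vec.span B1"
    using vec.maximal_independent_subset_extend[of "{}" "V k \<inter> W'"] by (auto simp: vec.independent_empty)
  obtain B2 where B2: "B1 \<subseteq> B2" "B2 \<subseteq> V k" "vec.independent B2" "V k \<subseteq> vec.span B2"
    using vec.maximal_independent_subset_extend[of B1 "V k"] B1 by auto
  obtain C where C: "B2 \<subseteq> C" "C \<subseteq> B2 \<union> W'" "vec.independent C" "B2 \<union> W' \<subseteq> vec.span C"
    using vec.maximal_independent_subset_extend[of B2 "B2 \<union> W'"] B2 by auto
  have CV: "C \<subseteq> V n" using C B2 W'V kn by blast
  obtain D where D: "C \<subseteq> D" "D \<subseteq> V n" "vec.independent D" "V n \<subseteq> vec.span D"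
    using vec.maximal_independent_subset_extend[OF CV C(3)] by auto
  have finD: "finite D" using fin D by blast
  then have fin': "finite C" "finite B2" "finite B1" using D(1) C(1) B2(1) by (meson finite_subset)+
  have spanB2: "vec.span B2 = V k" using vec.span_minimal[OF B2(2) subspace_V] B2(4) by blast
  have cardB2: "card B2 = k" by (rule card_basis[OF fin'(2) B2(3)]) (simp add: spanB2 card_V)
  have spanD: "vec.span D = V n" using vec.span_minimal[OF D(2) subspace_V] D(4) by blast
  have cardD: "card D = n" by (rule card_basis[OF finD D(3)]) (simp add: spanD card_V)
  define E where "E = C - B2"
  have EW: "E \<subseteq> W'" using C by (auto simp: E_def)
  \<comment> \<open>A vector of W' is \<open>s + t\<close> with \<open>s\<close> in W and
    \<open>t\<close> in the span of \<open>E\<close>. As \<open>E\<close> lies in W', so does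
    \<open>s\<close>, which therefore lies in the intersection spanned by \<open>B1\<close>.\<close>
  have "W' \<subseteq> vec.span (B1 \<union> E)"
  proof
    fix w assume w: "w \<in> W'"
    then have "w \<in> vec.span (B2 \<union> E)" using C(1,4) by (auto simp: E_def Un_absorb1)
    then obtain s t where st: "w = s + t" "s \<in> vec.span B2" "t \<in> vec.span E" unfolding vec.span_Un by auto
    have t: "t \<in> W'" using vec.span_minimal[OF EW subW'] st by blast
    have "w - t = s" using st(1) by simp
    then have "s \<in> W'" using vec.subspace_diff[OF subW' w t] by simp
    then have "s \<in> vec.span B1" using st spanB2 B1 by blast
    then have "s \<in> vec.span (B1 \<union> E)" "t \<in> vec.span (B1 \<union> E)" using st(3) vec.span_mono[of B1 "B1 \<union> E"] vec.span_mono[of E "B1 \<union> E"] by auto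
    then show "w \<in> vec.span (B1 \<union> E)" using st(1) vec.span_add by blast
  qed
  then have spanE: "vec.span (B1 \<union> E) = W'" using vec.span_minimal[OF _ subW', of "B1 \<union> E"] B1 EW by blast
  have "card (B1 \<union> E) = c"
    by (rule card_basis) (use fin' C B2 vec.independent_mono[OF C(3), of "B1 \<union> E"] in \<open>auto simp: E_def spanE[unfolded E_def] cardW'\<close>)
  moreover have disj: "B1 \<inter> E = {}" using B2 by (auto simp: E_def)
  ultimately have cardE: "card B1 + card E = c" using card_Un_disjoint[of B1 E] fin' by (simp add: E_def)
  \<comment> \<open>In this order: the dimension of the intersection, of W modulo it, of W' modulo
    it, and the codimension of W + W'.\<close>
  define k1 where "k1 = card B1"
  define k2 where "k2 = card (B2 - B1)"
  define l1 where "l1 = card E"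
  define l2 where "l2 = card (D - C)"
  have k: "k = k1 + k2" using cardB2 B2(1) fin' card_mono[OF fin'(2) B2(1)] by (simp add: k1_def k2_def card_Diff_subset)
  have c: "c = k1 + l1" using cardE by (simp add: k1_def l1_def)
  have "card C = k + l1" using cardB2 C(1) fin' card_mono[OF fin'(1) C(1)] by (simp add: l1_def E_def card_Diff_subset)
  then have nn: "n = k + l1 + l2" using cardD D(1) fin' card_mono[OF finD D(1)] by (simp add: l2_def card_Diff_subset)
  have l: "l = l1 + l2" "d = k2 + l2" using n nn k c by auto
  obtain \<beta>1 where b1: "bij_betw \<beta>1 {..<k1} B1"
    using ex_bij_betw_nat_finite[OF fin'(3)] by (auto simp: k1_def atLeast0LessThan)
  obtain \<beta>2 where b2: "bij_betw \<beta>2 {..<k1+k2} (B1 \<union> (B2 - B1))" "\<forall>i<k1. \<beta>2 i = \<beta>1 i"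
    using bij_betw_append[OF b1, of "B2 - B1" k2] fin' by (auto simp: k2_def)
  have "B1 \<union> (B2 - B1) = B2" using B2 by auto
  note b2 = b2[unfolded this k[symmetric]]
  obtain \<beta>3 where b3: "bij_betw \<beta>3 {..<k+l1} (B2 \<union> E)" "\<forall>i<k. \<beta>3 i = \<beta>2 i" "\<forall>i. k \<le> i \<and> i < k+l1 \<longrightarrow> \<beta>3 i \<in> E"
    using bij_betw_append[OF b2(1), of E l1] fin' by (auto simp: l1_def E_def)
  have "B2 \<union> E = C" using C by (auto simp: E_def)
  note b3 = b3[unfolded this]
  obtain \<beta> where b4: "bij_betw \<beta> {..<k+l1+l2} (C \<union> (D - C))" "\<forall>i<k+l1. \<beta> i = \<beta>3 i"
    using bij_betw_append[OF b3(1), of "D - C" l2] finD by (auto simp: l2_def)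
  have "C \<union> (D - C) = D" using D by auto
  note b4 = b4[unfolded this nn[symmetric]]
  define b where "b = (\<lambda>i j. if j < n then \<beta> j i else 0)"
  have bG: "b \<in> GL n" unfolding b_def by (rule GL_of_basis[OF b4(1) D(4,2)])
  have betak: "\<beta> j \<in> V k" if "j < k" for j
  proof -
    have "\<beta> j = \<beta>2 j" using b4(2) b3(2) that by simp
    then show ?thesis using b2(1) that B2(2) by (auto simp: bij_betw_def)
  qed
  have bP: "b \<in> Pgrp k l" using bG betak n GL_gl[OF bG] by (auto simp: Pgrp_def parab_def b_def V_def)
  \<comment> \<open>The basis is listed as \<open>B1\<close>, \<open>B2 - B1\<close>,
    \<open>E\<close>, \<open>D - C\<close>, and \<open>blkperm\<close> jumps over the second block,
    so its first \<open>c\<close> values index vectors of \<open>B1\<close> and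
    \<open>E\<close>.\<close>
  have betac: "\<beta> (blkperm k1 k2 l1 j) \<in> W'" if j: "j < c" for j
  proof (cases "j < k1")
    case True
    then have "\<beta> j = \<beta>1 j" using b4(2) b3(2) b2(2) k by simp
    then have "\<beta> j \<in> B1" using b1 True by (auto simp: bij_betw_def)
    then show ?thesis using True B1 by (auto simp: blkperm_def)
  next
    case False
    then have e: "blkperm k1 k2 l1 j = j + k2" using j c by (simp add: blkperm_def)
    have "\<beta> (j + k2) \<in> E" using b4(2) b3(3) False j c k by simp
    then show ?thesis using EW e by auto
  qed
  \<comment> \<open>\<open>wmat k1 l1 k2 n\<close> inverts \<open>wmat k1 k2 l1 n\<close>. The
    product is \<open>a b\<close> with its columns rearranged so that the first \<open>c\<close> of
    them lie in \<open>V c\<close>.\<close>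
  define p' where "p' = mmul n (mmul n a b) (wmat k1 l1 k2 n)"
  have le: "k1 + l1 + k2 \<le> n" "k1 + k2 + l1 \<le> n" using nn k by auto
  have wG: "wmat k1 l1 k2 n \<in> (GL n :: 'a mat set)" "wmat k1 k2 l1 n \<in> (GL n :: 'a mat set)" using le by (auto intro: wmat_GL)
  have "p' \<in> GL n" unfolding p'_def using a bG wG by (auto intro: GL_mmul)
  moreover have "p' i j = 0" if "c \<le> i" "j < c" for i j
  proof (cases "i < n")
    case True
    have jn: "j < n" using that n by simp
    have s: "blkperm k1 k2 l1 j < n" using blkperm_lt[OF le(2)] jn by blast
    have "p' i j = mmul n a b i (blkperm k1 k2 l1 j)"
      unfolding p'_def mmul_wmat[OF le(1)] using True jn by simp
    also have "\<dots> = mv n a (\<beta> (blkperm k1 k2 l1 j)) i" using True s by (simp add: mmul_def mv_def b_def)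
    also have "\<dots> = 0" using betac[OF that(2)] that(1) by (simp add: W'_def V_def)
    finally show ?thesis .
  next
    case False then show ?thesis by (simp add: p'_def mmul_def)
  qed
  ultimately have p': "p' \<in> Pgrp c d" using n GL_gl[of p' n] by (auto simp: Pgrp_def parab_def)
  have wi: "minv n (wmat k1 l1 k2 n :: 'a mat) = wmat k1 k2 l1 n" by (rule minv_wmat[OF le(1)])
  have "mmul n p' (wmat k1 k2 l1 n) = mmul n a b"
    unfolding p'_def wi[symmetric] by (rule mmul_cancel(3)[OF wG(1)]) simp
  then have "mmul n (mmul n p' (wmat k1 k2 l1 n)) (minv n b) = a"
    using mmul_cancel(3)[OF bG GL_gl[OF a]] by simp
  then show thesis using that[OF k l(1) c l(2) Pgrp_minv[OF bP] p'] n by simp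
qed

text \<open>The set counted is the intersection of \<open>V k\<close> with the preimage of
  \<open>V c\<close>. Its size does not change under \<open>p\<close> and \<open>p'\<close>, which
  preserve \<open>V k\<close> and \<open>V c\<close>, and for the block permutation the set is
  \<open>V k1\<close>. So \<open>a\<close> determines \<open>k1\<close>, which will make different
  double cosets disjoint.\<close>

lemma bruhat_unique:
  fixes p p' :: "'a::{finite,field} mat"
  assumes n: "n = k + l" "n = c + d"
    and k: "k = k1 + k2" "l = l1 + l2" "c = k1 + l1" "d = k2 + l2"
    and p: "p \<in> Pgrp k l" "p' \<in> Pgrp c d" and a: "a = mmul n (mmul n p' (wmat k1 k2 l1 n)) p"
  shows "card {v \<in> V k. mv n a v \<in> V c} = card (UNIV :: 'a set) ^ k1"
proof -
  let ?w = "wmat k1 k2 l1 n :: 'a mat"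
  have pG: "p \<in> GL n" "p' \<in> GL n" using p n by (auto simp: Pgrp_def)
  have pP: "mv n p v \<in> V k" "mv n (minv n p) v \<in> V k" if "v \<in> V k" for v
    using mv_parab[of p k l v] mv_parab[OF minv_parab[OF p(1)], of v] that p(1) n by (auto simp: Pgrp_def)
  have p'P: "mv n p' v \<in> V c" "mv n (minv n p') v \<in> V c" if "v \<in> V c" for v
    using mv_parab[of p' c d v] mv_parab[OF minv_parab[OF p(2)], of v] that p(2) n by (auto simp: Pgrp_def)
  have V: "v \<in> V n" if "v \<in> V k" for v :: "nat \<Rightarrow> 'a" using that n V_mono[of k n] by auto
  have av: "mv n a v \<in> V c \<longleftrightarrow> mv n ?w (mv n p v) \<in> V c" for v
    using p'P[of "mv n ?w (mv n p v)"] p'P(2)[of "mv n p' (mv n ?w (mv n p v))"] mv_inv(1)[OF pG(2) mv_V]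
    by (auto simp: a mv_mv)
  have "bij_betw (mv n p) {v \<in> V k. mv n a v \<in> V c} {v \<in> V k. mv n ?w v \<in> V c}"
    by (rule bij_betwI[of _ _ _ "mv n (minv n p)"]) (auto simp: av pP mv_inv pG V)
  then have "card {v \<in> V k. mv n a v \<in> V c} = card {v \<in> V k. mv n ?w v \<in> V c}" by (rule bij_betw_same_card)
  also have "{v \<in> V k. mv n ?w v \<in> V c} = V k1"
  proof -
    have le: "k1 + k2 + l1 \<le> n" using n k by simp
    have w: "mv n ?w v = (\<lambda>i. if i < n then v (blkperm k1 k2 l1 i) else 0)" for v
      using le by (auto simp: fun_eq_iff mv_def wmat_def sum_delta_mult blkperm_lt)
    show ?thesis
    proof (intro equalityI subsetI)
      fix v :: "nat \<Rightarrow> 'a" assume v: "v \<in> {v \<in> V k. mv n ?w v \<in> V c}"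
      have "v i = 0" if "k1 \<le> i" for i
      proof (cases "i < k")
        case True
        \<comment> \<open>A coordinate \<open>i\<close> with \<open>k1 \<le> i < k\<close> is moved
          to position \<open>i + l1\<close>, which is at least \<open>c\<close>, where vectors of
          \<open>V c\<close> vanish.\<close>
        have "(if i + l1 < n then v (blkperm k1 k2 l1 (i+l1)) else 0) = 0"
          using v that k by (auto simp: w V_def)
        moreover have "blkperm k1 k2 l1 (i+l1) = i" "i + l1 < n" using that True k n by (auto simp: blkperm_def)
        ultimately show ?thesis by simp
      qed (use v in \<open>simp add: V_def\<close>)
      then show "v \<in> V k1" by (simp add: V_def)
    next
      fix v :: "nat \<Rightarrow> 'a" assume "v \<in> V k1"
      then show "v \<in> {v \<in> V k. mv n ?w v \<in> V c}" using k unfolding w by (auto simp: V_def blkperm_def)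
    qed
  qed
  finally show ?thesis by (simp add: card_V)
qed

section \<open>Sizes of double cosets and sums of bi-invariant functions\<close>

definition dstab :: "nat \<Rightarrow> nat \<Rightarrow> nat \<Rightarrow> nat \<Rightarrow> 'a::{finite,field} mat \<Rightarrow> 'a mat set" where
  "dstab k l c d w = {s \<in> Pgrp k l. conjm (k+l) w s \<in> Pgrp c d}"

definition dcoset :: "nat \<Rightarrow> nat \<Rightarrow> nat \<Rightarrow> nat \<Rightarrow> 'a::{finite,field} mat \<Rightarrow> 'a mat set" where
  "dcoset k l c d w = (\<lambda>(p',p). mmul (k+l) (mmul (k+l) p' w) p) ` (Pgrp c d \<times> Pgrp k l)"

lemma finite_Pgrp [simp]: "finite (Pgrp k l :: 'a::{finite,comm_ring_1} mat set)"
  by (rule finite_subset[OF _ finite_GL]) (auto simp: Pgrp_def)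

lemma idm_Pgrp [simp]: "idm (k+l) \<in> Pgrp k l" by (simp add: Pgrp_def)

lemma card_Pgrp_pos: "card (Pgrp k l :: 'a::{finite,comm_ring_1} mat set) > 0"
  using card_gt_0_iff[of "Pgrp k l :: 'a mat set"] idm_Pgrp[of k l] by fastforce

text \<open>Every fibre of \<open>(p', p) \<mapsto> p' w p\<close> is a torsor under
  \<open>dstab\<close>, where \<open>s\<close> sends \<open>(p0', p0)\<close> to
  \<open>(p0' w s^-1 w^-1, s p0)\<close>.\<close>

lemma card_dcoset:
  fixes w :: "'a::{finite,field} mat"
  assumes w: "w \<in> GL (k+l)" and n: "k + l = c + d"
  shows "card (dcoset k l c d w) * card (dstab k l c d w) = card (Pgrp c d :: 'a mat set) * card (Pgrp k l :: 'a mat set)"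
proof -
  define n where "n = k + l"
  let ?X = "Pgrp c d \<times> Pgrp k l :: ('a mat \<times> 'a mat) set"
  let ?g = "\<lambda>(p',p). mmul n (mmul n p' w) p"
  have nc: "n = c + d" "c + d = n" using assms(2) by (simp_all add: n_def)
  have PG: "p \<in> GL n" if "p \<in> Pgrp k l" for p :: "'a mat" using that by (simp add: Pgrp_def n_def)
  have PG': "p \<in> GL n" if "p \<in> Pgrp c d" for p :: "'a mat" using that by (simp add: Pgrp_def nc(2))
  have Pm: "minv n p \<in> Pgrp k l" if "p \<in> Pgrp k l" for p :: "'a mat" using Pgrp_minv[OF that] by (simp add: n_def)
  have Pm': "minv n p \<in> Pgrp c d" if "p \<in> Pgrp c d" for p :: "'a mat" using Pgrp_minv[OF that] by (simp add: nc(2))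
  have Pp: "mmul n p q \<in> Pgrp k l" if "p \<in> Pgrp k l" "q \<in> Pgrp k l" for p q :: "'a mat" using Pgrp_mmul[OF that] by (simp add: n_def)
  have Pp': "mmul n p q \<in> Pgrp c d" if "p \<in> Pgrp c d" "q \<in> Pgrp c d" for p q :: "'a mat" using Pgrp_mmul[OF that] by (simp add: nc(2))
  have wG: "w \<in> GL n" using w by (simp add: n_def)
  note grp = mmul_assoc mmul_cancel(1,2) minv_mmul minv_GL GL_mmul GL_gl wG minv_minv
  have "card ?X = (\<Sum>x\<in>?X. 1)" by simp
  also have "\<dots> = (\<Sum>a\<in>?g ` ?X. \<Sum>x\<in>{x \<in> ?X. ?g x = a}. 1)"
    by (rule sum.image_gen) simp
  also have "\<dots> = (\<Sum>a\<in>?g ` ?X. card (dstab k l c d w))"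
  proof (rule sum.cong[OF refl])
    fix a assume "a \<in> ?g ` ?X"
    then obtain p0' p0 where p0: "p0' \<in> Pgrp c d" "p0 \<in> Pgrp k l" "a = mmul n (mmul n p0' w) p0" by auto
    note G0 = PG'[OF p0(1)] PG[OF p0(2)]
    have "bij_betw (\<lambda>s. (mmul n p0' (conjm n w (minv n s)), mmul n s p0)) (dstab k l c d w) {x \<in> ?X. ?g x = a}"
    proof (rule bij_betwI[of _ _ _ "\<lambda>(p',p). mmul n p (minv n p0)"])
      show "(\<lambda>s. (mmul n p0' (conjm n w (minv n s)), mmul n s p0)) \<in> dstab k l c d w \<rightarrow> {x \<in> ?X. ?g x = a}"
      proof
        fix s assume "s \<in> dstab k l c d w"
        then have s: "s \<in> Pgrp k l" "conjm n w s \<in> Pgrp c d" by (auto simp: dstab_def n_def)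
        note G = G0 PG[OF s(1)]
        have "conjm n w (minv n s) = minv n (conjm n w s)"
          unfolding conjm_def using G by (simp add: grp)
        then have "conjm n w (minv n s) \<in> Pgrp c d" using Pm'[OF s(2)] by simp
        moreover have "?g (mmul n p0' (conjm n w (minv n s)), mmul n s p0) = a"
          unfolding conjm_def p0(3) using G by (simp add: grp)
        ultimately show "(mmul n p0' (conjm n w (minv n s)), mmul n s p0) \<in> {x \<in> ?X. ?g x = a}"
          using p0 s Pp Pp' by auto
      qed
      show "(\<lambda>(p', p). mmul n p (minv n p0)) \<in> {x \<in> ?X. ?g x = a} \<rightarrow> dstab k l c d w"
      proof
        fix x assume "x \<in> {x \<in> ?X. ?g x = a}"
        then obtain p' p where x: "x = (p',p)" "p' \<in> Pgrp c d" "p \<in> Pgrp k l" "mmul n (mmul n p' w) p = mmul n (mmul n p0' w) p0"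
          using p0(3) by auto
        note G = G0 PG'[OF x(2)] PG[OF x(3)]
        have "mmul n (minv n p') (mmul n (mmul n (mmul n p' w) p) (mmul n (minv n p0) (minv n w))) =
              mmul n (minv n p') (mmul n (mmul n (mmul n p0' w) p0) (mmul n (minv n p0) (minv n w)))"
          by (simp only: x(4))
        then have "conjm n w (mmul n p (minv n p0)) = mmul n (minv n p') p0'"
          unfolding conjm_def using G by (simp add: grp minv_r)
        then have "conjm n w (mmul n p (minv n p0)) \<in> Pgrp c d" using Pp' Pm' x p0 by simp
        then show "(case x of (p', p) \<Rightarrow> mmul n p (minv n p0)) \<in> dstab k l c d w"
          using Pp Pm x p0 by (simp add: dstab_def n_def)
      qed
      show "(case (mmul n p0' (conjm n w (minv n s)), mmul n s p0) of (p', p) \<Rightarrow> mmul n p (minv n p0)) = s"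
        if "s \<in> dstab k l c d w" for s
      proof -
        have "s \<in> GL n" using that PG by (auto simp: dstab_def)
        then show ?thesis using G0 by (simp add: grp minv_r)
      qed
      show "(mmul n p0' (conjm n w (minv n (case x of (p', p) \<Rightarrow> mmul n p (minv n p0)))), mmul n (case x of (p', p) \<Rightarrow> mmul n p (minv n p0)) p0) = x"
        if xx: "x \<in> {x \<in> ?X. ?g x = a}" for x
      proof -
        obtain p' p where x: "x = (p',p)" "p' \<in> Pgrp c d" "p \<in> Pgrp k l" "mmul n (mmul n p' w) p = mmul n (mmul n p0' w) p0"
          using xx p0(3) by auto
        note G = G0 PG'[OF x(2)] PG[OF x(3)]
        have "mmul n (mmul n (mmul n p' w) p) (mmul n (minv n p) (minv n w)) =
              mmul n (mmul n (mmul n p0' w) p0) (mmul n (minv n p) (minv n w))"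
          by (simp only: x(4))
        then have "p' = mmul n p0' (conjm n w (mmul n p0 (minv n p)))"
          unfolding conjm_def using G by (simp add: grp minv_r)
        then show ?thesis using x G by (simp add: grp minv_l)
      qed
    qed
    then show "(\<Sum>x\<in>{x \<in> ?X. ?g x = a}. 1) = card (dstab k l c d w)" by (simp add: bij_betw_same_card)
  qed
  also have "\<dots> = card (dcoset k l c d w) * card (dstab k l c d w)" by (simp add: dcoset_def n_def)
  finally show ?thesis by (simp add: card_cartesian_product)
qed

lemma dstab_pos:
  assumes "w \<in> GL (k+l)" "k + l = c + d" shows "card (dstab k l c d w) > 0"
proof -
  have "idm (k+l) \<in> dstab k l c d w"
    using idm_Pgrp[of c d] idm_Pgrp[of k l] assms(1)
    unfolding dstab_def assms(2)[symmetric] by (simp add: conjm_def GL_gl minv_r)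
  moreover have "finite (dstab k l c d w)" by (rule finite_subset[OF _ finite_Pgrp]) (auto simp: dstab_def)
  ultimately show ?thesis by (auto simp: card_gt_0_iff)
qed

text \<open>The possible dimensions of the intersection: under these bounds the sizes
  \<open>k1\<close>, \<open>k - k1\<close>, \<open>c - k1\<close> and \<open>k1 + l - c\<close> of
  the four blocks are genuine differences of natural numbers.\<close>

definition dc_indices :: "nat \<Rightarrow> nat \<Rightarrow> nat \<Rightarrow> nat \<Rightarrow> nat set" where
  "dc_indices k l c d = {k1. k1 \<le> k \<and> k1 \<le> c \<and> c \<le> k1 + l}"

lemma finite_dc_indices [simp]: "finite (dc_indices k l c d)"
  by (rule finite_subset[of _ "{..k}"]) (auto simp: dc_indices_def)

lemma sum_double_cosets:
  fixes \<Phi> :: "'a::{finite,field} mat \<Rightarrow> complex"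
  assumes n: "k + l = c + d"
    and inv: "\<And>p p' a. p \<in> Pgrp k l \<Longrightarrow> p' \<in> Pgrp c d \<Longrightarrow> a \<in> GL (k+l) \<Longrightarrow> \<Phi> (mmul (k+l) (mmul (k+l) p' a) p) = \<Phi> a"
  shows "(\<Sum>a\<in>GL (k+l). \<Phi> a) = (\<Sum>k1\<in>dc_indices k l c d. \<Phi> (wmat k1 (k-k1) (c-k1) (k+l)) *
     (of_nat (card (Pgrp c d :: 'a mat set)) * of_nat (card (Pgrp k l :: 'a mat set)) /
      of_nat (card (dstab k l c d (wmat k1 (k-k1) (c-k1) (k+l) :: 'a mat)))))"
proof -
  define n where "n = k + l"
  define w where "w k1 = (wmat k1 (k-k1) (c-k1) n :: 'a mat)" for k1
  have wG: "w k1 \<in> GL n" if "k1 \<in> dc_indices k l c d" for k1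
    unfolding w_def using that n by (intro wmat_GL) (auto simp: dc_indices_def n_def)
  have nn: "n = k + l" "n = c + d" using n by (simp_all add: n_def)
  have cover: "(GL n :: 'a mat set) = (\<Union>k1\<in>dc_indices k l c d. dcoset k l c d (w k1))"
  proof (intro equalityI subsetI)
    fix a :: "'a mat" assume "a \<in> GL n"
    from bruhat_exists[OF this nn] obtain k1 k2 l1 l2 p p' where b: "k = k1 + k2" "l = l1 + l2" "c = k1 + l1" "d = k2 + l2"
      "p \<in> Pgrp k l" "p' \<in> Pgrp c d" "a = mmul n (mmul n p' (wmat k1 k2 l1 n)) p" .
    then have "k1 \<in> dc_indices k l c d" "w k1 = wmat k1 k2 l1 n" by (auto simp: dc_indices_def w_def)
    moreover from this b have "a \<in> dcoset k l c d (w k1)" by (auto simp: dcoset_def n_def)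
    ultimately show "a \<in> (\<Union>k1\<in>dc_indices k l c d. dcoset k l c d (w k1))" by blast
  next
    fix a assume "a \<in> (\<Union>k1\<in>dc_indices k l c d. dcoset k l c d (w k1))"
    then obtain k1 p p' where "k1 \<in> dc_indices k l c d" "p \<in> Pgrp k l" "p' \<in> Pgrp c d" "a = mmul n (mmul n p' (w k1)) p"
      by (auto simp: dcoset_def n_def)
    then show "a \<in> GL n" using wG nn by (auto intro!: GL_mmul simp: Pgrp_def)
  qed
  have key: "card {v \<in> V k. mv n a v \<in> V c} = card (UNIV :: 'a set) ^ k1" if k1: "k1 \<in> dc_indices k l c d" and a: "a \<in> dcoset k l c d (w k1)" for k1 and a :: "'a mat"
  proof -
    obtain p p' where p: "p \<in> Pgrp k l" "p' \<in> Pgrp c d" "a = mmul n (mmul n p' (w k1)) p"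
      using a by (auto simp: dcoset_def n_def)
    show ?thesis
      \<comment> \<open>The instance is the fourth block size \<open>l2\<close>, namely
        \<open>l - (c - k1)\<close> written with a single subtraction that does not
        truncate.\<close>
      by (rule bruhat_unique[OF nn _ _ _ _ p(1,2) p(3)[unfolded w_def], of "l + k1 - c"])
         (use k1 n in \<open>auto simp: dc_indices_def\<close>)
  qed
  note q = card_field_gt_1[where 'a = 'a]
  have disj: "dcoset k l c d (w k1) \<inter> dcoset k l c d (w k1') = {}"
    if kk: "k1 \<in> dc_indices k l c d" "k1' \<in> dc_indices k l c d" "k1 \<noteq> k1'" for k1 k1'
  proof (rule ccontr)
    assume "\<not> ?thesis"
    then obtain a where "a \<in> dcoset k l c d (w k1)" "a \<in> dcoset k l c d (w k1')" by blast
    then have "card (UNIV :: 'a set) ^ k1 = card (UNIV :: 'a set) ^ k1'" using key[OF kk(1), of a] key[OF kk(2), of a] by simp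
    then show False using q kk(3) by simp
  qed
  have fin: "finite (dcoset k l c d v)" for v :: "'a mat" by (simp add: dcoset_def)
  have "(\<Sum>a\<in>GL n. \<Phi> a) = (\<Sum>k1\<in>dc_indices k l c d. \<Sum>a\<in>dcoset k l c d (w k1). \<Phi> a)"
    unfolding cover by (rule sum.UNION_disjoint) (auto simp: fin disj)
  also have "\<dots> = (\<Sum>k1\<in>dc_indices k l c d. \<Phi> (w k1) *
     (of_nat (card (Pgrp c d :: 'a mat set)) * of_nat (card (Pgrp k l :: 'a mat set)) / of_nat (card (dstab k l c d (w k1)))))"
  proof (rule sum.cong[OF refl])
    fix k1 assume k1: "k1 \<in> dc_indices k l c d"
    note wG' = wG[OF k1, unfolded n_def]
    have "(\<Sum>a\<in>dcoset k l c d (w k1). \<Phi> a) = (\<Sum>a\<in>dcoset k l c d (w k1). \<Phi> (w k1))"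
      by (rule sum.cong[OF refl]) (auto simp: dcoset_def inv wG')
    also have "\<dots> = \<Phi> (w k1) * of_nat (card (dcoset k l c d (w k1)))" by simp
    also have "(of_nat (card (dcoset k l c d (w k1))) :: complex) =
      of_nat (card (Pgrp c d :: 'a mat set)) * of_nat (card (Pgrp k l :: 'a mat set)) / of_nat (card (dstab k l c d (w k1)))"
      using card_dcoset[OF wG' n] dstab_pos[OF wG' n]
      by (simp add: nonzero_eq_divide_eq flip: of_nat_mult)
    finally show "(\<Sum>a\<in>dcoset k l c d (w k1). \<Phi> a) = \<Phi> (w k1) *
     (of_nat (card (Pgrp c d :: 'a mat set)) * of_nat (card (Pgrp k l :: 'a mat set)) / of_nat (card (dstab k l c d (w k1))))" .
  qed
  finally show ?thesis by (simp add: w_def n_def)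
qed

section \<open>The Mackey formula as a sum over double cosets\<close>

lemma conjm_parab_bij:
  fixes p :: "'a::{finite,comm_ring_1} mat"
  assumes "p \<in> Pgrp k l" shows "bij_betw (conjm (k+l) p) (parab k l) (parab k l)"
  using assms Pgrp_minv[OF assms] by (intro bij_betwI[of _ _ _ "conjm (k+l) (minv (k+l) p)"])
    (auto simp: conjm_parab conjm_inv parab_gl Pgrp_def)

text \<open>The contribution of the group element \<open>a\<close> to the inner product of two induced functions.\<close>

definition dcsum :: "nat \<Rightarrow> nat \<Rightarrow> nat \<Rightarrow> nat \<Rightarrow> ('a::{finite,field} mat \<Rightarrow> 'a mat \<Rightarrow> complex) \<Rightarrow>
    ('a mat \<Rightarrow> 'a mat \<Rightarrow> complex) \<Rightarrow> 'a mat \<Rightarrow> complex" where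
  "dcsum k l c d f h a = (\<Sum>y\<in>parab k l. f (blk1 k y) (blk2 k l y) *
     (if conjm (k+l) a y \<in> parab c d then h (blk1 c (conjm (k+l) a y)) (blk2 c d (conjm (k+l) a y)) else 0))"

text \<open>Conjugation by \<open>p'\<close> acts on the diagonal blocks seen by \<open>h\<close>
  through conjugations, to which \<open>h\<close> is blind; conjugation by \<open>p\<close> is a
  change of variable in \<open>parab k l\<close> that leaves \<open>f\<close> unchanged.\<close>

lemma dcsum_invariant:
  assumes f: "classfun2 k l f" and h: "classfun2 c d h" and n: "k + l = c + d"
    and p: "p \<in> Pgrp k l" "p' \<in> Pgrp c d" and a: "a \<in> GL (k+l)"
  shows "dcsum k l c d f h (mmul (k+l) (mmul (k+l) p' a) p) = dcsum k l c d f h a"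
proof -
  define F where "F y = f (blk1 k y) (blk2 k l y)" for y
  define H where "H y = (if y \<in> parab c d then h (blk1 c y) (blk2 c d y) else 0)" for y
  have FP: "F (conjm (k+l) p y) = F y" if "y \<in> parab k l" for y
    using that p by (simp add: F_def conjm_parab blk_Pgrp classfun2_conj[OF f])
  have p'G: "p' \<in> GL (k+l)" "p \<in> GL (k+l)" using p n by (auto simp: Pgrp_def)
  have HP: "H (conjm (k+l) p' y) = H y" if y: "y \<in> gl (k+l)" for y
  proof (cases "y \<in> parab c d")
    case True
    then show ?thesis using p(2) by (simp add: n H_def conjm_parab blk_Pgrp classfun2_conj[OF h])
  next
    case False
    have "conjm (k+l) p' y \<notin> parab c d"
    proof
      assume "conjm (k+l) p' y \<in> parab c d"
      then have "conjm (c+d) (minv (c+d) p') (conjm (c+d) p' y) \<in> parab c d"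
        using conjm_parab(1)[OF Pgrp_minv[OF p(2)]] n by simp
      then show False using False conjm_inv(2)[OF p'G(1) y] n by simp
    qed
    then show ?thesis using False by (simp add: H_def)
  qed
  have "dcsum k l c d f h (mmul (k+l) (mmul (k+l) p' a) p) = (\<Sum>y\<in>parab k l. F y * H (conjm (k+l) p' (conjm (k+l) a (conjm (k+l) p y))))"
    unfolding dcsum_def F_def[symmetric] H_def[symmetric] by (simp add: conjm_mmul GL_mmul p'G a)
  also have "\<dots> = (\<Sum>y\<in>parab k l. F (conjm (k+l) p y) * H (conjm (k+l) a (conjm (k+l) p y)))"
    by (intro sum.cong refl) (simp add: HP FP)
  also have "\<dots> = (\<Sum>y\<in>parab k l. F y * H (conjm (k+l) a y))"
    by (rule sum.reindex_bij_betw[OF conjm_parab_bij[OF p(1)]])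
  finally show ?thesis by (simp add: dcsum_def F_def H_def)
qed

text \<open>One induction is removed by adjunction and the other is unfolded, which gives a sum of
  \<open>dcsum\<close> over the group divided by the orders of both parabolic groups. The size of a
  double coset is the product of these orders over |dstab|, so both cancel.\<close>

lemma mackey_double_coset:
  fixes f h :: "'a::{finite,field} mat \<Rightarrow> 'a mat \<Rightarrow> complex"
  assumes f: "classfun2 k l f" and h: "classfun2 c d h" and n: "k + l = c + d"
  shows "form (k+l) (hc_ind k l f) (hc_ind c d h) =
    (\<Sum>k1\<in>dc_indices k l c d. dcsum k l c d f (\<lambda>x y. cnj (h x y)) (wmat k1 (k-k1) (c-k1) (k+l)) /
      of_nat (card (dstab k l c d (wmat k1 (k-k1) (c-k1) (k+l) :: 'a mat))))"
proof -
  let ?h = "\<lambda>x y. cnj (h x y)"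
  let ?P = "of_nat (card (Pgrp k l :: 'a mat set)) :: complex"
  let ?P' = "of_nat (card (Pgrp c d :: 'a mat set)) :: complex"
  have P: "?P \<noteq> 0" "?P' \<noteq> 0" using card_Pgrp_pos[of k l, where 'a = 'a] card_Pgrp_pos[of c d, where 'a = 'a] by auto
  have h': "classfun2 c d ?h" using h by (auto simp: classfun2_def)
  have cf: "classfun (k+l) (hc_ind c d h)" using hc_ind_classfun[of c d h] n by simp
  have ind: "cnj (hc_ind c d h y) = (\<Sum>a\<in>GL (k+l). if conjm (k+l) a y \<in> parab c d
       then ?h (blk1 c (conjm (k+l) a y)) (blk2 c d (conjm (k+l) a y)) else 0) / ?P'" if "y \<in> parab k l" for y
    using parab_gl[OF that] unfolding hc_ind_def n[symmetric] by (simp add: sum.inter_filter if_distrib[of cnj] cong: if_cong)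
  have "form (k+l) (hc_ind k l f) (hc_ind c d h) = (\<Sum>y\<in>parab k l. f (blk1 k y) (blk2 k l y) *
      ((\<Sum>a\<in>GL (k+l). if conjm (k+l) a y \<in> parab c d
       then ?h (blk1 c (conjm (k+l) a y)) (blk2 c d (conjm (k+l) a y)) else 0) / ?P')) / ?P"
    unfolding adjunction_sum[OF cf] by (simp add: ind)
  also have "\<dots> = (\<Sum>a\<in>GL (k+l). dcsum k l c d f ?h a) / (?P * ?P')"
    unfolding dcsum_def by (subst sum.swap) (simp add: sum_distrib_left sum_divide_distrib mult_ac)
  also have "(\<Sum>a\<in>GL (k+l). dcsum k l c d f ?h a) = (\<Sum>k1\<in>dc_indices k l c d. dcsum k l c d f ?h (wmat k1 (k-k1) (c-k1) (k+l)) *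
     (?P' * ?P / of_nat (card (dstab k l c d (wmat k1 (k-k1) (c-k1) (k+l) :: 'a mat)))))"
    by (rule sum_double_cosets[OF n]) (rule dcsum_invariant[OF f h' n])
  finally show ?thesis using P by (simp add: sum_divide_distrib mult_ac)
qed

section \<open>Factorization of the contribution of one double coset\<close>

text \<open>Conjugation by the permutation matrix \<open>wmat\<close>, as a map of matrices: it interchanges the two
 middle blocks in a decomposition into blocks of sizes \<open>(k1,k2,l1,l2)\<close>.\<close>

definition swp :: "nat \<Rightarrow> nat \<Rightarrow> nat \<Rightarrow> nat \<Rightarrow> 'a::zero mat \<Rightarrow> 'a mat" where
  "swp k1 k2 l1 l2 y = (\<lambda>i j. if i < k1+k2+l1+l2 \<and> j < k1+k2+l1+l2
     then y (blkperm k1 k2 l1 i) (blkperm k1 k2 l1 j) else 0)"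

lemma conjm_wmat_swp: "conjm (k1+k2+(l1+l2)) (wmat k1 k2 l1 (k1+k2+(l1+l2)) :: 'a::{finite,comm_ring_1} mat) = swp k1 k2 l1 l2"
  by (simp add: fun_eq_iff conjm_wmat swp_def add.assoc)

lemma swp_gl: "swp k1 k2 l1 l2 y \<in> gl (k1+l1+(k2+l2))"
  by (auto simp: swp_def gl_def)

lemma swp_inv: "y \<in> gl (k1+k2+(l1+l2)) \<Longrightarrow> swp k1 l1 k2 l2 (swp k1 k2 l1 l2 y) = y"
proof (intro ext)
  fix i j assume y: "y \<in> gl (k1+k2+(l1+l2))"
  show "swp k1 l1 k2 l2 (swp k1 k2 l1 l2 y) i j = y i j"
    using y blkperm_lt[of k1 l1 k2 "k1+l1+k2+l2" i] blkperm_lt[of k1 l1 k2 "k1+l1+k2+l2" j]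
    by (auto simp: swp_def blkperm_blkperm gl_def not_less add_ac)
qed

lemma swp_add: "swp k1 k2 l1 l2 (x + y) = swp k1 k2 l1 l2 x + swp k1 k2 l1 l2 (y :: 'a::comm_ring_1 mat)"
  by (auto simp: swp_def fun_eq_iff)
lemma swp_diff: "swp k1 k2 l1 l2 (x - y) = swp k1 k2 l1 l2 x - swp k1 k2 l1 l2 (y :: 'a::comm_ring_1 mat)"
  by (auto simp: swp_def fun_eq_iff)

lemma bdiag_add: "bdiag k l (x + x') (y + y') = bdiag k l x y + bdiag k l x' (y' :: 'a::comm_ring_1 mat)"
  by (auto simp: bdiag_def fun_eq_iff)

text \<open>After the swap, blocks 1 and 3 form the first group and blocks 2 and 4 the second, so
  the positions (1,2) and (3,4) both lead from the first group to the second.\<close>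

lemma swp_bdiag_nilrad:
  fixes u12 u34 :: "'a::comm_ring_1 mat"
  assumes "u12 \<in> nilrad k1 k2" "u34 \<in> nilrad l1 l2"
  shows "swp k1 k2 l1 l2 (bdiag (k1+k2) (l1+l2) u12 u34) \<in> nilrad (k1+l1) (k2+l2)"
proof -
  have 1: "i < k1" "k1 \<le> j" if "u12 i j \<noteq> 0" for i j
    using that assms(1) unfolding nilrad_def by blast+
  have 2: "i < l1" "l1 \<le> j" if "u34 i j \<noteq> 0" for i j
    using that assms(2) unfolding nilrad_def by blast+
  have "i < k1 + l1 \<and> k1 + l1 \<le> j" if nz: "swp k1 k2 l1 l2 (bdiag (k1+k2) (l1+l2) u12 u34) i j \<noteq> 0" for i j
  proof -
    let ?i = "blkperm k1 k2 l1 i" and ?j = "blkperm k1 k2 l1 j"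
    have n: "i < k1+k2+l1+l2" "j < k1+k2+l1+l2" and nz': "bdiag (k1+k2) (l1+l2) u12 u34 ?i ?j \<noteq> 0"
      using nz by (auto simp: swp_def split: if_splits)
    consider "?i < k1" "k1 \<le> ?j" "?j < k1 + k2" | "k1 + k2 \<le> ?i" "?i < k1 + k2 + l1" "k1 + k2 + l1 \<le> ?j"
      using nz' 1[of ?i ?j] 2[of "?i - (k1+k2)" "?j - (k1+k2)"] by (fastforce simp: bdiag_def split: if_splits)
    then show ?thesis using n by cases (auto simp: blkperm_def split: if_splits)
  qed
  then show ?thesis using swp_gl[of k1 k2 l1 l2] by (simp add: nilrad_def)
qed

lemma swp_bdiag:
  "swp k1 k2 l1 l2 (bdiag (k1+k2) (l1+l2) (bdiag k1 k2 y1 y2) (bdiag l1 l2 y3 y4)) =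
   bdiag (k1+l1) (k2+l2) (bdiag k1 l1 y1 y3) (bdiag k2 l2 y2 y4)"
proof (intro ext)
  fix i j
  have c: "i < k1 \<or> (\<exists>r<l1. i = k1 + r) \<or> (\<exists>r<k2. i = k1 + l1 + r) \<or> (\<exists>r<l2. i = k1 + l1 + k2 + r)
      \<or> k1+l1+k2+l2 \<le> i" for i
  proof -
    consider "i < k1" | "k1 \<le> i" "i < k1+l1" | "k1+l1 \<le> i" "i < k1+l1+k2" | "k1+l1+k2 \<le> i" "i < k1+l1+k2+l2" | "k1+l1+k2+l2 \<le> i"
      by linarith
    then show ?thesis
    proof cases
      case 2 then have "i - k1 < l1 \<and> i = k1 + (i - k1)" by simp then show ?thesis by blast
    next
      case 3 then have "i - (k1+l1) < k2 \<and> i = k1 + l1 + (i - (k1+l1))" by simp then show ?thesis by blast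
    next
      case 4 then have "i - (k1+l1+k2) < l2 \<and> i = k1 + l1 + k2 + (i - (k1+l1+k2))" by simp then show ?thesis by blast
    qed auto
  qed
  show "swp k1 k2 l1 l2 (bdiag (k1+k2) (l1+l2) (bdiag k1 k2 y1 y2) (bdiag l1 l2 y3 y4)) i j =
   bdiag (k1+l1) (k2+l2) (bdiag k1 l1 y1 y3) (bdiag k2 l2 y2 y4) i j"
    using c[of i] c[of j] by (elim disjE exE conjE) (simp_all add: swp_def bdiag_def blkperm_def)
qed

lemma blk_swp:
  "blk1 k1 (blk1 (k1+l1) (swp k1 k2 l1 l2 y)) = blk1 k1 (blk1 (k1+k2) y)"
  "blk2 k1 l1 (blk1 (k1+l1) (swp k1 k2 l1 l2 y)) = blk1 l1 (blk2 (k1+k2) (l1+l2) y)"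
  "blk1 k2 (blk2 (k1+l1) (k2+l2) (swp k1 k2 l1 l2 y)) = blk2 k1 k2 (blk1 (k1+k2) y)"
  "blk2 k2 l2 (blk2 (k1+l1) (k2+l2) (swp k1 k2 l1 l2 y)) = blk2 l1 l2 (blk2 (k1+k2) (l1+l2) y)"
  by (auto simp: fun_eq_iff blk1_def blk2_def swp_def blkperm_def add_ac)

text \<open>The positions (2,1) and (4,3), below the diagonal inside the two diagonal blocks of
  \<open>y\<close>, lie in the lower left corner of the swapped matrix.\<close>

lemma blk_swp_parab:
  assumes y: "y \<in> parab (k1+k2) (l1+l2)" and s: "swp k1 k2 l1 l2 y \<in> parab (k1+l1) (k2+l2)"
  shows "blk1 (k1+k2) y \<in> parab k1 k2" "blk2 (k1+k2) (l1+l2) y \<in> parab l1 l2"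
proof -
  have z: "swp k1 k2 l1 l2 y i j = 0" if "k1+l1 \<le> i" "j < k1+l1" for i j using s that by (simp add: parab_def)
  have "blk1 (k1+k2) y i j = 0" if "k1 \<le> i" "j < k1" for i j
    using z[of "i+l1" j] that by (auto simp: blk1_def swp_def blkperm_def)
  then show "blk1 (k1+k2) y \<in> parab k1 k2" by (simp add: parab_def)
  have "blk2 (k1+k2) (l1+l2) y i j = 0" if "l1 \<le> i" "j < l1" for i j
    using z[of "i+(k1+k2)" "j+k1"] that by (auto simp: blk2_def swp_def blkperm_def add_ac)
  then show "blk2 (k1+k2) (l1+l2) y \<in> parab l1 l2" by (simp add: parab_def)
qed

text \<open>\<open>meetalg\<close> is the Lie algebra stabilizing both the span of blocks 1, 2 and the span of blocks
 1, 3; \<open>corner\<close> consists of its elements supported on block position (1,4), the only entries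
 that none of the four restricted functions sees.\<close>

definition corner :: "nat \<Rightarrow> nat \<Rightarrow> nat \<Rightarrow> nat \<Rightarrow> 'a::zero mat set" where
  "corner k1 k2 l1 l2 = {u \<in> nilrad (k1+k2) (l1+l2). swp k1 k2 l1 l2 u \<in> nilrad (k1+l1) (k2+l2)}"

definition meetalg :: "nat \<Rightarrow> nat \<Rightarrow> nat \<Rightarrow> nat \<Rightarrow> 'a::zero mat set" where
  "meetalg k1 k2 l1 l2 = {y \<in> parab (k1+k2) (l1+l2). swp k1 k2 l1 l2 y \<in> parab (k1+l1) (k2+l2)}"

lemma nilrad_diff: "x \<in> nilrad k l \<Longrightarrow> y \<in> nilrad k l \<Longrightarrow> x - y \<in> nilrad k l" for x y :: "'a::comm_ring_1 mat"
  using nilrad_add[of x k l "- y"] nilrad_minus[of y k l] by simp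

text \<open>The two block shapes together leave the four diagonal positions and (1,2), (3,4), (1,3),
  (2,4), (1,4), which are the nine coordinates. The diagonal blocks for the groups {1,2}, {3,4},
  {1,3}, {2,4} each see two diagonal entries and one off-diagonal entry of their own.\<close>

lemma sum_meetalg:
  fixes G :: "'a::{finite,comm_ring_1} mat \<Rightarrow> 'a mat \<Rightarrow> 'a mat \<Rightarrow> 'a mat \<Rightarrow> 'b::comm_monoid_add"
  shows "(\<Sum>y\<in>meetalg k1 k2 l1 l2. G (blk1 (k1+k2) y) (blk2 (k1+k2) (l1+l2) y)
       (blk1 (k1+l1) (swp k1 k2 l1 l2 y)) (blk2 (k1+l1) (k2+l2) (swp k1 k2 l1 l2 y))) =
    (\<Sum>(y1,y2,y3,y4,u12,u34,u13,u24,u14)\<in>gl k1 \<times> gl k2 \<times> gl l1 \<times> gl l2 \<times> nilrad k1 k2 \<times> nilrad l1 l2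
        \<times> nilrad k1 l1 \<times> nilrad k2 l2 \<times> (corner k1 k2 l1 l2 :: 'a mat set).
      G (bdiag k1 k2 y1 y2 + u12) (bdiag l1 l2 y3 y4 + u34) (bdiag k1 l1 y1 y3 + u13) (bdiag k2 l2 y2 y4 + u24))"
proof -
  let ?k = "k1+k2" and ?l = "l1+l2" and ?c = "k1+l1" and ?d = "k2+l2"
  let ?s = "swp k1 k2 l1 l2 :: 'a mat \<Rightarrow> _" and ?t = "swp k1 l1 k2 l2 :: 'a mat \<Rightarrow> _"
  let ?G = "\<lambda>y. G (blk1 ?k y) (blk2 ?k ?l y) (blk1 ?c (?s y)) (blk2 ?c ?d (?s y))"
  define T :: "('a mat \<times> 'a mat \<times> 'a mat \<times> 'a mat \<times> 'a mat \<times> 'a mat \<times> 'a mat \<times> 'a mat \<times> 'a mat) set"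
    where "T = gl k1 \<times> gl k2 \<times> gl l1 \<times> gl l2 \<times> nilrad k1 k2 \<times> nilrad l1 l2
        \<times> nilrad k1 l1 \<times> nilrad k2 l2 \<times> corner k1 k2 l1 l2"
  \<comment> \<open>\<open>u13\<close> and \<open>u24\<close> are given in the swapped block order;
    \<open>?t\<close> carries them back to the original one.\<close>
  define build :: "'a mat \<times> 'a mat \<times> 'a mat \<times> 'a mat \<times> 'a mat \<times> 'a mat \<times> 'a mat \<times> 'a mat \<times> 'a mat \<Rightarrow> 'a mat" where
    "build = (\<lambda>(y1,y2,y3,y4,u12,u34,u13,u24,u14).
       bdiag ?k ?l (bdiag k1 k2 y1 y2 + u12) (bdiag l1 l2 y3 y4 + u34) + ?t (bdiag ?c ?d u13 u24) + u14)"
  define D1 where "D1 y = blk1 ?k y - bdiag k1 k2 (blk1 k1 (blk1 ?k y)) (blk2 k1 k2 (blk1 ?k y))" for y :: "'a mat"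
  define D2 where "D2 y = blk2 ?k ?l y - bdiag l1 l2 (blk1 l1 (blk2 ?k ?l y)) (blk2 l1 l2 (blk2 ?k ?l y))" for y :: "'a mat"
  define D3 where "D3 y = blk1 ?c (?s y) - bdiag k1 l1 (blk1 k1 (blk1 ?k y)) (blk1 l1 (blk2 ?k ?l y))" for y :: "'a mat"
  define D4 where "D4 y = blk2 ?c ?d (?s y) - bdiag k2 l2 (blk2 k1 k2 (blk1 ?k y)) (blk2 l1 l2 (blk2 ?k ?l y))" for y :: "'a mat"
  \<comment> \<open>For \<open>y\<close> in \<open>meetalg\<close> only the entry (1,4) survives
    these subtractions, so \<open>D5 y\<close> will lie in \<open>corner\<close>.\<close>
  define D5 where "D5 y = y - bdiag ?k ?l (blk1 ?k y) (blk2 ?k ?l y) - ?t (bdiag ?c ?d (D3 y) (D4 y))" for y :: "'a mat"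
  define parts where "parts y = (blk1 k1 (blk1 ?k y), blk2 k1 k2 (blk1 ?k y), blk1 l1 (blk2 ?k ?l y),
     blk2 l1 l2 (blk2 ?k ?l y), D1 y, D2 y, D3 y, D4 y, D5 y)" for y
  have gln: "y \<in> gl (?c + ?d)" if "y \<in> gl (?k + ?l)" for y :: "'a mat" using that by (simp add: add_ac)
  have st: "?t (?s y) = y" if "y \<in> gl (?k + ?l)" for y by (rule swp_inv[OF that])
  have ts: "?s (?t y) = y" if "y \<in> gl (?c + ?d)" for y by (rule swp_inv[OF that])
  have sb: "?s (bdiag ?k ?l (bdiag k1 k2 y1 y2 + u12) (bdiag l1 l2 y3 y4 + u34)) =
     bdiag ?c ?d (bdiag k1 l1 y1 y3) (bdiag k2 l2 y2 y4) + ?s (bdiag ?k ?l u12 u34)" for y1 y2 y3 y4 u12 u34 :: "'a mat"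
    by (simp add: bdiag_add swp_add swp_bdiag)
  have build: "build x \<in> meetalg k1 k2 l1 l2" "parts (build x) = x"
    "?G (build x) = (\<lambda>(y1,y2,y3,y4,u12,u34,u13,u24,u14).
       G (bdiag k1 k2 y1 y2 + u12) (bdiag l1 l2 y3 y4 + u34) (bdiag k1 l1 y1 y3 + u13) (bdiag k2 l2 y2 y4 + u24)) x"
    if xT: "x \<in> T" for x
  proof -
    obtain y1 y2 y3 y4 u12 u34 u13 u24 u14 where x: "x = (y1,y2,y3,y4,u12,u34,u13,u24,u14)" by (cases x) auto
    have y: "y1 \<in> gl k1" "y2 \<in> gl k2" "y3 \<in> gl l1" "y4 \<in> gl l2"
      and u: "u12 \<in> nilrad k1 k2" "u34 \<in> nilrad l1 l2" "u13 \<in> nilrad k1 l1" "u24 \<in> nilrad k2 l2"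
      and u14: "u14 \<in> nilrad ?k ?l" "?s u14 \<in> nilrad ?c ?d" using xT by (auto simp: x T_def corner_def)
    have n1: "?t (bdiag ?c ?d u13 u24) \<in> nilrad ?k ?l" by (rule swp_bdiag_nilrad[OF u(3,4)])
    have n2: "?s (bdiag ?k ?l u12 u34) \<in> nilrad ?c ?d" by (rule swp_bdiag_nilrad[OF u(1,2)])
    have X: "bdiag k1 k2 y1 y2 + u12 \<in> gl ?k" "bdiag l1 l2 y3 y4 + u34 \<in> gl ?l"
      using gl_add[OF bdiag_gl nilrad_gl[OF u(1)]] gl_add[OF bdiag_gl nilrad_gl[OF u(2)]] by auto
    have U: "u13 \<in> gl ?c" "u24 \<in> gl ?d" using u by (auto intro!: nilrad_gl)
    have sB: "?s (build x) = bdiag ?c ?d (bdiag k1 l1 y1 y3) (bdiag k2 l2 y2 y4) + ?s (bdiag ?k ?l u12 u34) + bdiag ?c ?d u13 u24 + ?s u14"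
      unfolding build_def x using sb[of y1 y2 u12 y3 y4 u34] by (simp add: swp_add ts)
    have "build x \<in> parab ?k ?l"
      unfolding build_def x using n1 u14 by (simp add: parab_add nilrad_parab)
    moreover have "?s (build x) \<in> parab ?c ?d"
      unfolding sB using n2 u14 by (simp add: parab_add nilrad_parab)
    ultimately show "build x \<in> meetalg k1 k2 l1 l2" by (simp add: meetalg_def)
    have b: "blk1 ?k (build x) = bdiag k1 k2 y1 y2 + u12" "blk2 ?k ?l (build x) = bdiag l1 l2 y3 y4 + u34"
      unfolding build_def x using X n1 u14 by (simp_all add: blk_add)
    have b': "blk1 ?c (?s (build x)) = bdiag k1 l1 y1 y3 + u13" "blk2 ?c ?d (?s (build x)) = bdiag k2 l2 y2 y4 + u24"
      unfolding sB using U n2 u14 by (simp_all add: blk_add)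
    show "?G (build x) = (\<lambda>(y1,y2,y3,y4,u12,u34,u13,u24,u14).
       G (bdiag k1 k2 y1 y2 + u12) (bdiag l1 l2 y3 y4 + u34) (bdiag k1 l1 y1 y3 + u13) (bdiag k2 l2 y2 y4 + u24)) x"
      unfolding b b' by (simp add: x)
    have D: "D1 (build x) = u12" "D2 (build x) = u34" "D3 (build x) = u13" "D4 (build x) = u24"
      unfolding D1_def D2_def D3_def D4_def b b' using y u by (simp_all add: blk_add)
    have "D5 (build x) = u14" unfolding D5_def D b by (simp add: build_def x)
    then show "parts (build x) = x" unfolding parts_def D b using y u by (simp add: x blk_add)
  qed
  have parts: "parts y \<in> T" "build (parts y) = y" if yM: "y \<in> meetalg k1 k2 l1 l2" for y
  proof -
    have y: "y \<in> parab ?k ?l" "?s y \<in> parab ?c ?d" using yM by (auto simp: meetalg_def)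
    have yg: "y \<in> gl (?k + ?l)" using y parab_gl by blast
    have t: "?t (?s y) = y" by (rule st[OF yg])
    note e = blk_swp_parab[OF y]
    \<comment> \<open>The same statement by symmetry: the swap with \<open>k2\<close> and
      \<open>l1\<close> exchanged undoes \<open>?s\<close>.\<close>
    have e': "blk1 ?c (?s y) \<in> parab k1 l1" "blk2 ?c ?d (?s y) \<in> parab k2 l2"
      using blk_swp_parab[of "?s y" k1 l1 k2 l2] y by (simp_all add: t)
    have d1: "D1 y \<in> nilrad k1 k2" unfolding D1_def by (rule parab_decomp[OF e(1)])
    have d2: "D2 y \<in> nilrad l1 l2" unfolding D2_def by (rule parab_decomp[OF e(2)])
    have d3: "D3 y \<in> nilrad k1 l1" unfolding D3_def
      using parab_decomp[OF e'(1)] by (simp add: blk_swp)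
    have d4: "D4 y \<in> nilrad k2 l2" unfolding D4_def
      using parab_decomp[OF e'(2)] by (simp add: blk_swp)
    have n1: "?t (bdiag ?c ?d (D3 y) (D4 y)) \<in> nilrad ?k ?l" by (rule swp_bdiag_nilrad[OF d3 d4])
    have n2: "?s (bdiag ?k ?l (D1 y) (D2 y)) \<in> nilrad ?c ?d" by (rule swp_bdiag_nilrad[OF d1 d2])
    have d5: "D5 y \<in> nilrad ?k ?l" unfolding D5_def by (rule nilrad_diff[OF parab_decomp[OF y(1)] n1])
    have bb: "bdiag ?k ?l (blk1 ?k y) (blk2 ?k ?l y) = bdiag ?k ?l
        (bdiag k1 k2 (blk1 k1 (blk1 ?k y)) (blk2 k1 k2 (blk1 ?k y)) + D1 y)
        (bdiag l1 l2 (blk1 l1 (blk2 ?k ?l y)) (blk2 l1 l2 (blk2 ?k ?l y)) + D2 y)"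
      by (simp add: D1_def D2_def)
    have s5: "?s (D5 y) = ?s y - (bdiag ?c ?d (bdiag k1 l1 (blk1 k1 (blk1 ?k y)) (blk1 l1 (blk2 ?k ?l y)))
        (bdiag k2 l2 (blk2 k1 k2 (blk1 ?k y)) (blk2 l1 l2 (blk2 ?k ?l y))) + ?s (bdiag ?k ?l (D1 y) (D2 y))) -
        bdiag ?c ?d (D3 y) (D4 y)"
      unfolding D5_def swp_diff bb sb by (simp add: ts)
    have g: "D3 y \<in> gl ?c" "D4 y \<in> gl ?d" using d3 d4 nilrad_gl by auto
    have "?s (D5 y) \<in> nilrad ?c ?d"
    proof (rule nilradI)
      show "?s (D5 y) \<in> parab ?c ?d"
        unfolding s5 using y n2 by (simp add: parab_diff parab_add nilrad_parab)
      show "blk1 ?c (?s (D5 y)) = 0" "blk2 ?c ?d (?s (D5 y)) = 0"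
        unfolding s5 using g n2 by (simp_all add: blk_diff blk_add) (simp_all add: D3_def D4_def)
    qed
    then have "D5 y \<in> corner k1 k2 l1 l2" using d5 by (simp add: corner_def)
    then show "parts y \<in> T" using d1 d2 d3 d4 by (simp add: parts_def T_def)
    show "build (parts y) = y" unfolding build_def parts_def by (simp add: bb[symmetric] D5_def)
  qed
  have "(\<Sum>y\<in>meetalg k1 k2 l1 l2. ?G y) = (\<Sum>x\<in>T. (\<lambda>(y1,y2,y3,y4,u12,u34,u13,u24,u14).
       G (bdiag k1 k2 y1 y2 + u12) (bdiag l1 l2 y3 y4 + u34) (bdiag k1 l1 y1 y3 + u13) (bdiag k2 l2 y2 y4 + u24)) x)"
  proof (rule sum.reindex_bij_witness[where i = build and j = parts])
    fix y :: "'a mat" assume y: "y \<in> meetalg k1 k2 l1 l2"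
    show "build (parts y) = y" "parts y \<in> T" by (rule parts[OF y])+
    show "(\<lambda>(y1,y2,y3,y4,u12,u34,u13,u24,u14).
       G (bdiag k1 k2 y1 y2 + u12) (bdiag l1 l2 y3 y4 + u34) (bdiag k1 l1 y1 y3 + u13) (bdiag k2 l2 y2 y4 + u24)) (parts y) = ?G y"
      using build(3)[OF parts(1)[OF y]] by (simp only: parts(2)[OF y])
  next
    fix x assume x: "x \<in> T"
    show "parts (build x) = x" "build x \<in> meetalg k1 k2 l1 l2" by (rule build[OF x])+
  qed
  then show ?thesis unfolding T_def .
qed

lemma corner_pos: "finite (corner k1 k2 l1 l2 :: 'a::{finite,comm_ring_1} mat set)" "card (corner k1 k2 l1 l2 :: 'a::{finite,comm_ring_1} mat set) > 0"
proof -
  show 1: "finite (corner k1 k2 l1 l2 :: 'a mat set)" by (rule finite_subset[OF _ finite_nilrad]) (auto simp: corner_def)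
  have "swp k1 k2 l1 l2 0 = (0 :: 'a mat)" by (auto simp: swp_def fun_eq_iff)
  then have "(0 :: 'a mat) \<in> corner k1 k2 l1 l2" by (simp add: corner_def)
  then show "card (corner k1 k2 l1 l2 :: 'a mat set) > 0" using 1 by (auto simp: card_gt_0_iff)
qed

text \<open>Each of \<open>u12\<close>, \<open>u34\<close>, \<open>u13\<close>, \<open>u24\<close>
  occurs in exactly one of the four factors, so summing over it produces a restriction;
  \<open>u14\<close> occurs in none and contributes |corner|.\<close>

lemma sum_meetalg_hc_res:
  fixes f1 f2 h1 h2 :: "'a::{finite,field} mat \<Rightarrow> complex"
  shows "(\<Sum>y\<in>meetalg k1 k2 l1 l2. f1 (blk1 (k1+k2) y) * f2 (blk2 (k1+k2) (l1+l2) y) *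
       (h1 (blk1 (k1+l1) (swp k1 k2 l1 l2 y)) * h2 (blk2 (k1+l1) (k2+l2) (swp k1 k2 l1 l2 y)))) =
   of_nat (card (nilrad k1 k2 :: 'a mat set) * card (nilrad l1 l2 :: 'a mat set) * card (nilrad k1 l1 :: 'a mat set) *
      card (nilrad k2 l2 :: 'a mat set) * card (corner k1 k2 l1 l2 :: 'a mat set)) *
   (\<Sum>y1\<in>gl k1. \<Sum>y2\<in>gl k2. \<Sum>y3\<in>gl l1. \<Sum>y4\<in>gl l2.
      hc_res k1 k2 f1 y1 y2 * hc_res l1 l2 f2 y3 y4 * (hc_res k1 l1 h1 y1 y3 * hc_res k2 l2 h2 y2 y4))"
proof -
  have r: "(\<Sum>u\<in>nilrad k l. f (bdiag k l x y + u)) = of_nat (card (nilrad k l :: 'a mat set)) * hc_res k l f x y"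
    if "x \<in> gl k" "y \<in> gl l" for k l f and x y :: "'a mat"
    using that by (simp add: hc_res_alt)
  have "(\<Sum>y\<in>meetalg k1 k2 l1 l2. f1 (blk1 (k1+k2) y) * f2 (blk2 (k1+k2) (l1+l2) y) *
       (h1 (blk1 (k1+l1) (swp k1 k2 l1 l2 y)) * h2 (blk2 (k1+l1) (k2+l2) (swp k1 k2 l1 l2 y)))) =
     (\<Sum>y1\<in>gl k1. \<Sum>y2\<in>gl k2. \<Sum>y3\<in>gl l1. \<Sum>y4\<in>gl l2. \<Sum>u12\<in>nilrad k1 k2. \<Sum>u34\<in>nilrad l1 l2.
       \<Sum>u13\<in>nilrad k1 l1. \<Sum>u24\<in>nilrad k2 l2. \<Sum>u14\<in>(corner k1 k2 l1 l2 :: 'a mat set).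
        f1 (bdiag k1 k2 y1 y2 + u12) * f2 (bdiag l1 l2 y3 y4 + u34) * (h1 (bdiag k1 l1 y1 y3 + u13) * h2 (bdiag k2 l2 y2 y4 + u24)))"
    unfolding sum.cartesian_product
    by (rule sum_meetalg[where G = "\<lambda>a b c d. f1 a * f2 b * (h1 c * h2 d)"])
  also have "\<dots> = (\<Sum>y1\<in>gl k1. \<Sum>y2\<in>gl k2. \<Sum>y3\<in>gl l1. \<Sum>y4\<in>gl l2.
      of_nat (card (corner k1 k2 l1 l2 :: 'a mat set)) *
      ((\<Sum>u\<in>nilrad k1 k2. f1 (bdiag k1 k2 y1 y2 + u)) * (\<Sum>u\<in>nilrad l1 l2. f2 (bdiag l1 l2 y3 y4 + u)) *
       ((\<Sum>u\<in>nilrad k1 l1. h1 (bdiag k1 l1 y1 y3 + u)) * (\<Sum>u\<in>nilrad k2 l2. h2 (bdiag k2 l2 y2 y4 + u)))))"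
    by (simp add: sum_distrib_left[symmetric] sum_distrib_right[symmetric])
  also have "\<dots> = (\<Sum>y1\<in>gl k1. \<Sum>y2\<in>gl k2. \<Sum>y3\<in>gl l1. \<Sum>y4\<in>gl l2.
     of_nat (card (nilrad k1 k2 :: 'a mat set) * card (nilrad l1 l2 :: 'a mat set) * card (nilrad k1 l1 :: 'a mat set) *
      card (nilrad k2 l2 :: 'a mat set) * card (corner k1 k2 l1 l2 :: 'a mat set)) *
      (hc_res k1 k2 f1 y1 y2 * hc_res l1 l2 f2 y3 y4 * (hc_res k1 l1 h1 y1 y3 * hc_res k2 l2 h2 y2 y4)))"
    by (intro sum.cong refl) (simp add: r mult_ac)
  finally show ?thesis by (simp only: sum_distrib_left)
qed

lemma dcsum_meetalg:
  fixes f1 f2 h1 h2 :: "'a::{finite,field} mat \<Rightarrow> complex"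
  shows "dcsum (k1+k2) (l1+l2) (k1+l1) (k2+l2) (\<lambda>x y. f1 x * f2 y) (\<lambda>x y. h1 x * h2 y) (wmat k1 k2 l1 (k1+k2+(l1+l2))) =
    (\<Sum>y\<in>meetalg k1 k2 l1 l2. f1 (blk1 (k1+k2) y) * f2 (blk2 (k1+k2) (l1+l2) y) *
       (h1 (blk1 (k1+l1) (swp k1 k2 l1 l2 y)) * h2 (blk2 (k1+l1) (k2+l2) (swp k1 k2 l1 l2 y))))"
  unfolding dcsum_def conjm_wmat_swp
  by (rule sum.mono_neutral_cong_right) (auto simp: meetalg_def)

text \<open>Invertibility of a matrix of parabolic shape depends on its diagonal blocks only, so the
  indicator is constant along the nilradical.\<close>

lemma hc_res_indicator_GL:
  fixes x y :: "'a::{finite,field} mat"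
  assumes "x \<in> gl k" "y \<in> gl l"
  shows "hc_res k l (\<lambda>z. of_bool (z \<in> GL (k+l))) x y = of_bool (x \<in> GL k) * of_bool (y \<in> GL l)"
proof -
  have "bdiag k l x y + u \<in> GL (k+l) \<longleftrightarrow> x \<in> GL k \<and> y \<in> GL l" if "u \<in> nilrad k l" for u
  proof -
    have "bdiag k l x y + u \<in> parab k l" using that by (simp add: parab_add nilrad_parab)
    then show ?thesis using Pgrp_iff[of "bdiag k l x y + u" k l] that assms by (simp add: blk_add Pgrp_def)
  qed
  then show ?thesis using assms card_nilrad_pos[of k l, where 'a = 'a] by (simp add: hc_res_alt)
qed

lemma card_dstab:
  "of_nat (card (dstab (k1+k2) (l1+l2) (k1+l1) (k2+l2) (wmat k1 k2 l1 (k1+k2+(l1+l2)) :: 'a::{finite,field} mat))) =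
   (of_nat (card (nilrad k1 k2 :: 'a mat set) * card (nilrad l1 l2 :: 'a mat set) * card (nilrad k1 l1 :: 'a mat set) *
      card (nilrad k2 l2 :: 'a mat set) * card (corner k1 k2 l1 l2 :: 'a mat set)) *
    (of_nat (card (GL k1 :: 'a mat set)) * of_nat (card (GL k2 :: 'a mat set)) *
     of_nat (card (GL l1 :: 'a mat set)) * of_nat (card (GL l2 :: 'a mat set))) :: complex)" (is "of_nat (card ?S) = ?K * ?R")
proof -
  let ?w = "wmat k1 k2 l1 (k1+k2+(l1+l2)) :: 'a mat"
  have w: "?w \<in> GL (k1+k2+(l1+l2))" by (rule wmat_GL) simp
  \<comment> \<open>Conjugation preserves invertibility, so the condition on the conjugate only adds
    its block shape. Hence \<open>f1\<close> and \<open>f2\<close> become indicators while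
    \<open>h1\<close> and \<open>h2\<close> are constantly 1.\<close>
  have "conjm (k1+k2+(l1+l2)) ?w s \<in> GL (k1+k2+(l1+l2))" if "s \<in> GL (k1+k2+(l1+l2))" for s
    unfolding conjm_def using that w by (intro GL_mmul minv_GL)
  then have S: "?S = {y \<in> meetalg k1 k2 l1 l2. blk1 (k1+k2) y \<in> GL (k1+k2) \<and> blk2 (k1+k2) (l1+l2) y \<in> GL (l1+l2)}"
    unfolding dstab_def conjm_wmat_swp meetalg_def using Pgrp_iff[where 'a = 'a, of _ "k1+k2" "l1+l2"]
    by (auto simp: Pgrp_def add_ac)
  have fin: "finite (meetalg k1 k2 l1 l2 :: 'a mat set)"
    by (rule finite_subset[OF _ finite_parab]) (auto simp: meetalg_def)
  let ?i = "\<lambda>n z. of_bool (z \<in> (GL n :: 'a mat set)) :: complex"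
  have G: "gl n \<inter> GL n = (GL n :: 'a mat set)" for n by (auto simp: GL_gl)
  have cG: "(\<Sum>y\<in>gl n. ?i n y) = of_nat (card (GL n :: 'a mat set))" for n
    by (simp add: of_bool_def sum.If_cases G)
  have "of_nat (card ?S) = (\<Sum>y\<in>meetalg k1 k2 l1 l2. ?i (k1+k2) (blk1 (k1+k2) y) * ?i (l1+l2) (blk2 (k1+k2) (l1+l2) y) *
     ((\<lambda>_. 1) (blk1 (k1+l1) (swp k1 k2 l1 l2 y)) * (\<lambda>_. 1) (blk2 (k1+l1) (k2+l2) (swp k1 k2 l1 l2 y))))"
    unfolding S mult_1_right of_bool_conj[symmetric] using fin by (simp add: of_bool_def sum.If_cases Int_def)
  also have "\<dots> = ?K * (\<Sum>y1\<in>gl k1. \<Sum>y2\<in>gl k2. \<Sum>y3\<in>gl l1. \<Sum>y4\<in>gl l2.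
      hc_res k1 k2 (?i (k1+k2)) y1 y2 * hc_res l1 l2 (?i (l1+l2)) y3 y4 *
      (hc_res k1 l1 (\<lambda>_. 1) y1 y3 * hc_res k2 l2 (\<lambda>_. 1) y2 y4))"
    by (rule sum_meetalg_hc_res)
  also have "(\<Sum>y1\<in>gl k1. \<Sum>y2\<in>gl k2. \<Sum>y3\<in>gl l1. \<Sum>y4\<in>gl l2.
      hc_res k1 k2 (?i (k1+k2)) y1 y2 * hc_res l1 l2 (?i (l1+l2)) y3 y4 *
      (hc_res k1 l1 (\<lambda>_. 1) y1 y3 * hc_res k2 l2 (\<lambda>_. 1) y2 y4)) =
     (\<Sum>y1\<in>gl k1. \<Sum>y2\<in>gl k2. \<Sum>y3\<in>gl l1. \<Sum>y4\<in>gl l2. ?i k1 y1 * ?i k2 y2 * ?i l1 y3 * ?i l2 y4)"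
  proof (intro sum.cong refl)
    have 1: "hc_res k l (\<lambda>_. 1) x y = 1" if "x \<in> gl k" "y \<in> gl l" for k l and x y :: "'a mat"
      using that card_nilrad_pos[of k l, where 'a = 'a] by (simp add: hc_res_alt)
    fix y1 y2 y3 y4 :: "'a mat" assume "y1 \<in> gl k1" "y2 \<in> gl k2" "y3 \<in> gl l1" "y4 \<in> gl l2"
    then show "hc_res k1 k2 (?i (k1+k2)) y1 y2 * hc_res l1 l2 (?i (l1+l2)) y3 y4 *
      (hc_res k1 l1 (\<lambda>_. 1) y1 y3 * hc_res k2 l2 (\<lambda>_. 1) y2 y4) = ?i k1 y1 * ?i k2 y2 * ?i l1 y3 * ?i l2 y4"
      by (simp only: hc_res_indicator_GL 1 mult_1_right mult.assoc)
  qed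
  also have "\<dots> = ?R" by (simp only: sum_distrib_left[symmetric] sum_distrib_right[symmetric] cG)
  finally show ?thesis .
qed

text \<open>The coefficient of \<open>a \<otimes> b\<close> in the restriction of \<open>f\<close>, for \<open>a\<close>, \<open>b\<close> in the orthonormal bases.\<close>

definition tc :: "nat \<Rightarrow> nat \<Rightarrow> ('a::{finite,field} mat \<Rightarrow> complex) \<Rightarrow> ('a mat \<Rightarrow> complex) \<Rightarrow> ('a mat \<Rightarrow> complex) \<Rightarrow> complex" where
  "tc k l a b f = form2 k l (hc_res k l f) (\<lambda>x y. a x * b y)"

lemma hc_res_expansion:
  "classfun (k+l) f \<Longrightarrow> hc_res k l f x y = (\<Sum>a\<in>Om k. \<Sum>b\<in>Om l. tc k l a b f * (a x * b y))"
  unfolding tc_def by (rule classfun2_expansion[OF hc_res_classfun])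

text \<open>The variables separate into the pairs (1,3) and (2,4), the groups of the swapped block
  order.\<close>

lemma sum_four_factor:
  fixes a :: "'b \<Rightarrow> complex"
  shows "(\<Sum>y1\<in>A. \<Sum>y2\<in>B. \<Sum>y3\<in>C. \<Sum>y4\<in>D. (a y1 * b y2) * (c y3 * d y4) * (g y1 y3 * h y2 y4)) =
    (\<Sum>y1\<in>A. \<Sum>y3\<in>C. a y1 * c y3 * g y1 y3) * (\<Sum>y2\<in>B. \<Sum>y4\<in>D. b y2 * d y4 * h y2 y4)"
proof -
  have "(\<Sum>y1\<in>A. \<Sum>y2\<in>B. \<Sum>y3\<in>C. \<Sum>y4\<in>D. (a y1 * b y2) * (c y3 * d y4) * (g y1 y3 * h y2 y4)) =
     (\<Sum>y1\<in>A. \<Sum>y3\<in>C. \<Sum>y2\<in>B. \<Sum>y4\<in>D. (a y1 * c y3 * g y1 y3) * (b y2 * d y4 * h y2 y4))"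
    by (rule sum.cong[OF refl], subst sum.swap) (simp add: mult_ac)
  also have "\<dots> = (\<Sum>y1\<in>A. \<Sum>y3\<in>C. a y1 * c y3 * g y1 y3) * (\<Sum>y2\<in>B. \<Sum>y4\<in>D. b y2 * d y4 * h y2 y4)"
    by (simp only: sum_distrib_left[symmetric] sum_distrib_right[symmetric])
  finally show ?thesis .
qed

lemma sum_product_four:
  fixes X Y :: "'b \<Rightarrow> 'b \<Rightarrow> complex"
  shows "(\<Sum>a\<in>A. \<Sum>b\<in>B. X a b) * (\<Sum>c\<in>C. \<Sum>d\<in>D. Y c d) * Z =
    (\<Sum>a\<in>A. \<Sum>b\<in>B. \<Sum>c\<in>C. \<Sum>d\<in>D. X a b * Y c d * Z)"
  unfolding sum_distrib_right by (rule sum.cong[OF refl])+ (simp only: sum_distrib_left sum_distrib_right)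

text \<open>The coefficient of \<open>h1\<close> tensor \<open>h2\<close> in the product of the
  coproducts of \<open>f1\<close> and \<open>f2\<close>, restricted to the component of degrees
  \<open>(k1, k2)\<close> and \<open>(l1, l2)\<close>, with the conjugates that adjunction
  produces.\<close>

definition mackey_term :: "nat \<Rightarrow> nat \<Rightarrow> nat \<Rightarrow> nat \<Rightarrow> ('a::{finite,field} mat \<Rightarrow> complex) \<Rightarrow> ('a mat \<Rightarrow> complex) \<Rightarrow>
    ('a mat \<Rightarrow> complex) \<Rightarrow> ('a mat \<Rightarrow> complex) \<Rightarrow> complex" where
  "mackey_term k1 k2 l1 l2 f1 f2 h1 h2 = (\<Sum>p1\<in>Om k1. \<Sum>p2\<in>Om k2. \<Sum>r1\<in>Om l1. \<Sum>r2\<in>Om l2.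
     tc k1 k2 p1 p2 f1 * tc l1 l2 r1 r2 f2 * (cnj (tc k1 l1 p1 r1 h1) * cnj (tc k2 l2 p2 r2 h2)))"

text \<open>The restrictions of \<open>f1\<close> and \<open>f2\<close> are expanded in the
  orthonormal bases; the remaining sums over matrices are then inner products with the restrictions
  of \<open>h1\<close> and \<open>h2\<close>. The sizes of nilradicals and corner are the same as in
  \<open>card_dstab\<close> and cancel.\<close>

lemma dcsum_tc:
  fixes f1 f2 h1 h2 :: "'a::{finite,field} mat \<Rightarrow> complex"
  assumes "classfun (k1+k2) f1" "classfun (l1+l2) f2"
  shows "dcsum (k1+k2) (l1+l2) (k1+l1) (k2+l2) (\<lambda>x y. f1 x * f2 y) (\<lambda>x y. cnj (h1 x * h2 y)) (wmat k1 k2 l1 (k1+k2+(l1+l2))) /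
     of_nat (card (dstab (k1+k2) (l1+l2) (k1+l1) (k2+l2) (wmat k1 k2 l1 (k1+k2+(l1+l2)) :: 'a mat))) =
    mackey_term k1 k2 l1 l2 f1 f2 h1 h2"
proof -
  let ?K = "of_nat (card (nilrad k1 k2 :: 'a mat set) * card (nilrad l1 l2 :: 'a mat set) * card (nilrad k1 l1 :: 'a mat set) *
      card (nilrad k2 l2 :: 'a mat set) * card (corner k1 k2 l1 l2 :: 'a mat set)) :: complex"
  let ?g = "\<lambda>n. of_nat (card (GL n :: 'a mat set)) :: complex"
  have K: "?K \<noteq> 0" unfolding of_nat_eq_0_iff mult_eq_0_iff
    using card_nilrad_pos[where 'a = 'a] corner_pos(2)[where 'a = 'a] by (metis less_irrefl)
  have c: "hc_res k l (\<lambda>x. cnj (f x)) x y = cnj (hc_res k l f x y)" for k l f and x y :: "'a mat"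
    by (simp add: hc_res_def)
  let ?s = "\<lambda>p1 p2 r1 r2. (\<Sum>y1\<in>gl k1. \<Sum>y2\<in>gl k2. \<Sum>y3\<in>gl l1. \<Sum>y4\<in>gl l2.
      (p1 y1 * p2 y2) * (r1 y3 * r2 y4) * (cnj (hc_res k1 l1 h1 y1 y3) * cnj (hc_res k2 l2 h2 y2 y4)))"
  have s: "?s p1 p2 r1 r2 = (?g k1 * ?g l1 * cnj (tc k1 l1 p1 r1 h1)) * (?g k2 * ?g l2 * cnj (tc k2 l2 p2 r2 h2))" for p1 p2 r1 r2
    unfolding sum_four_factor tc_def form2_def
    using card_GL_pos[where 'a = 'a] by (simp add: mult_ac)
  have "dcsum (k1+k2) (l1+l2) (k1+l1) (k2+l2) (\<lambda>x y. f1 x * f2 y) (\<lambda>x y. cnj (h1 x * h2 y)) (wmat k1 k2 l1 (k1+k2+(l1+l2))) =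
    ?K * (\<Sum>y1\<in>gl k1. \<Sum>y2\<in>gl k2. \<Sum>y3\<in>gl l1. \<Sum>y4\<in>gl l2.
      hc_res k1 k2 f1 y1 y2 * hc_res l1 l2 f2 y3 y4 * (hc_res k1 l1 (\<lambda>x. cnj (h1 x)) y1 y3 * hc_res k2 l2 (\<lambda>x. cnj (h2 x)) y2 y4))"
    unfolding complex_cnj_mult dcsum_meetalg by (rule sum_meetalg_hc_res)
  also have "(\<Sum>y1\<in>gl k1. \<Sum>y2\<in>gl k2. \<Sum>y3\<in>gl l1. \<Sum>y4\<in>gl l2.
      hc_res k1 k2 f1 y1 y2 * hc_res l1 l2 f2 y3 y4 * (hc_res k1 l1 (\<lambda>x. cnj (h1 x)) y1 y3 * hc_res k2 l2 (\<lambda>x. cnj (h2 x)) y2 y4)) =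
     (\<Sum>y1\<in>gl k1. \<Sum>y2\<in>gl k2. \<Sum>y3\<in>gl l1. \<Sum>y4\<in>gl l2. \<Sum>(p1,p2,r1,r2)\<in>Om k1 \<times> Om k2 \<times> Om l1 \<times> Om l2.
       tc k1 k2 p1 p2 f1 * tc l1 l2 r1 r2 f2 * ((p1 y1 * p2 y2) * (r1 y3 * r2 y4) * (cnj (hc_res k1 l1 h1 y1 y3) * cnj (hc_res k2 l2 h2 y2 y4))))"
  proof (intro sum.cong refl)
    fix y1 y2 y3 y4 :: "'a mat"
    show "hc_res k1 k2 f1 y1 y2 * hc_res l1 l2 f2 y3 y4 * (hc_res k1 l1 (\<lambda>x. cnj (h1 x)) y1 y3 * hc_res k2 l2 (\<lambda>x. cnj (h2 x)) y2 y4) =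
      (\<Sum>(p1,p2,r1,r2)\<in>Om k1 \<times> Om k2 \<times> Om l1 \<times> Om l2.
       tc k1 k2 p1 p2 f1 * tc l1 l2 r1 r2 f2 * ((p1 y1 * p2 y2) * (r1 y3 * r2 y4) * (cnj (hc_res k1 l1 h1 y1 y3) * cnj (hc_res k2 l2 h2 y2 y4))))"
      unfolding c hc_res_expansion[OF assms(1)] hc_res_expansion[OF assms(2)] sum.cartesian_product[symmetric] sum_product_four
      by (intro sum.cong refl) (simp only: mult_ac)
  qed
  also have "\<dots> = (\<Sum>(p1,p2,r1,r2)\<in>Om k1 \<times> Om k2 \<times> Om l1 \<times> Om l2. tc k1 k2 p1 p2 f1 * tc l1 l2 r1 r2 f2 * ?s p1 p2 r1 r2)"
  proof -
    have sw: "(\<Sum>y1\<in>A. \<Sum>y2\<in>B. \<Sum>y3\<in>C. \<Sum>y4\<in>D. \<Sum>z\<in>Z. F y1 y2 y3 y4 z) = (\<Sum>z\<in>Z. \<Sum>y1\<in>A. \<Sum>y2\<in>B. \<Sum>y3\<in>C. \<Sum>y4\<in>D. F y1 y2 y3 y4 z)"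
      for A B C D :: "'a mat set" and Z :: "(('a mat \<Rightarrow> complex) \<times> ('a mat \<Rightarrow> complex) \<times> ('a mat \<Rightarrow> complex) \<times> ('a mat \<Rightarrow> complex)) set"
      and F :: "'a mat \<Rightarrow> 'a mat \<Rightarrow> 'a mat \<Rightarrow> 'a mat \<Rightarrow> _ \<Rightarrow> complex"
    proof -
      have "(\<Sum>y1\<in>A. \<Sum>y2\<in>B. \<Sum>y3\<in>C. \<Sum>y4\<in>D. \<Sum>z\<in>Z. F y1 y2 y3 y4 z) =
        (\<Sum>(y1,y2,y3,y4)\<in>A\<times>B\<times>C\<times>D. \<Sum>z\<in>Z. F y1 y2 y3 y4 z)"
        by (simp only: sum.cartesian_product[symmetric])
      also have "\<dots> = (\<Sum>z\<in>Z. \<Sum>(y1,y2,y3,y4)\<in>A\<times>B\<times>C\<times>D. F y1 y2 y3 y4 z)"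
        unfolding case_prod_beta by (rule sum.swap)
      also have "\<dots> = (\<Sum>z\<in>Z. \<Sum>y1\<in>A. \<Sum>y2\<in>B. \<Sum>y3\<in>C. \<Sum>y4\<in>D. F y1 y2 y3 y4 z)" by (simp add: sum.cartesian_product)
      finally show ?thesis .
    qed
    show ?thesis unfolding sw by (intro sum.cong refl) (simp add: case_prod_beta sum_distrib_left)
  qed
  also have "\<dots> = ?g k1 * ?g k2 * ?g l1 * ?g l2 * mackey_term k1 k2 l1 l2 f1 f2 h1 h2"
    unfolding s mackey_term_def sum.cartesian_product[symmetric] sum_distrib_left
    by (intro sum.cong refl) (simp only: mult_ac)
  finally show ?thesis unfolding card_dstab using K card_GL_pos[where 'a = 'a] by simp
qed

lemma mackey:
  fixes f1 f2 h1 h2 :: "'a::{finite,field} mat \<Rightarrow> complex"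
  assumes "classfun k f1" "classfun l f2" "classfun c h1" "classfun d h2" and n: "k + l = c + d"
  shows "form (k+l) (hc_ind k l (\<lambda>x y. f1 x * f2 y)) (hc_ind c d (\<lambda>x y. h1 x * h2 y)) =
    (\<Sum>k1\<in>dc_indices k l c d. mackey_term k1 (k-k1) (c-k1) (k1+l-c) f1 f2 h1 h2)"
  unfolding mackey_double_coset[OF classfun2_tens[OF assms(1,2)] classfun2_tens[OF assms(3,4)] n]
proof (rule sum.cong[OF refl])
  fix k1 assume "k1 \<in> dc_indices k l c d"
  then obtain k2 l1 l2 where e: "k = k1 + k2" "c = k1 + l1" "l = l1 + l2" "d = k2 + l2"
    using n by (auto simp: dc_indices_def le_iff_add)
  show "dcsum k l c d (\<lambda>x y. f1 x * f2 y) (\<lambda>x y. cnj (h1 x * h2 y)) (wmat k1 (k-k1) (c-k1) (k+l)) /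
      of_nat (card (dstab k l c d (wmat k1 (k-k1) (c-k1) (k+l) :: 'a mat))) = mackey_term k1 (k-k1) (c-k1) (k1+l-c) f1 f2 h1 h2"
    using dcsum_tc[of k1 k2 f1 l1 l2 f2 h1 h2] assms(1,2) by (simp add: e)
qed

section \<open>Transitivity of restriction\<close>

text \<open>The nilradical of the parabolic with three diagonal blocks, reached from either of the two
 intermediate parabolics.\<close>

definition nil3 :: "nat \<Rightarrow> nat \<Rightarrow> nat \<Rightarrow> 'a::zero mat set" where
  "nil3 k l m = {z \<in> gl (k+l+m). \<forall>i j. z i j \<noteq> 0 \<longrightarrow> (i < k \<and> k \<le> j) \<or> (i < k+l \<and> k+l \<le> j)}"

lemma sum_nil3_left:
  fixes F :: "'a::{finite,comm_ring_1} mat \<Rightarrow> 'b::comm_monoid_add"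
  shows "(\<Sum>u\<in>nilrad k l. \<Sum>v\<in>nilrad (k+l) m. F (bdiag (k+l) m u 0 + v)) = (\<Sum>z\<in>nil3 k l m. F z)"
proof -
  have "(\<Sum>z\<in>nil3 k l m. F z) = (\<Sum>(u,v)\<in>nilrad k l \<times> nilrad (k+l) m. F (bdiag (k+l) m u 0 + v))"
  proof (rule sum.reindex_bij_witness[where j = "\<lambda>z. (blk1 (k+l) z, z - bdiag (k+l) m (blk1 (k+l) z) 0)" and i = "\<lambda>(u,v). bdiag (k+l) m u 0 + v"])
    fix z :: "'a mat" assume z: "z \<in> nil3 k l m"
    have nz: "(i < k \<and> k \<le> j) \<or> (i < k+l \<and> k+l \<le> j)" if "z i j \<noteq> 0" for i j
      using z that unfolding nil3_def by blast
    have zg: "z \<in> gl (k+l+m)" using z by (simp add: nil3_def)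
    have zp: "z \<in> parab (k+l) m"
      unfolding parab_def using zg nz by fastforce
    have b2: "blk2 (k+l) m z = 0"
    proof (intro ext)
      fix i j show "blk2 (k+l) m z i j = 0 i j" using nz[of "i+(k+l)" "j+(k+l)"] by (auto simp: blk2_def)
    qed
    have "blk1 (k+l) z \<in> nilrad k l"
    proof -
      have "i < k \<and> k \<le> j" if "blk1 (k+l) z i j \<noteq> 0" for i j
        using that nz[of i j] by (auto simp: blk1_def split: if_splits)
      then show ?thesis by (simp add: nilrad_def)
    qed
    then show "(blk1 (k+l) z, z - bdiag (k+l) m (blk1 (k+l) z) 0) \<in> nilrad k l \<times> nilrad (k+l) m"
      using parab_decomp[OF zp] by (simp add: b2)
  next
    fix x :: "'a mat \<times> 'a mat" assume "x \<in> nilrad k l \<times> nilrad (k+l) m"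
    then obtain u v where x: "x = (u,v)" "u \<in> nilrad k l" "v \<in> nilrad (k+l) m" by auto
    have u: "i < k" "k \<le> j" if "u i j \<noteq> 0" for i j using x(2) that unfolding nilrad_def by blast+
    have v: "i < k+l" "k+l \<le> j" if "v i j \<noteq> 0" for i j using x(3) that unfolding nilrad_def by blast+
    have "bdiag (k+l) m u 0 + v \<in> gl (k+l+m)" by (rule gl_add[OF bdiag_gl nilrad_gl[OF x(3)]])
    moreover have "(i < k \<and> k \<le> j) \<or> (i < k+l \<and> k+l \<le> j)" if "(bdiag (k+l) m u 0 + v) i j \<noteq> 0" for i j
    proof (cases "v i j = 0")
      case True
      then have "u i j \<noteq> 0" using that by (auto simp: bdiag_def split: if_splits)
      then show ?thesis using u by blast
    qed (use v in blast)
    ultimately show "(case x of (u, v) \<Rightarrow> bdiag (k+l) m u 0 + v) \<in> nil3 k l m" by (simp add: nil3_def x)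
    show "(blk1 (k+l) (case x of (u, v) \<Rightarrow> bdiag (k+l) m u 0 + v), (case x of (u, v) \<Rightarrow> bdiag (k+l) m u 0 + v) -
        bdiag (k+l) m (blk1 (k+l) (case x of (u, v) \<Rightarrow> bdiag (k+l) m u 0 + v)) 0) = x"
      using x by (simp add: blk_add nilrad_gl)
  qed auto
  then show ?thesis by (simp add: sum.cartesian_product)
qed

lemma sum_nil3_right:
  fixes F :: "'a::{finite,comm_ring_1} mat \<Rightarrow> 'b::comm_monoid_add"
  shows "(\<Sum>u\<in>nilrad l m. \<Sum>v\<in>nilrad k (l+m). F (bdiag k (l+m) 0 u + v)) = (\<Sum>z\<in>nil3 k l m. F z)"
proof -
  have "(\<Sum>z\<in>nil3 k l m. F z) = (\<Sum>(u,v)\<in>nilrad l m \<times> nilrad k (l+m). F (bdiag k (l+m) 0 u + v))"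
  proof (rule sum.reindex_bij_witness[where j = "\<lambda>z. (blk2 k (l+m) z, z - bdiag k (l+m) 0 (blk2 k (l+m) z))" and i = "\<lambda>(u,v). bdiag k (l+m) 0 u + v"])
    fix z :: "'a mat" assume z: "z \<in> nil3 k l m"
    have nz: "(i < k \<and> k \<le> j) \<or> (i < k+l \<and> k+l \<le> j)" if "z i j \<noteq> 0" for i j
      using z that unfolding nil3_def by blast
    have zg: "z \<in> gl (k+(l+m))" using z by (simp add: nil3_def add.assoc)
    have zp: "z \<in> parab k (l+m)"
      unfolding parab_def using zg nz by fastforce
    have b1: "blk1 k z = 0"
    proof (intro ext)
      fix i j show "blk1 k z i j = 0 i j" using nz[of i j] by (cases "z i j = 0") (auto simp: blk1_def)
    qed
    have "blk2 k (l+m) z \<in> nilrad l m"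
    proof -
      have "i < l \<and> l \<le> j" if "blk2 k (l+m) z i j \<noteq> 0" for i j
        using that nz[of "i+k" "j+k"] by (auto simp: blk2_def split: if_splits)
      then show ?thesis by (simp add: nilrad_def)
    qed
    then show "(blk2 k (l+m) z, z - bdiag k (l+m) 0 (blk2 k (l+m) z)) \<in> nilrad l m \<times> nilrad k (l+m)"
      using parab_decomp[OF zp] by (simp add: b1)
  next
    fix x :: "'a mat \<times> 'a mat" assume "x \<in> nilrad l m \<times> nilrad k (l+m)"
    then obtain u v where x: "x = (u,v)" "u \<in> nilrad l m" "v \<in> nilrad k (l+m)" by auto
    have u: "i < l" "l \<le> j" if "u i j \<noteq> 0" for i j using x(2) that unfolding nilrad_def by blast+
    have v: "i < k" "k \<le> j" if "v i j \<noteq> 0" for i j using x(3) that unfolding nilrad_def by blast+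
    have "bdiag k (l+m) 0 u + v \<in> gl (k+l+m)" using gl_add[OF bdiag_gl nilrad_gl[OF x(3)]] by (simp add: add.assoc)
    moreover have "(i < k \<and> k \<le> j) \<or> (i < k+l \<and> k+l \<le> j)" if "(bdiag k (l+m) 0 u + v) i j \<noteq> 0" for i j
    proof (cases "v i j = 0")
      case True
      then have "k \<le> i" "k \<le> j" "u (i-k) (j-k) \<noteq> 0" using that by (auto simp: bdiag_def split: if_splits)
      then show ?thesis using u[of "i-k" "j-k"] by auto
    qed (use v in blast)
    ultimately show "(case x of (u, v) \<Rightarrow> bdiag k (l+m) 0 u + v) \<in> nil3 k l m" by (simp add: nil3_def x)
    show "(blk2 k (l+m) (case x of (u, v) \<Rightarrow> bdiag k (l+m) 0 u + v), (case x of (u, v) \<Rightarrow> bdiag k (l+m) 0 u + v) -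
        bdiag k (l+m) 0 (blk2 k (l+m) (case x of (u, v) \<Rightarrow> bdiag k (l+m) 0 u + v))) = x"
      using x by (simp add: blk_add nilrad_gl)
  qed auto
  then show ?thesis by (simp add: sum.cartesian_product)
qed

lemma bdiag_assoc: "bdiag (k+l) m (bdiag k l x y) z = bdiag k (l+m) x (bdiag l m y z)"
proof (intro ext)
  fix i j
  have c: "i < k \<or> (\<exists>r<l. i = k + r) \<or> (\<exists>r<m. i = k + l + r) \<or> k + l + m \<le> i" for i
  proof -
    consider "i < k" | "k \<le> i" "i < k+l" | "k+l \<le> i" "i < k+l+m" | "k+l+m \<le> i" by linarith
    then show ?thesis
    proof cases
      case 2 then have "i - k < l \<and> i = k + (i - k)" by simp then show ?thesis by blast
    next
      case 3 then have "i - (k+l) < m \<and> i = k + l + (i - (k+l))" by simp then show ?thesis by blast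
    qed auto
  qed
  show "bdiag (k+l) m (bdiag k l x y) z i j = bdiag k (l+m) x (bdiag l m y z) i j"
    using c[of i] c[of j] by (elim disjE exE conjE) (simp_all add: bdiag_def)
qed

text \<open>Both sides average \<open>d\<close> over the same coset of \<open>nil3 k l m\<close>,
  fibred over one or the other intermediate nilradical.\<close>

lemma hc_res_trans:
  fixes d :: "'a::{finite,field} mat \<Rightarrow> complex"
  assumes "x \<in> gl k" "y \<in> gl l" "z \<in> gl m"
  shows "hc_res k l (\<lambda>w. hc_res (k+l) m d w z) x y = hc_res l m (\<lambda>w. hc_res k (l+m) d x w) y z"
proof -
  let ?c = "\<lambda>k l. of_nat (card (nilrad k l :: 'a mat set)) :: complex"
  let ?B = "bdiag (k+l) m (bdiag k l x y) z"
  have g: "bdiag k l x y + u \<in> gl (k+l)" if "u \<in> nilrad k l" for k l u and x y :: "'a mat"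
    by (rule gl_add[OF bdiag_gl nilrad_gl[OF that]])
  have 1: "bdiag (k+l) m (bdiag k l x y + u) z = ?B + bdiag (k+l) m u 0" for u
    using bdiag_add[of "k+l" m "bdiag k l x y" u z 0] by simp
  have 2: "bdiag k (l+m) x (bdiag l m y z + u) = ?B + bdiag k (l+m) 0 u" for u
    using bdiag_add[of k "l+m" x 0 "bdiag l m y z" u] by (simp add: bdiag_assoc)
  have "hc_res k l (\<lambda>w. hc_res (k+l) m d w z) x y = (\<Sum>u\<in>nilrad k l. \<Sum>v\<in>nilrad (k+l) m. d (?B + (bdiag (k+l) m u 0 + v))) / (?c k l * ?c (k+l) m)"
    using assms g by (simp add: hc_res_alt sum_divide_distrib 1 add.assoc mult.commute)
  also have "\<dots> = (\<Sum>w\<in>nil3 k l m. d (?B + w)) / (?c k l * ?c (k+l) m)"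
    by (simp only: sum_nil3_left[where F = "\<lambda>w. d (?B + w)"])
  \<comment> \<open>The normalizations agree because summing the constant 1 over \<open>nil3\<close>
    in both ways counts the same set.\<close>
  also have "?c k l * ?c (k+l) m = ?c l m * ?c k (l+m)"
    using sum_nil3_left[where F = "\<lambda>_ :: 'a mat. 1::complex" and k = k and l = l and m = m]
      sum_nil3_right[where F = "\<lambda>_ :: 'a mat. 1::complex" and k = k and l = l and m = m] by (simp add: mult.commute)
  also have "(\<Sum>w\<in>nil3 k l m. d (?B + w)) / (?c l m * ?c k (l+m)) =
     (\<Sum>u\<in>nilrad l m. \<Sum>v\<in>nilrad k (l+m). d (?B + (bdiag k (l+m) 0 u + v))) / (?c l m * ?c k (l+m))"
    by (simp only: sum_nil3_right[where F = "\<lambda>w. d (?B + w)"])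
  also have "\<dots> = hc_res l m (\<lambda>w. hc_res k (l+m) d x w) y z"
    using assms g by (simp add: hc_res_alt sum_divide_distrib 2 add.assoc mult.commute)
  finally show ?thesis .
qed

section \<open>Multilinearity and associativity of the coefficients \<open>tc\<close>\<close>

lemma sum_swap3: "(\<Sum>y\<in>A. \<Sum>z\<in>B. \<Sum>x\<in>C. F x y z) = (\<Sum>x\<in>C. \<Sum>y\<in>A. \<Sum>z\<in>B. F x y z)"
  for F :: "'b \<Rightarrow> 'c \<Rightarrow> 'd \<Rightarrow> 'e::comm_monoid_add"
proof -
  have "(\<Sum>y\<in>A. \<Sum>z\<in>B. \<Sum>x\<in>C. F x y z) = (\<Sum>y\<in>A. \<Sum>x\<in>C. \<Sum>z\<in>B. F x y z)"
    by (rule sum.cong[OF refl]) (rule sum.swap)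
  also have "\<dots> = (\<Sum>x\<in>C. \<Sum>y\<in>A. \<Sum>z\<in>B. F x y z)" by (rule sum.swap)
  finally show ?thesis .
qed

lemma tc_sum: "tc k l a b (\<lambda>x. \<Sum>\<psi>\<in>R. F \<psi> x) = (\<Sum>\<psi>\<in>R. tc k l a b (F \<psi>))"
proof -
  have r: "hc_res k l (\<lambda>w. \<Sum>x\<in>R. F x w) y z = (\<Sum>x\<in>R. hc_res k l (F x) y z)" for y z
    unfolding hc_res_alt by (auto simp: sum_divide_distrib intro: sum.swap)
  show ?thesis unfolding tc_def form2_def r sum_distrib_right
    by (subst sum_swap3) (rule sum_divide_distrib)
qed

lemma tc_cmult: "tc k l a b (\<lambda>x. s * f x) = s * tc k l a b f"
proof -
  have "hc_res k l (\<lambda>x. s * f x) y z = s * hc_res k l f y z" for y z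
    by (simp add: hc_res_def sum_distrib_left)
  then show ?thesis by (simp add: tc_def form2_def sum_distrib_left mult.assoc)
qed

lemma tc_sum_ab:
  "tc k l (\<lambda>x. \<Sum>\<phi>\<in>S. A \<phi> x) (\<lambda>y. \<Sum>\<phi>\<in>S'. B \<phi> y) f = (\<Sum>p\<in>S\<times>S'. tc k l (A (fst p)) (B (snd p)) f)"
proof -
  have e: "(\<Sum>\<phi>\<in>S. A \<phi> y) * (\<Sum>\<phi>\<in>S'. B \<phi> z) = (\<Sum>p\<in>S\<times>S'. A (fst p) y * B (snd p) z)" for y z
    by (simp add: sum_product sum.cartesian_product case_prod_beta)
  show ?thesis unfolding tc_def form2_def e unfolding cnj_sum sum_distrib_left
    by (subst sum_swap3) (rule sum_divide_distrib)
qed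

lemma tc_scale: "tc k l (\<lambda>x. a x / r) (\<lambda>y. b y / s) (\<lambda>x. f x / t) = tc k l a b f / (t * cnj r * cnj s)"
proof -
  have "hc_res k l (\<lambda>x. f x / t) y z = hc_res k l f y z / t" for y z
    by (simp add: hc_res_def sum_divide_distrib mult_ac)
  then show ?thesis by (simp add: tc_def form2_def sum_divide_distrib mult_ac)
qed

text \<open>Pairing the last block of the restricted \<open>d\<close> with \<open>c\<close> gives a
  class function \<open>G\<close> whose coordinates are \<open>tc (k+l) m x c d\<close>, so the left
  sum is \<open>tc k l a b G\<close>. The right sum is likewise \<open>tc l m b c H\<close> with
  \<open>H\<close> paired against \<open>a\<close>, and \<open>hc_res_trans\<close> identifies the
  two.\<close>

lemma tc_assoc:
  fixes a b c d :: "'a::{finite,field} mat \<Rightarrow> complex"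
  assumes d: "classfun (k+l+m) d"
  shows "(\<Sum>x\<in>Om (k+l). tc (k+l) m x c d * tc k l a b x) = (\<Sum>y\<in>Om (l+m). tc k (l+m) a y d * tc l m b c y)"
proof -
  let ?g = "\<lambda>n. of_nat (card (GL n :: 'a mat set)) :: complex"
  have d': "classfun (k+(l+m)) d" using d by (simp add: add.assoc)
  define G where "G w = form m (\<lambda>z. hc_res (k+l) m d w z) c" for w
  define H where "H w = form k (\<lambda>x. hc_res k (l+m) d x w) a" for w
  have G: "classfun (k+l) G" using classfun2_fst[OF hc_res_classfun[OF d]] by (simp add: classfun_def G_def form_def)
  have H: "classfun (l+m) H" using classfun2_snd[OF hc_res_classfun[OF d']] by (simp add: classfun_def H_def form_def)
  have Gx: "form (k+l) G x = tc (k+l) m x c d" for x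
    by (simp add: G_def form_def tc_def form2_def sum_divide_distrib sum_distrib_right sum_distrib_left mult_ac)
  have Hy: "form (l+m) H y = tc k (l+m) a y d" for y
  proof -
    have "(\<Sum>w\<in>gl (l+m). (\<Sum>x\<in>gl k. hc_res k (l+m) d x w * cnj (a x)) * cnj (y w)) =
      (\<Sum>x\<in>gl k. \<Sum>w\<in>gl (l+m). hc_res k (l+m) d x w * cnj (a x * y w))"
      by (simp add: sum_distrib_right mult.assoc) (rule sum.swap)
    then show ?thesis by (simp add: H_def form_def tc_def form2_def sum_divide_distrib[symmetric])
  qed
  have tsum: "tc k l a b (\<lambda>w. \<Sum>x\<in>A. s x * x w) = (\<Sum>x\<in>A. s x * tc k l a b x)" for k l a b s and A :: "('a mat \<Rightarrow> complex) set"
    by (simp add: tc_sum tc_cmult)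
  have "(\<Sum>x\<in>Om (k+l). tc (k+l) m x c d * tc k l a b x) = tc k l a b G"
    using tsum[where A = "Om (k+l)" and s = "form (k+l) G"] unfolding classfun_expansion[OF G, symmetric] by (simp add: Gx)
  also have "\<dots> = (\<Sum>x\<in>gl k. \<Sum>y\<in>gl l. \<Sum>z\<in>gl m. hc_res k l (\<lambda>w. hc_res (k+l) m d w z) x y * (cnj (a x) * cnj (b y) * cnj (c z))) /
      (?g k * ?g l * ?g m)"
  proof -
    have "hc_res k l G x y = (\<Sum>z\<in>gl m. hc_res k l (\<lambda>w. hc_res (k+l) m d w z) x y * cnj (c z)) / ?g m" for x y
    proof (cases "x \<in> gl k \<and> y \<in> gl l")
      case True
      have "(\<Sum>u\<in>nilrad k l. G (bdiag k l x y + u)) = (\<Sum>z\<in>gl m. (\<Sum>u\<in>nilrad k l. hc_res (k+l) m d (bdiag k l x y + u) z) * cnj (c z)) / ?g m"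
        unfolding G_def form_def sum_divide_distrib[symmetric] by (subst sum.swap) (simp add: sum_distrib_right)
      then show ?thesis using True by (simp add: hc_res_alt[of k l] sum_divide_distrib sum_distrib_left sum_distrib_right mult_ac)
    qed (auto simp: hc_res_def)
    then show ?thesis unfolding tc_def form2_def
      by (simp add: sum_distrib_right sum_distrib_left sum_divide_distrib mult_ac)
  qed
  also have "\<dots> = (\<Sum>x\<in>gl k. \<Sum>y\<in>gl l. \<Sum>z\<in>gl m. hc_res l m (\<lambda>w. hc_res k (l+m) d x w) y z * (cnj (a x) * cnj (b y) * cnj (c z))) /
      (?g k * ?g l * ?g m)"
    by (intro arg_cong2[where f = "(/)"] sum.cong refl arg_cong2[where f = "(*)"] hc_res_trans)
  also have "\<dots> = tc l m b c H"
  proof -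
    have r: "hc_res l m H y z = (\<Sum>x\<in>gl k. hc_res l m (\<lambda>w. hc_res k (l+m) d x w) y z * cnj (a x)) / ?g k" for y z
    proof (cases "y \<in> gl l \<and> z \<in> gl m")
      case True
      have "(\<Sum>u\<in>nilrad l m. H (bdiag l m y z + u)) = (\<Sum>x\<in>gl k. (\<Sum>u\<in>nilrad l m. hc_res k (l+m) d x (bdiag l m y z + u)) * cnj (a x)) / ?g k"
        unfolding H_def form_def sum_divide_distrib[symmetric] by (subst sum.swap) (simp add: sum_distrib_right)
      then show ?thesis using True by (simp add: hc_res_alt[of l m] sum_divide_distrib sum_distrib_left sum_distrib_right mult_ac)
    qed (auto simp: hc_res_def)
    let ?X = "\<lambda>x y z. hc_res l m (\<lambda>w. hc_res k (l+m) d x w) y z * (cnj (a x) * cnj (b y) * cnj (c z))"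
    have "(\<Sum>x\<in>gl k. \<Sum>y\<in>gl l. \<Sum>z\<in>gl m. ?X x y z) = (\<Sum>y\<in>gl l. \<Sum>x\<in>gl k. \<Sum>z\<in>gl m. ?X x y z)" by (rule sum.swap)
    also have "\<dots> = (\<Sum>y\<in>gl l. \<Sum>z\<in>gl m. \<Sum>x\<in>gl k. ?X x y z)" by (rule sum.cong[OF refl]) (rule sum.swap)
    finally show ?thesis unfolding tc_def form2_def r
      by (simp add: sum_distrib_right sum_distrib_left sum_divide_distrib mult_ac)
  qed
  also have "\<dots> = (\<Sum>y\<in>Om (l+m). tc k (l+m) a y d * tc l m b c y)"
    using tsum[where A = "Om (l+m)" and s = "form (l+m) H"] unfolding classfun_expansion[OF H, symmetric] by (simp add: Hy)
  finally show ?thesis .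
qed

section \<open>Positivity\<close>

definition nnr :: "complex \<Rightarrow> bool" where "nnr z \<longleftrightarrow> (\<exists>r\<ge>0. z = of_real r)"

lemma nnr_mult: "nnr z \<Longrightarrow> nnr w \<Longrightarrow> nnr (z * w)"
  unfolding nnr_def by (metis mult_nonneg_nonneg of_real_mult)
lemma nnr_divide: "nnr z \<Longrightarrow> nnr w \<Longrightarrow> nnr (z / w)"
  unfolding nnr_def by (metis divide_nonneg_nonneg of_real_divide)
lemma nnr_nat: "nnr (of_nat n)" unfolding nnr_def by (metis of_nat_0_le_iff of_real_of_nat_eq)
lemma nnr_real: "r \<ge> 0 \<Longrightarrow> nnr (of_real r)" unfolding nnr_def by blast
lemma nnr_sum: "(\<And>x. x \<in> A \<Longrightarrow> nnr (f x)) \<Longrightarrow> nnr (sum f A)"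
proof (induction A rule: infinite_finite_induct)
  case (insert x A)
  then have "nnr (f x)" "nnr (sum f A)" by auto
  then obtain r s where "f x = of_real r" "sum f A = of_real s" "r \<ge> 0" "s \<ge> 0" unfolding nnr_def by blast
  then have "sum f (insert x A) = of_real (r + s)" "r + s \<ge> 0" using insert by auto
  then show ?case unfolding nnr_def by blast
qed (auto simp: nnr_def intro: exI[of _ 0])

text \<open>On the additive decomposition of \<open>parab\<close> into two diagonal blocks and the
  nilradical, \<open>\<psi>\<close> is a product of three additive characters. The coefficient
  therefore splits into three character sums, each of them 0 or the size of a set.\<close>

lemma nnr_tc_lin_char:
  fixes \<psi> \<phi> \<phi>' :: "'a::{finite,field} mat \<Rightarrow> complex"
  assumes p: "lin_char (k+l) \<psi>" "lin_char k \<phi>" "lin_char l \<phi>'"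
  shows "nnr (tc k l \<phi> \<phi>' \<psi>)"
proof -
  let ?A = "\<lambda>x. \<psi> (bdiag k l x 0) * cnj (\<phi> x)" and ?B = "\<lambda>y. \<psi> (bdiag k l 0 y) * cnj (\<phi>' y)"
  have nn: "nnr (sum h S)" if "finite S" "\<And>x y. x \<in> S \<Longrightarrow> y \<in> S \<Longrightarrow> x + y \<in> S"
    "\<And>x y. x \<in> S \<Longrightarrow> y \<in> S \<Longrightarrow> h (x + y) = h x * h y" for S :: "'a mat set" and h
  proof -
    have "sum h S = (if \<forall>x\<in>S. h x = 1 then of_nat (card S) else 0)"
      by (rule sum_additive_char) (use that in auto)
    then show ?thesis using nnr_nat[of 0] by (simp add: nnr_nat)
  qed
  have b1: "bdiag k l (x + y) 0 = bdiag k l x 0 + bdiag k l y (0 :: 'a mat)" for x y using bdiag_add[of k l x y 0 0] by simp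
  have b2: "bdiag k l 0 (x + y) = bdiag k l 0 x + bdiag k l (0 :: 'a mat) y" for x y using bdiag_add[of k l 0 0 x y] by simp
  have A: "nnr (sum ?A (gl k))" using p by (intro nn) (auto simp: gl_add b1 lin_char_add)
  have B: "nnr (sum ?B (gl l))" using p by (intro nn) (auto simp: gl_add b2 lin_char_add)
  have C: "nnr (sum \<psi> (nilrad k l))" using p by (intro nn) (auto simp: nilrad_add lin_char_add nilrad_gl)
  have e: "\<psi> (bdiag k l x y + u) = \<psi> (bdiag k l x 0) * \<psi> (bdiag k l 0 y) * \<psi> u" if "u \<in> nilrad k l" for x y u
  proof -
    have "bdiag k l x y = bdiag k l x 0 + bdiag k l 0 y" using bdiag_add[of k l x 0 0 y] by simp
    then show ?thesis using p that by (simp add: lin_char_add gl_add nilrad_gl)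
  qed
  have "(\<Sum>x\<in>gl k. \<Sum>y\<in>gl l. hc_res k l \<psi> x y * cnj (\<phi> x * \<phi>' y)) =
     (\<Sum>x\<in>gl k. \<Sum>y\<in>gl l. ?A x * ?B y * (sum \<psi> (nilrad k l) / of_nat (card (nilrad k l :: 'a mat set))))"
    by (intro sum.cong refl) (simp add: hc_res_alt e sum_distrib_left[symmetric])
  also have "\<dots> = sum ?A (gl k) * sum ?B (gl l) * (sum \<psi> (nilrad k l) / of_nat (card (nilrad k l :: 'a mat set)))"
    by (simp only: sum_distrib_left[symmetric] sum_distrib_right[symmetric])
  finally show ?thesis unfolding tc_def form2_def using A B C by (simp only:) (intro nnr_mult nnr_divide nnr_nat)
qed

text \<open>Expanding the three orbit sums reduces to linear characters, and the normalizing factors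
  are positive reals.\<close>

lemma nnr_tc:
  fixes a b c :: "'a::{finite,field} mat \<Rightarrow> complex"
  assumes "a \<in> Om k" "b \<in> Om l" "c \<in> Om (k+l)"
  shows "nnr (tc k l a b c)"
proof -
  obtain S S' R where S: "S \<in> orbs k" "a = nosum k S" "S' \<in> orbs l" "b = nosum l S'" "R \<in> orbs (k+l)" "c = nosum (k+l) R"
    using assms by (auto simp: Om_def)
  have sub: "S \<subseteq> LC k" "S' \<subseteq> LC l" "R \<subseteq> LC (k+l)" using S orb_subset by (auto simp: orbs_def)
  have "tc k l (osum S) (osum S') (osum R) = (\<Sum>p\<in>S\<times>S'. \<Sum>\<psi>\<in>R. tc k l (fst p) (snd p) \<psi>)"
  proof -
    have "osum S = (\<lambda>x. \<Sum>\<psi>\<in>S. \<psi> x)" for S :: "('a mat \<Rightarrow> complex) set" by (simp add: fun_eq_iff osum_def)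
    then show ?thesis by (simp only: tc_sum_ab tc_sum)
  qed
  also have "nnr \<dots>" using sub by (intro nnr_sum) (auto intro!: nnr_sum nnr_tc_lin_char)
  finally have "nnr (tc k l (osum S) (osum S') (osum R))" .
  then show ?thesis unfolding S nosum_def tc_scale using onrm_pos[OF S(1)] onrm_pos[OF S(3)] onrm_pos[OF S(5)]
    by (intro nnr_divide nnr_mult) (auto intro!: nnr_real)
qed

section \<open>Self-adjoint structure constants\<close>

lemma sum_support:
  fixes F :: "'b \<Rightarrow> 'r::semiring_0"
  assumes "finite A" "\<And>x. F x \<noteq> 0 \<Longrightarrow> x \<in> A"
  shows "(\<Sum>x\<in>{x. F x \<noteq> 0}. F x * g x) = (\<Sum>x\<in>A. F x * g x)"
  by (rule sum.mono_neutral_left) (use assms in auto)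

text \<open>\<open>T a b c\<close> is at once the coefficient of \<open>c\<close> in the product of
  \<open>a\<close> and \<open>b\<close> and that of \<open>a\<close> tensor \<open>b\<close> in the
  coproduct of \<open>c\<close>. Isolating the axioms of such a table separates the construction of
  the antipode from matrices. In \<open>hopf\<close> the degree conditions keep the right side
  finite and match the block sizes of the Mackey formula.\<close>

locale selfadjoint =
  fixes B :: "'b set" and deg :: "'b \<Rightarrow> nat" and T :: "'b \<Rightarrow> 'b \<Rightarrow> 'b \<Rightarrow> real" and e :: 'b
  assumes finite_deg: "finite {b \<in> B. deg b = n}"
    and T_supp: "T a b c \<noteq> 0 \<Longrightarrow> a \<in> B \<and> b \<in> B \<and> c \<in> B \<and> deg c = deg a + deg b"
    and T_nonneg: "T a b c \<ge> 0"
    and e: "e \<in> B" and deg_0: "b \<in> B \<Longrightarrow> deg b = 0 \<longleftrightarrow> b = e"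
    and unit_l: "a \<in> B \<Longrightarrow> c \<in> B \<Longrightarrow> T e a c = of_bool (a = c)"
    and unit_r: "a \<in> B \<Longrightarrow> c \<in> B \<Longrightarrow> T a e c = of_bool (a = c)"
    and assoc: "a \<in> B \<Longrightarrow> b \<in> B \<Longrightarrow> c \<in> B \<Longrightarrow> d \<in> B \<Longrightarrow>
      (\<Sum>x\<in>{x \<in> B. deg x = deg a + deg b}. T a b x * T x c d) = (\<Sum>y\<in>{y \<in> B. deg y = deg b + deg c}. T b c y * T a y d)"
    and hopf: "a \<in> B \<Longrightarrow> b \<in> B \<Longrightarrow> c1 \<in> B \<Longrightarrow> c2 \<in> B \<Longrightarrow>
      (\<Sum>x\<in>{x \<in> B. deg x = deg a + deg b}. T a b x * T c1 c2 x) =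
      (\<Sum>(p,r)\<in>{((p1,p2),(r1,r2)). p1 \<in> B \<and> p2 \<in> B \<and> r1 \<in> B \<and> r2 \<in> B \<and> deg p1 + deg p2 = deg a \<and>
         deg r1 + deg r2 = deg b \<and> deg p1 + deg r1 = deg c1 \<and> deg p2 + deg r2 = deg c2}.
        T (fst p) (snd p) a * T (fst r) (snd r) b * T (fst p) (fst r) c1 * T (snd p) (snd r) c2)"
begin

section \<open>Convolution of graded maps and the antipode\<close>

definition BL :: "nat \<Rightarrow> 'b set" where "BL n = {b \<in> B. deg b \<le> n}"

lemma finite_BL [simp]: "finite (BL n)"
proof -
  have "BL n = (\<Union>m\<le>n. {b \<in> B. deg b = m})" by (auto simp: BL_def)
  then show ?thesis using finite_deg by simp
qed

lemma deg_e: "deg e = 0" using deg_0[OF e] by simp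

lemma BL_I: "b \<in> B \<Longrightarrow> deg b \<le> n \<Longrightarrow> b \<in> BL n" by (simp add: BL_def)

definition graded :: "('b \<Rightarrow> 'b \<Rightarrow> real) \<Rightarrow> bool" where
  "graded f \<longleftrightarrow> (\<forall>b c. f b c \<noteq> 0 \<longrightarrow> b \<in> B \<and> c \<in> B \<and> deg b = deg c)"

lemma gradedD: "graded f \<Longrightarrow> f b c \<noteq> 0 \<Longrightarrow> b \<in> B \<and> c \<in> B \<and> deg b = deg c"
  by (simp add: graded_def)

text \<open>A convolution with all four indices cut off at degree \<open>n\<close>.
  \<open>conv\<close> uses the cutoff \<open>deg b\<close>, but an iterated convolution has inner
  factors of lower degree; \<open>convn_eq\<close> allows one common index set for both
  levels.\<close>

definition convn :: "nat \<Rightarrow> ('b \<Rightarrow> 'b \<Rightarrow> real) \<Rightarrow> ('b \<Rightarrow> 'b \<Rightarrow> real) \<Rightarrow> 'b \<Rightarrow> 'b \<Rightarrow> real" where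
  "convn n f g b c = (\<Sum>p1\<in>BL n. \<Sum>p2\<in>BL n. \<Sum>x\<in>BL n. \<Sum>y\<in>BL n. T p1 p2 b * f p1 x * g p2 y * T x y c)"

definition conv :: "('b \<Rightarrow> 'b \<Rightarrow> real) \<Rightarrow> ('b \<Rightarrow> 'b \<Rightarrow> real) \<Rightarrow> 'b \<Rightarrow> 'b \<Rightarrow> real" where
  "conv f g b c = convn (deg b) f g b c"

lemma convn_eq:
  assumes "graded f" "graded g" "deg b \<le> n" shows "convn n f g b c = conv f g b c"
proof -
  have *: "convn m f g b c = (\<Sum>(p1,p2,x,y)\<in>BL m \<times> BL m \<times> BL m \<times> BL m. T p1 p2 b * f p1 x * g p2 y * T x y c)" for m
    unfolding convn_def by (simp only: sum.cartesian_product)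
  show ?thesis unfolding conv_def *
  proof (rule sum.mono_neutral_right)
    show "BL (deg b) \<times> BL (deg b) \<times> BL (deg b) \<times> BL (deg b) \<subseteq> BL n \<times> BL n \<times> BL n \<times> BL n"
      using assms(3) by (auto simp: BL_def)
    show "\<forall>i\<in>BL n \<times> BL n \<times> BL n \<times> BL n - BL (deg b) \<times> BL (deg b) \<times> BL (deg b) \<times> BL (deg b).
       (case i of (p1, p2, x, y) \<Rightarrow> T p1 p2 b * f p1 x * g p2 y * T x y c) = 0"
    proof
      fix i assume i: "i \<in> BL n \<times> BL n \<times> BL n \<times> BL n - BL (deg b) \<times> BL (deg b) \<times> BL (deg b) \<times> BL (deg b)"
      obtain p1 p2 x y where ii: "i = (p1,p2,x,y)" by (cases i) auto
      show "(case i of (p1, p2, x, y) \<Rightarrow> T p1 p2 b * f p1 x * g p2 y * T x y c) = 0"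
      proof (rule ccontr)
        assume "\<not> ?thesis"
        then have nz: "T p1 p2 b \<noteq> 0" "f p1 x \<noteq> 0" "g p2 y \<noteq> 0" by (auto simp: ii)
        then show False using T_supp[OF nz(1)] gradedD[OF assms(1) nz(2)] gradedD[OF assms(2) nz(3)] i
          by (auto simp: ii BL_def)
      qed
    qed
  qed simp
qed

lemma graded_conv:
  assumes "graded f" "graded g" shows "graded (conv f g)"
  unfolding graded_def
proof (intro allI impI)
  fix b c assume "conv f g b c \<noteq> 0"
  then obtain p1 p2 x y where "T p1 p2 b * f p1 x * g p2 y * T x y c \<noteq> 0"
    unfolding conv_def convn_def by (meson sum.neutral)
  then have nz: "T p1 p2 b \<noteq> 0" "f p1 x \<noteq> 0" "g p2 y \<noteq> 0" "T x y c \<noteq> 0" by auto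
  then show "b \<in> B \<and> c \<in> B \<and> deg b = deg c"
    using T_supp[OF nz(1)] T_supp[OF nz(4)] gradedD[OF assms(1) nz(2)] gradedD[OF assms(2) nz(3)] by auto
qed

lemma assoc_BL:
  assumes "a \<in> B" "b \<in> B" "c \<in> B" "d \<in> B" "deg d \<le> n"
  shows "(\<Sum>x\<in>BL n. T a b x * T x c d) = (\<Sum>y\<in>BL n. T b c y * T a y d)"
proof -
  have "(\<Sum>x\<in>BL n. T a b x * T x c d) = (\<Sum>x\<in>{x \<in> B. deg x = deg a + deg b}. T a b x * T x c d)"
  proof (rule sum.mono_neutral_cong)
    fix x assume "x \<in> BL n - {x \<in> B. deg x = deg a + deg b}" then show "T a b x * T x c d = 0"
      using T_supp[of a b x] by (auto simp: BL_def)
  next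
    fix x assume "x \<in> {x \<in> B. deg x = deg a + deg b} - BL n" then show "T a b x * T x c d = 0"
      using T_supp[of x c d] assms by (force simp: BL_def)
  qed (auto simp: finite_deg)
  also have "\<dots> = (\<Sum>y\<in>{y \<in> B. deg y = deg b + deg c}. T b c y * T a y d)" by (rule assoc) (use assms in auto)
  also have "\<dots> = (\<Sum>y\<in>BL n. T b c y * T a y d)"
  proof (rule sum.mono_neutral_cong)
    fix x assume "x \<in> BL n - {y \<in> B. deg y = deg b + deg c}" then show "T b c x * T a x d = 0"
      using T_supp[of b c x] by (auto simp: BL_def)
  next
    fix x assume "x \<in> {y \<in> B. deg y = deg b + deg c} - BL n" then show "T b c x * T a x d = 0"
      using T_supp[of a x d] assms by (force simp: BL_def)
  qed (auto simp: finite_deg)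
  finally show ?thesis .
qed

lemma conv_assoc:
  assumes f: "graded f" and g: "graded g" and h: "graded h"
  shows "conv (conv f g) h = conv f (conv g h)"
proof (intro ext)
  fix b c
  show "conv (conv f g) h b c = conv f (conv g h) b c"
  proof (cases "b \<in> B \<and> c \<in> B \<and> deg b = deg c")
    case False
    then have "conv (conv f g) h b c = 0" "conv f (conv g h) b c = 0"
      using gradedD[OF graded_conv[OF graded_conv[OF f g] h], of b c]
        gradedD[OF graded_conv[OF f graded_conv[OF g h]], of b c] by blast+
    then show ?thesis by simp
  next
    case True
    define n where "n = deg b"
    let ?I = "BL n"
    \<comment> \<open>Both bracketings are brought to this shape, with two innermost sums: the one
      over \<open>p\<close> expresses iterated comultiplication, the one over \<open>x\<close>
      iterated multiplication. Associativity then applies to each.\<close>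
    define X where "X = (\<Sum>q1\<in>?I. \<Sum>q2\<in>?I. \<Sum>q3\<in>?I. \<Sum>z1\<in>?I. \<Sum>z2\<in>?I. \<Sum>z3\<in>?I.
       (\<Sum>p\<in>?I. T q1 q2 p * T p q3 b) * (\<Sum>x\<in>?I. T z1 z2 x * T x z3 c) * (f q1 z1 * g q2 z2 * h q3 z3))"
    define Y where "Y = (\<Sum>q1\<in>?I. \<Sum>q2\<in>?I. \<Sum>q3\<in>?I. \<Sum>z1\<in>?I. \<Sum>z2\<in>?I. \<Sum>z3\<in>?I.
       (\<Sum>p\<in>?I. T q2 q3 p * T q1 p b) * (\<Sum>x\<in>?I. T z2 z3 x * T z1 x c) * (f q1 z1 * g q2 z2 * h q3 z3))"
    have "X = Y" unfolding X_def Y_def using True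
      by (intro sum.cong refl arg_cong2[where f = "(*)"] assoc_BL) (auto simp: BL_def n_def)
    have inner: "conv f g p x = convn n f g p x" "conv g h p x = convn n g h p x" if "p \<in> ?I" for p x
      using that f g h by (auto simp: BL_def convn_eq)
    have "conv (conv f g) h b c = (\<Sum>p1\<in>?I. \<Sum>p2\<in>?I. \<Sum>x\<in>?I. \<Sum>y\<in>?I. T p1 p2 b * convn n f g p1 x * h p2 y * T x y c)"
      unfolding conv_def[of "conv f g"] n_def[symmetric] convn_def[of n "conv f g"]
      by (intro sum.cong refl) (simp add: inner)
    also have "\<dots> = (\<Sum>(p1,p2,x,y,q1,q2,z,w)\<in>?I\<times>?I\<times>?I\<times>?I\<times>?I\<times>?I\<times>?I\<times>?I.
        T p1 p2 b * (T q1 q2 p1 * f q1 z * g q2 w * T z w x) * h p2 y * T x y c)"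
      unfolding convn_def sum_distrib_left sum_distrib_right by (simp only: sum.cartesian_product)
    also have "\<dots> = (\<Sum>(q1,q2,q3,z1,z2,z3,p,x)\<in>?I\<times>?I\<times>?I\<times>?I\<times>?I\<times>?I\<times>?I\<times>?I.
        T q1 q2 p * T p q3 b * (T z1 z2 x * T x z3 c) * (f q1 z1 * g q2 z2 * h q3 z3))"
      by (rule sum.reindex_bij_witness[where i = "\<lambda>(q1,q2,q3,z1,z2,z3,p,x). (p,q3,x,z3,q1,q2,z1,z2)" and
           j = "\<lambda>(p1,p2,x,y,q1,q2,z,w). (q1,q2,p2,z,w,y,p1,x)"]) auto
    also have "\<dots> = X"
      unfolding X_def sum_distrib_left sum_distrib_right sum.cartesian_product[symmetric]
      by (rule sum.cong[OF refl], rule sum.cong[OF refl], rule sum.cong[OF refl],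
          rule sum.cong[OF refl], rule sum.cong[OF refl], rule sum.cong[OF refl], rule sum.swap)
    also have "X = Y" by fact
    also have "Y = (\<Sum>(q1,q2,q3,z1,z2,z3,p,x)\<in>?I\<times>?I\<times>?I\<times>?I\<times>?I\<times>?I\<times>?I\<times>?I.
        T q2 q3 p * T q1 p b * (T z2 z3 x * T z1 x c) * (f q1 z1 * g q2 z2 * h q3 z3))"
      unfolding Y_def sum_distrib_left sum_distrib_right sum.cartesian_product[symmetric]
      by (rule sum.cong[OF refl], rule sum.cong[OF refl], rule sum.cong[OF refl],
          rule sum.cong[OF refl], rule sum.cong[OF refl], rule sum.cong[OF refl], rule sum.swap)
    also have "\<dots> = (\<Sum>(p1,p2,x,y,q1,q2,z,w)\<in>?I\<times>?I\<times>?I\<times>?I\<times>?I\<times>?I\<times>?I\<times>?I.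
        T p1 p2 b * f p1 x * (T q1 q2 p2 * g q1 z * h q2 w * T z w y) * T x y c)"
      by (rule sum.reindex_bij_witness[where j = "\<lambda>(q1,q2,q3,z1,z2,z3,p,x). (q1,p,z1,x,q2,q3,z2,z3)" and
           i = "\<lambda>(p1,p2,x,y,q1,q2,z,w). (p1,q1,q2,x,z,w,p2,y)"]) auto
    also have "\<dots> = (\<Sum>p1\<in>?I. \<Sum>p2\<in>?I. \<Sum>x\<in>?I. \<Sum>y\<in>?I. T p1 p2 b * f p1 x * convn n g h p2 y * T x y c)"
      unfolding convn_def sum_distrib_left sum_distrib_right by (simp only: sum.cartesian_product)
    also have "\<dots> = conv f (conv g h) b c"
      unfolding conv_def[of f] n_def[symmetric] convn_def[of n f "conv g h"]
      by (intro sum.cong refl) (simp add: inner)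
    finally show ?thesis .
  qed
qed

text \<open>Unit after counit, the neutral element for convolution.\<close>

definition eps :: "'b \<Rightarrow> 'b \<Rightarrow> real" where "eps b c = of_bool (b = e \<and> c = e)"
definition ident :: "'b \<Rightarrow> 'b \<Rightarrow> real" where "ident b c = of_bool (b \<in> B \<and> b = c)"
text \<open>The projection onto positive degrees, as \<open>e\<close> is the only basis element of
  degree 0.\<close>

definition J :: "'b \<Rightarrow> 'b \<Rightarrow> real" where "J b c = ident b c - eps b c"

lemma graded_basic: "graded eps" "graded ident" "graded J"
  using e by (auto simp: graded_def eps_def ident_def J_def)

lemma e_BL [simp]: "e \<in> BL n" by (simp add: BL_def e deg_e)

lemma of_bool_mult_sum: "finite A \<Longrightarrow> (\<Sum>x\<in>A. of_bool (x = a) * f x) = (if a \<in> A then f a else (0::real))"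
  by (simp add: of_bool_def sum_delta_mult)

lemma conv_eps_l: assumes f: "graded f" shows "conv eps f = f"
proof (intro ext)
  fix b c
  show "conv eps f b c = f b c"
  proof (cases "b \<in> B \<and> c \<in> B \<and> deg b = deg c")
    case False then show ?thesis using gradedD[OF f] gradedD[OF graded_conv[OF graded_basic(1) f]] by metis
  next
    case True
    let ?I = "BL (deg b)"
    have "conv eps f b c = (\<Sum>p1\<in>?I. \<Sum>p2\<in>?I. \<Sum>x\<in>?I. \<Sum>y\<in>?I. of_bool (p1 = e) * (of_bool (x = e) * (T p1 p2 b * f p2 y * T x y c)))"
      unfolding conv_def convn_def by (intro sum.cong refl) (auto simp: eps_def)
    also have "\<dots> = (\<Sum>p2\<in>?I. \<Sum>y\<in>?I. T e p2 b * f p2 y * T e y c)"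
      by (simp add: sum_distrib_left[symmetric] of_bool_mult_sum)
    also have "\<dots> = (\<Sum>p2\<in>?I. \<Sum>y\<in>?I. of_bool (p2 = b) * (of_bool (y = c) * f p2 y))"
      using True by (intro sum.cong refl) (auto simp: unit_l BL_def)
    also have "\<dots> = f b c" using True BL_I[of b "deg b"] BL_I[of c "deg b"]
      by (simp add: sum_distrib_left[symmetric] of_bool_mult_sum)
    finally show ?thesis .
  qed
qed

lemma conv_eps_r: assumes f: "graded f" shows "conv f eps = f"
proof (intro ext)
  fix b c
  show "conv f eps b c = f b c"
  proof (cases "b \<in> B \<and> c \<in> B \<and> deg b = deg c")
    case False then show ?thesis using gradedD[OF f] gradedD[OF graded_conv[OF f graded_basic(1)]] by metis
  next
    case True
    let ?I = "BL (deg b)"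
    have "conv f eps b c = (\<Sum>p1\<in>?I. \<Sum>p2\<in>?I. \<Sum>x\<in>?I. \<Sum>y\<in>?I. of_bool (p2 = e) * (of_bool (y = e) * (T p1 p2 b * f p1 x * T x y c)))"
      unfolding conv_def convn_def by (intro sum.cong refl) (auto simp: eps_def)
    also have "\<dots> = (\<Sum>p1\<in>?I. \<Sum>x\<in>?I. T p1 e b * f p1 x * T x e c)"
      by (simp add: sum_distrib_left[symmetric] of_bool_mult_sum)
    also have "\<dots> = (\<Sum>p2\<in>?I. \<Sum>y\<in>?I. of_bool (p2 = b) * (of_bool (y = c) * f p2 y))"
      using True by (intro sum.cong refl) (auto simp: unit_r BL_def)
    also have "\<dots> = f b c" using True BL_I[of b "deg b"] BL_I[of c "deg b"]
      by (simp add: sum_distrib_left[symmetric] of_bool_mult_sum)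
    finally show ?thesis .
  qed
qed

primrec Jp :: "nat \<Rightarrow> 'b \<Rightarrow> 'b \<Rightarrow> real" where
  "Jp 0 = eps" | "Jp (Suc k) = conv J (Jp k)"

lemma graded_Jp: "graded (Jp k)" by (induction k) (auto simp: graded_basic graded_conv)

text \<open>The powers are built by multiplication on the left; the left antipode identity
  multiplies on the right.\<close>

lemma Jp_comm: "conv (Jp k) J = Jp (Suc k)"
proof (induction k)
  case 0 then show ?case by (simp add: conv_eps_l conv_eps_r graded_basic)
next
  case (Suc k)
  have "conv (Jp (Suc k)) J = conv J (conv (Jp k) J)" by (simp add: conv_assoc graded_basic graded_Jp)
  then show ?case using Suc by simp
qed

text \<open>Each factor \<open>J\<close> kills \<open>e\<close>, so it consumes at least one degree
  of \<open>b\<close>.\<close>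

lemma Jp_vanish: "deg b < k \<Longrightarrow> Jp k b c = 0"
proof (induction k arbitrary: b c)
  case (Suc k)
  have z: "T p1 p2 b * J p1 x * Jp k p2 y * T x y c = 0" for p1 p2 x y
  proof (rule ccontr)
    assume nz: "\<not> ?thesis"
    then have "T p1 p2 b \<noteq> 0" "J p1 x \<noteq> 0" "Jp k p2 y \<noteq> 0" by auto
    moreover have "p1 \<noteq> e" using \<open>J p1 x \<noteq> 0\<close> e by (auto simp: J_def ident_def eps_def of_bool_def split: if_splits)
    ultimately have "deg p1 \<noteq> 0" "deg b = deg p1 + deg p2" using T_supp[of p1 p2 b] deg_0[of p1] by auto
    then show False using Suc.IH[of p2 y] Suc.prems \<open>Jp k p2 y \<noteq> 0\<close> by simp
  qed
  show ?case unfolding Jp.simps conv_def convn_def by (simp only: z sum.neutral_const)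
qed simp

text \<open>The convolution inverse of \<open>eps + J\<close>; the terms beyond \<open>deg b\<close>
  vanish by \<open>Jp_vanish\<close>.\<close>

definition antip :: "'b \<Rightarrow> 'b \<Rightarrow> real" where
  "antip b c = (\<Sum>k\<le>deg b. (-1) ^ k * Jp k b c)"

lemma graded_antip: "graded antip"
  unfolding graded_def antip_def
proof (intro allI impI)
  fix b c assume "(\<Sum>k\<le>deg b. (-1) ^ k * Jp k b c) \<noteq> 0"
  then obtain k where "Jp k b c \<noteq> 0" by (metis (no_types, lifting) mult_zero_right sum.neutral)
  then show "b \<in> B \<and> c \<in> B \<and> deg b = deg c" using gradedD[OF graded_Jp] by blast
qed

lemma antip_eq: "deg b \<le> n \<Longrightarrow> antip b c = (\<Sum>k\<le>n. (-1) ^ k * Jp k b c)"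
  unfolding antip_def by (rule sum.mono_neutral_left) (auto simp: Jp_vanish)

lemma ident_eq: "ident b c = eps b c + J b c" by (simp add: J_def)

lemma telescope: "(\<Sum>k\<le>n. (-1) ^ k * (x k + x (Suc k))) = x 0 + (-1) ^ n * x (Suc n)" for x :: "nat \<Rightarrow> real"
  by (induction n) (auto simp: algebra_simps)

lemma conv_antip_l: "conv antip ident b c = eps b c"
proof -
  let ?I = "BL (deg b)"
  have "conv antip ident b c = (\<Sum>p1\<in>?I. \<Sum>p2\<in>?I. \<Sum>x\<in>?I. \<Sum>y\<in>?I. \<Sum>k\<le>deg b.
      (-1)^k * (T p1 p2 b * Jp k p1 x * eps p2 y * T x y c + T p1 p2 b * Jp k p1 x * J p2 y * T x y c))"
    unfolding conv_def convn_def
    by (intro sum.cong refl) (simp add: BL_def antip_eq[where n = "deg b"] ident_eq sum_distrib_left sum_distrib_right algebra_simps sum.distrib)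
  also have "\<dots> = (\<Sum>k\<le>deg b. \<Sum>p1\<in>?I. \<Sum>p2\<in>?I. \<Sum>x\<in>?I. \<Sum>y\<in>?I.
      (-1)^k * (T p1 p2 b * Jp k p1 x * eps p2 y * T x y c + T p1 p2 b * Jp k p1 x * J p2 y * T x y c))"
    by (simp only: sum.swap[where A = ?I and B = "{..deg b}"])
  also have "\<dots> = (\<Sum>k\<le>deg b. (-1)^k * (conv (Jp k) eps b c + conv (Jp k) J b c))"
    unfolding conv_def convn_def by (simp add: sum_distrib_left sum.distrib distrib_left)
  also have "\<dots> = (\<Sum>k\<le>deg b. (-1)^k * (Jp k b c + Jp (Suc k) b c))"
    by (simp add: conv_eps_r graded_Jp Jp_comm del: Jp.simps)
  \<comment> \<open>The boundary term left by the telescoping sum is the power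
    \<open>deg b + 1\<close>, which vanishes at \<open>b\<close>.\<close>
  also have "\<dots> = eps b c"
    unfolding telescope[where x = "\<lambda>k. Jp k b c"] by (simp add: Jp_vanish del: Jp.simps(2))
  finally show ?thesis .
qed

lemma conv_antip_r: "conv ident antip b c = eps b c"
proof -
  let ?I = "BL (deg b)"
  have "conv ident antip b c = (\<Sum>p1\<in>?I. \<Sum>p2\<in>?I. \<Sum>x\<in>?I. \<Sum>y\<in>?I. \<Sum>k\<le>deg b.
      (-1)^k * (T p1 p2 b * eps p1 x * Jp k p2 y * T x y c + T p1 p2 b * J p1 x * Jp k p2 y * T x y c))"
    unfolding conv_def convn_def
    by (intro sum.cong refl) (simp add: BL_def antip_eq[where n = "deg b"] ident_eq sum_distrib_left sum_distrib_right algebra_simps sum.distrib)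
  also have "\<dots> = (\<Sum>k\<le>deg b. \<Sum>p1\<in>?I. \<Sum>p2\<in>?I. \<Sum>x\<in>?I. \<Sum>y\<in>?I.
      (-1)^k * (T p1 p2 b * eps p1 x * Jp k p2 y * T x y c + T p1 p2 b * J p1 x * Jp k p2 y * T x y c))"
    by (simp only: sum.swap[where A = ?I and B = "{..deg b}"])
  also have "\<dots> = (\<Sum>k\<le>deg b. (-1)^k * (conv eps (Jp k) b c + conv J (Jp k) b c))"
    unfolding conv_def convn_def by (simp add: sum_distrib_left sum.distrib distrib_left)
  also have "\<dots> = (\<Sum>k\<le>deg b. (-1)^k * (Jp k b c + Jp (Suc k) b c))"
    by (simp add: conv_eps_l graded_Jp)
  also have "\<dots> = eps b c"
    unfolding telescope[where x = "\<lambda>k. Jp k b c"] by (simp add: Jp_vanish del: Jp.simps(2))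
  finally show ?thesis .
qed

lemma finite_T_supp: "finite {p. T (fst p) (snd p) c \<noteq> 0}"
  by (rule finite_subset[of _ "BL (deg c) \<times> BL (deg c)", rotated], simp) (auto simp: BL_def dest!: T_supp)

lemma conv_antip_BL:
  assumes "b \<in> B" "c \<in> B"
  shows "(\<Sum>p\<in>{p. T (fst p) (snd p) b \<noteq> 0}. \<Sum>x\<in>{x. antip (fst p) x \<noteq> 0}. T (fst p) (snd p) b * antip (fst p) x * T x (snd p) c) = eps b c"
    and "(\<Sum>p\<in>{p. T (fst p) (snd p) b \<noteq> 0}. \<Sum>x\<in>{x. antip (snd p) x \<noteq> 0}. T (fst p) (snd p) b * antip (snd p) x * T (fst p) x c) = eps b c"
proof -
  let ?I = "BL (deg b)"
  let ?P = "{p. T (fst p) (snd p) b \<noteq> 0}"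
  have P: "?P \<subseteq> ?I \<times> ?I" by (auto simp: BL_def dest!: T_supp)
  have A: "(\<Sum>x\<in>{x. antip q x \<noteq> 0}. t * antip q x * F x) = (\<Sum>x\<in>?I. t * antip q x * F x)" if "q \<in> ?I" for q t F
    by (rule sum.mono_neutral_left[OF finite_BL]) (use that in \<open>auto simp: BL_def dest!: gradedD[OF graded_antip]\<close>)
  have id: "(\<Sum>y\<in>?I. t * ident p y * F y) = t * F p" if "p \<in> ?I" for p t F
  proof -
    have "(\<Sum>y\<in>?I. t * ident p y * F y) = (\<Sum>y\<in>?I. of_bool (y = p) * (t * F y))"
      using that by (intro sum.cong refl) (auto simp: ident_def BL_def)
    then show ?thesis using that by (simp add: of_bool_mult_sum)
  qed
  have "(\<Sum>p\<in>?P. \<Sum>x\<in>{x. antip (fst p) x \<noteq> 0}. T (fst p) (snd p) b * antip (fst p) x * T x (snd p) c) =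
     (\<Sum>p\<in>?P. \<Sum>x\<in>?I. T (fst p) (snd p) b * antip (fst p) x * T x (snd p) c)"
    using P by (intro sum.cong refl A) auto
  also have "\<dots> = (\<Sum>p\<in>?I \<times> ?I. \<Sum>x\<in>?I. T (fst p) (snd p) b * antip (fst p) x * T x (snd p) c)"
    by (rule sum.mono_neutral_left[OF _ P]) auto
  also have "\<dots> = (\<Sum>p1\<in>?I. \<Sum>p2\<in>?I. \<Sum>x\<in>?I. T p1 p2 b * antip p1 x * T x p2 c)"
    by (simp only: sum.cartesian_product' fst_conv snd_conv)
  also have "\<dots> = conv antip ident b c" unfolding conv_def convn_def
    by (intro sum.cong refl) (simp add: id)
  finally show "(\<Sum>p\<in>?P. \<Sum>x\<in>{x. antip (fst p) x \<noteq> 0}. T (fst p) (snd p) b * antip (fst p) x * T x (snd p) c) = eps b c"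
    by (simp add: conv_antip_l)
  have "(\<Sum>p\<in>?P. \<Sum>x\<in>{x. antip (snd p) x \<noteq> 0}. T (fst p) (snd p) b * antip (snd p) x * T (fst p) x c) =
     (\<Sum>p\<in>?P. \<Sum>x\<in>?I. T (fst p) (snd p) b * antip (snd p) x * T (fst p) x c)"
    using P by (intro sum.cong refl A) auto
  also have "\<dots> = (\<Sum>p\<in>?I \<times> ?I. \<Sum>x\<in>?I. T (fst p) (snd p) b * antip (snd p) x * T (fst p) x c)"
    by (rule sum.mono_neutral_left[OF _ P]) auto
  also have "\<dots> = (\<Sum>p1\<in>?I. \<Sum>p2\<in>?I. \<Sum>y\<in>?I. T p1 p2 b * antip p2 y * T p1 y c)"
    by (simp only: sum.cartesian_product' fst_conv snd_conv)
  also have "\<dots> = (\<Sum>p1\<in>?I. \<Sum>p2\<in>?I. \<Sum>y\<in>?I. \<Sum>x\<in>?I. T p1 p2 b * ident p1 x * (antip p2 y * T x y c))"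
    by (intro sum.cong refl) (simp add: id)
  also have "\<dots> = (\<Sum>p1\<in>?I. \<Sum>p2\<in>?I. \<Sum>x\<in>?I. \<Sum>y\<in>?I. T p1 p2 b * ident p1 x * (antip p2 y * T x y c))"
    by (intro sum.cong refl sum.swap)
  also have "\<dots> = conv ident antip b c" unfolding conv_def convn_def
    by (intro sum.cong refl) (simp add: mult.assoc)
  finally show "(\<Sum>p\<in>?P. \<Sum>x\<in>{x. antip (snd p) x \<noteq> 0}. T (fst p) (snd p) b * antip (snd p) x * T (fst p) x c) = eps b c"
    by (simp add: conv_antip_r)
qed

section \<open>From structure constants to a PSH algebra\<close>

lemma hopf_supp:
  assumes "a \<in> B" "b \<in> B" "c1 \<in> B" "c2 \<in> B"
  shows "(\<Sum>x\<in>{x \<in> B. deg x = deg a + deg b}. T a b x * T c1 c2 x) =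
    (\<Sum>p\<in>{p. T (fst p) (snd p) a \<noteq> 0}. \<Sum>r\<in>{r. T (fst r) (snd r) b \<noteq> 0}.
       T (fst p) (snd p) a * T (fst r) (snd r) b * T (fst p) (fst r) c1 * T (snd p) (snd r) c2)" (is "_ = ?R")
proof -
  let ?Q = "{((p1,p2),(r1,r2)). p1 \<in> B \<and> p2 \<in> B \<and> r1 \<in> B \<and> r2 \<in> B \<and> deg p1 + deg p2 = deg a \<and>
         deg r1 + deg r2 = deg b \<and> deg p1 + deg r1 = deg c1 \<and> deg p2 + deg r2 = deg c2}"
  let ?F = "\<lambda>(p,r). T (fst p) (snd p) a * T (fst r) (snd r) b * T (fst p) (fst r) c1 * T (snd p) (snd r) c2"
  have fQ: "finite ?Q"
    by (rule finite_subset[of _ "(BL (deg a) \<times> BL (deg a)) \<times> (BL (deg b) \<times> BL (deg b))", rotated], simp) (auto simp: BL_def)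
  have "?R = (\<Sum>z\<in>{p. T (fst p) (snd p) a \<noteq> 0} \<times> {r. T (fst r) (snd r) b \<noteq> 0}. ?F z)"
    by (simp add: sum.cartesian_product)
  also have "\<dots> = (\<Sum>z\<in>?Q. ?F z)"
  proof (rule sum.mono_neutral_cong)
    fix z assume z: "z \<in> ?Q - {p. T (fst p) (snd p) a \<noteq> 0} \<times> {r. T (fst r) (snd r) b \<noteq> 0}"
    obtain p r where "z = (p,r)" by (cases z) auto
    then show "?F z = 0" using z by auto
  next
    fix z assume z: "z \<in> {p. T (fst p) (snd p) a \<noteq> 0} \<times> {r. T (fst r) (snd r) b \<noteq> 0} - ?Q"
    obtain p1 p2 r1 r2 where zz: "z = ((p1,p2),(r1,r2))" by (cases z) auto
    show "?F z = 0"
    proof (rule ccontr)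
      assume "?F z \<noteq> 0"
      then have "T p1 p2 a \<noteq> 0" "T r1 r2 b \<noteq> 0" "T p1 r1 c1 \<noteq> 0" "T p2 r2 c2 \<noteq> 0" by (auto simp: zz)
      then have "z \<in> ?Q" unfolding zz using T_supp by simp
      then show False using z by blast
    qed
  qed (rule fQ | rule finite_cartesian_product finite_T_supp | rule refl)+
  finally show ?thesis using hopf[OF assms] by simp
qed

text \<open>The tables are compared with \<open>T\<close> only at the basis arguments where
  \<open>real_coords\<close> determines them; outside these they may take any values.\<close>

lemma based_psh_of_coords:
  assumes mc: "\<And>a b c. a \<in> B \<Longrightarrow> b \<in> B \<Longrightarrow> mc a b c = T a b c"
    and cc: "\<And>a b c. c \<in> B \<Longrightarrow> cc a b c = T a b c"
    and un: "\<And>b. un b = of_bool (b = e)"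
    and cu: "\<And>b. b \<in> B \<Longrightarrow> cu b = of_bool (b = e)"
  shows "based_psh B deg mc cc un cu"
proof -
  let ?D = "\<lambda>n. {x \<in> B. deg x = n}"
  have fT: "finite {c. T a b c \<noteq> 0}" for a b
    by (rule finite_subset[OF _ finite_deg[of "deg a + deg b"]]) (auto dest: T_supp)
  have un1: "{x. un x \<noteq> 0} = {e}" by (auto simp: un)
  have s1: "(\<Sum>x\<in>{x. T a b x \<noteq> 0}. T a b x * g x) = (\<Sum>x\<in>?D (deg a + deg b). T a b x * g x)" for a b g
    by (rule sum_support[OF finite_deg]) (auto dest: T_supp)
  have D: "x \<in> B" if "x \<in> ?D n" for x n using that by simp
  have s2: "(\<Sum>x\<in>{x. T x c d \<noteq> 0}. T x c d * g x) = (\<Sum>x\<in>BL (deg d). T x c d * g x)" for c d g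
    by (rule sum_support[OF finite_BL]) (auto simp: BL_def dest: T_supp)
  have s3: "(\<Sum>x\<in>{x. T c x d \<noteq> 0}. T c x d * g x) = (\<Sum>x\<in>BL (deg d). T c x d * g x)" for c d g
    by (rule sum_support[OF finite_BL]) (auto simp: BL_def dest: T_supp)
  have BLB: "x \<in> B" if "x \<in> BL n" for x n using that by (simp add: BL_def)
  have "based_hopf B deg mc cc un cu"
    unfolding based_hopf_def
  proof (intro conjI ballI)
    fix a b assume ab: "a \<in> B" "b \<in> B"
    show "finite {c. mc a b c \<noteq> 0}" "{c. mc a b c \<noteq> 0} \<subseteq> B"
      using fT by (auto simp: mc ab dest: T_supp)
  next
    fix c assume c: "c \<in> B"
    show "finite {p. cc (fst p) (snd p) c \<noteq> 0}" "{p. cc (fst p) (snd p) c \<noteq> 0} \<subseteq> B \<times> B"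
      using finite_T_supp by (auto simp: cc c dest: T_supp)
  next
    show "finite {b. un b \<noteq> 0}" "{b. un b \<noteq> 0} \<subseteq> B" using e by (auto simp: un1)
  next
    fix a b c assume abc: "a \<in> B" "b \<in> B" "c \<in> B"
    show "mc a b c \<noteq> 0 \<longrightarrow> deg c = deg a + deg b" "cc a b c \<noteq> 0 \<longrightarrow> deg c = deg a + deg b"
      using T_supp[of a b c] by (auto simp: mc cc abc)
  next
    fix b assume b: "b \<in> B"
    show "un b \<noteq> 0 \<longrightarrow> deg b = 0" "cu b \<noteq> 0 \<longrightarrow> deg b = 0" using deg_e by (auto simp: un cu b)
  next
    show "\<exists>b0\<in>B. \<forall>b\<in>B. (deg b = 0) = (b = b0)" using e deg_0 by blast
  next
    fix a b c d assume B: "a \<in> B" "b \<in> B" "c \<in> B" "d \<in> B"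
    have "(\<Sum>x\<in>{x. mc a b x \<noteq> 0}. mc a b x * mc x c d) = (\<Sum>x\<in>?D (deg a + deg b). T a b x * T x c d)"
      unfolding mc[OF B(1,2)] s1 by (rule sum.cong[OF refl]) (simp add: mc B)
    also have "\<dots> = (\<Sum>x\<in>?D (deg b + deg c). T b c x * T a x d)" by (rule assoc[OF B])
    also have "\<dots> = (\<Sum>y\<in>{y. mc b c y \<noteq> 0}. mc b c y * mc a y d)"
      unfolding mc[OF B(2,3)] s1 by (rule sum.cong[OF refl]) (simp add: mc B)
    finally show "(\<Sum>x\<in>{x. mc a b x \<noteq> 0}. mc a b x * mc x c d) = (\<Sum>y\<in>{y. mc b c y \<noteq> 0}. mc b c y * mc a y d)" .
    have "(\<Sum>x\<in>{x. cc x c d \<noteq> 0}. cc x c d * cc a b x) = (\<Sum>x\<in>BL (deg d). T a b x * T x c d)"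
      unfolding cc[OF B(4)] s2 by (rule sum.cong[OF refl]) (simp add: cc BLB)
    also have "\<dots> = (\<Sum>y\<in>BL (deg d). T b c y * T a y d)" using B by (intro assoc_BL) auto
    also have "\<dots> = (\<Sum>y\<in>{y. cc a y d \<noteq> 0}. cc a y d * cc b c y)"
      unfolding cc[OF B(4)] s3 by (rule sum.cong[OF refl]) (simp add: cc BLB)
    finally show "(\<Sum>x\<in>{x. cc x c d \<noteq> 0}. cc x c d * cc a b x) = (\<Sum>y\<in>{y. cc a y d \<noteq> 0}. cc a y d * cc b c y)" .
  next
    fix a c assume B: "a \<in> B" "c \<in> B"
    show "(\<Sum>x\<in>{x. un x \<noteq> 0}. un x * mc x a c) = (if a = c then 1 else 0)"
      "(\<Sum>x\<in>{x. un x \<noteq> 0}. un x * mc a x c) = (if a = c then 1 else 0)"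
      unfolding un1 using B e by (simp_all add: un mc unit_l unit_r)
    have "(\<Sum>x\<in>{x. cc x a c \<noteq> 0}. cu x * cc x a c) = (\<Sum>x\<in>BL (deg c). of_bool (x = e) * T x a c)"
      unfolding cc[OF B(2)] mult.commute[of "cu _"] s2 by (rule sum.cong[OF refl]) (auto simp: cu BLB)
    then show "(\<Sum>x\<in>{x. cc x a c \<noteq> 0}. cu x * cc x a c) = (if a = c then 1 else 0)"
      using B by (simp add: of_bool_mult_sum unit_l)
    have "(\<Sum>x\<in>{x. cc a x c \<noteq> 0}. cc a x c * cu x) = (\<Sum>x\<in>BL (deg c). of_bool (x = e) * T a x c)"
      unfolding cc[OF B(2)] s3 by (rule sum.cong[OF refl]) (auto simp: cu BLB)
    then show "(\<Sum>x\<in>{x. cc a x c \<noteq> 0}. cc a x c * cu x) = (if a = c then 1 else 0)"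
      using B by (simp add: of_bool_mult_sum unit_r)
  next
    fix a b c1 c2 assume B: "a \<in> B" "b \<in> B" "c1 \<in> B" "c2 \<in> B"
    have "(\<Sum>x\<in>{x. mc a b x \<noteq> 0}. mc a b x * cc c1 c2 x) = (\<Sum>x\<in>?D (deg a + deg b). T a b x * T c1 c2 x)"
      unfolding mc[OF B(1,2)] s1 by (rule sum.cong[OF refl]) (simp add: cc)
    also have "\<dots> = (\<Sum>p\<in>{p. T (fst p) (snd p) a \<noteq> 0}. \<Sum>r\<in>{r. T (fst r) (snd r) b \<noteq> 0}.
       T (fst p) (snd p) a * T (fst r) (snd r) b * T (fst p) (fst r) c1 * T (snd p) (snd r) c2)"
      by (rule hopf_supp[OF B])
    also have "\<dots> = (\<Sum>p\<in>{p. cc (fst p) (snd p) a \<noteq> 0}. \<Sum>r\<in>{r. cc (fst r) (snd r) b \<noteq> 0}.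
            cc (fst p) (snd p) a * cc (fst r) (snd r) b * mc (fst p) (fst r) c1 * mc (snd p) (snd r) c2)"
      unfolding cc[OF B(1)] cc[OF B(2)]
    proof (intro sum.cong refl)
      fix p r assume "p \<in> {p. T (fst p) (snd p) a \<noteq> 0}" "r \<in> {r. T (fst r) (snd r) b \<noteq> 0}"
      then have "fst p \<in> B" "snd p \<in> B" "fst r \<in> B" "snd r \<in> B"
        using T_supp[of "fst p" "snd p" a] T_supp[of "fst r" "snd r" b] by auto
      then show "T (fst p) (snd p) a * T (fst r) (snd r) b * T (fst p) (fst r) c1 * T (snd p) (snd r) c2 =
        T (fst p) (snd p) a * T (fst r) (snd r) b * mc (fst p) (fst r) c1 * mc (snd p) (snd r) c2" by (simp add: mc)
    qed
    finally show "(\<Sum>x\<in>{x. mc a b x \<noteq> 0}. mc a b x * cc c1 c2 x) =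
        (\<Sum>p\<in>{p. cc (fst p) (snd p) a \<noteq> 0}. \<Sum>r\<in>{r. cc (fst r) (snd r) b \<noteq> 0}.
            cc (fst p) (snd p) a * cc (fst r) (snd r) b * mc (fst p) (fst r) c1 * mc (snd p) (snd r) c2)" .
  next
    fix a b assume B: "a \<in> B" "b \<in> B"
    \<comment> \<open>By degree, a nonzero coefficient at \<open>e\<close> forces both arguments
      into degree 0, hence equal to \<open>e\<close>.\<close>
    have te: "T a b e = of_bool (a = e) * of_bool (b = e)"
    proof (cases "T a b e = 0")
      case True then show ?thesis using unit_l[OF e e] by auto
    next
      case False
      then have "a = e" "b = e" using T_supp[OF False] deg_e deg_0[OF B(1)] deg_0[OF B(2)] by auto
      then show ?thesis using unit_l[OF e e] by simp
    qed
    show "(\<Sum>x\<in>{x. un x \<noteq> 0}. un x * cc a b x) = un a * un b"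
      unfolding un1 by (simp add: un cc e te)
    have "(\<Sum>x\<in>{x. mc a b x \<noteq> 0}. mc a b x * cu x) = (\<Sum>x\<in>?D (deg a + deg b). of_bool (x = e) * T a b x)"
      unfolding mc[OF B] s1 by (rule sum.cong[OF refl]) (auto simp: cu)
    also have "\<dots> = T a b e" using T_supp[of a b e] e unfolding of_bool_mult_sum[OF finite_deg] by auto
    finally show "(\<Sum>x\<in>{x. mc a b x \<noteq> 0}. mc a b x * cu x) = cu a * cu b" by (simp add: te cu B)
  next
    show "(\<Sum>x\<in>{x. un x \<noteq> 0}. un x * cu x) = 1" unfolding un1 by (simp add: un cu e)
  next
    show "\<exists>s :: 'b \<Rightarrow> 'b \<Rightarrow> real.
        (\<forall>b\<in>B. finite {c. s b c \<noteq> 0} \<and> {c. s b c \<noteq> 0} \<subseteq> B) \<and>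
        (\<forall>b\<in>B. \<forall>c\<in>B.
           (\<Sum>p\<in>{p. cc (fst p) (snd p) b \<noteq> 0}. \<Sum>x\<in>{x. s (fst p) x \<noteq> 0}.
               cc (fst p) (snd p) b * s (fst p) x * mc x (snd p) c) = cu b * un c) \<and>
        (\<forall>b\<in>B. \<forall>c\<in>B.
           (\<Sum>p\<in>{p. cc (fst p) (snd p) b \<noteq> 0}. \<Sum>x\<in>{x. s (snd p) x \<noteq> 0}.
               cc (fst p) (snd p) b * s (snd p) x * mc (fst p) x c) = cu b * un c)"
    proof (intro exI[of _ antip] conjI ballI)
      fix b assume "b \<in> B"
      show "finite {c. antip b c \<noteq> 0}" "{c. antip b c \<noteq> 0} \<subseteq> B"
        using gradedD[OF graded_antip, of b] by (auto intro!: finite_subset[OF _ finite_deg[of "deg b"]])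
    next
      fix b c assume B: "b \<in> B" "c \<in> B"
      have pB: "p \<in> B \<and> q \<in> B" if "T p q b \<noteq> 0" for p q using that T_supp by blast
      have aB: "x \<in> B" if "antip q x \<noteq> 0" for q x using that gradedD[OF graded_antip] by blast
      have eb: "eps b c = cu b * un c" by (simp add: eps_def cu un B)
      show "(\<Sum>p\<in>{p. cc (fst p) (snd p) b \<noteq> 0}. \<Sum>x\<in>{x. antip (fst p) x \<noteq> 0}.
               cc (fst p) (snd p) b * antip (fst p) x * mc x (snd p) c) = cu b * un c"
        unfolding cc[OF B(1)] eb[symmetric] conv_antip_BL(1)[OF B, symmetric]
        by (intro sum.cong refl arg_cong2[where f = "(*)"] mc) (auto dest: pB aB)
      show "(\<Sum>p\<in>{p. cc (fst p) (snd p) b \<noteq> 0}. \<Sum>x\<in>{x. antip (snd p) x \<noteq> 0}.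
               cc (fst p) (snd p) b * antip (snd p) x * mc (fst p) x c) = cu b * un c"
        unfolding cc[OF B(1)] eb[symmetric] conv_antip_BL(2)[OF B, symmetric]
        by (intro sum.cong refl arg_cong2[where f = "(*)"] mc) (auto dest: pB aB)
    qed
  qed
  then show ?thesis unfolding based_psh_def using T_nonneg by (simp add: mc cc un cu)
qed

end

section \<open>The structure constants of \<open>C(q)\<close>\<close>

text \<open>Taking the real part loses nothing, as \<open>nnr_tc\<close> makes the coefficient real.
  The default 0 off \<open>Omega\<close> and off matching degrees confines the supports to finite
  sets.\<close>

definition Tc :: "'a::{finite,field} gr \<Rightarrow> 'a gr \<Rightarrow> 'a gr \<Rightarrow> real" where
  "Tc a b c = (if a \<in> Omega \<and> b \<in> Omega \<and> c \<in> Omega \<and> gdeg c = gdeg a + gdeg b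
     then Re (tc (gdeg a) (gdeg b) (a (gdeg a)) (b (gdeg b)) (c (gdeg c))) else 0)"

lemma emb_same [simp]: "emb n f n = f" by (simp add: emb_def)
lemma emb_other: "m \<noteq> n \<Longrightarrow> emb n f m = (\<lambda>x. 0)" by (simp add: emb_def)
lemma emb_eq_iff: "a \<in> Om n \<Longrightarrow> b \<in> Om m \<Longrightarrow> emb n a = emb m b \<longleftrightarrow> n = m \<and> a = b"
  using gdeg_emb by (metis emb_same)

lemma nnr_Re: "nnr z \<Longrightarrow> complex_of_real (Re z) = z" by (auto simp: nnr_def)

lemma Tc_emb: "a \<in> Om k \<Longrightarrow> b \<in> Om l \<Longrightarrow> c \<in> Om (k+l) \<Longrightarrow>
    complex_of_real (Tc (emb k a) (emb l b) (emb (k+l) c)) = tc k l a b c"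
  by (simp add: Tc_def emb_Omega nnr_Re nnr_tc)

lemma Tc_supp: "Tc a b c \<noteq> 0 \<Longrightarrow> a \<in> Omega \<and> b \<in> Omega \<and> c \<in> Omega \<and> gdeg c = gdeg a + gdeg b"
  by (auto simp: Tc_def split: if_splits)

lemma Tc_nonneg: "Tc a b c \<ge> 0"
proof (cases "Tc a b c = 0")
  case False
  from Tc_supp[OF this] obtain k l a' b' c' where "a' \<in> Om k" "a = emb k a'" "b' \<in> Om l" "b = emb l b'"
    "c' \<in> Om (k+l)" "c = emb (k+l) c'" by (metis OmegaE)
  then have "complex_of_real (Tc a b c) = tc k l a' b' c'" "nnr (tc k l a' b' c')" by (simp_all add: Tc_emb nnr_tc)
  then obtain r where "complex_of_real (Tc a b c) = of_real r" "r \<ge> 0" unfolding nnr_def by metis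
  then show ?thesis by simp
qed simp

lemma bij_betw_emb: "bij_betw (emb n) (Om n) {x \<in> Omega. gdeg x = n}"
  by (rule bij_betwI[of _ _ _ "\<lambda>F. F n"]) (auto simp: emb_Omega elim!: OmegaE)

lemma sum_Omega_deg: "(\<Sum>x\<in>{x \<in> Omega. gdeg x = n}. F x) = (\<Sum>x\<in>Om n. F (emb n x))"
  using sum.reindex_bij_betw[OF bij_betw_emb, of F n] by simp

lemma card_GL_0: "card (GL 0 :: 'a::{finite,comm_ring_1} mat set) = 1"
proof -
  have "card (GL 0 :: 'a mat set) \<le> card (gl 0 :: 'a mat set)"
    by (rule card_mono[OF finite_gl]) (use GL_gl in blast)
  then show ?thesis using card_GL_pos[of 0, where 'a = 'a] by (simp add: gl_0_eq)
qed

lemma Om_0: "(Om 0 :: ('a::{finite,field} mat \<Rightarrow> complex) set) = {\<lambda>x. if x \<in> gl 0 then 1 else 0}"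
proof -
  let ?t = "\<lambda>x :: 'a mat. if x \<in> gl 0 then 1 else 0 :: complex"
  have "\<psi> = ?t" if "lin_char 0 \<psi>" for \<psi> :: "'a mat \<Rightarrow> complex"
  proof
    fix x :: "'a mat"
    show "\<psi> x = ?t x"
    proof (cases "x \<in> gl 0")
      case True
      then have "x = 0" by (auto simp: gl_0_eq fun_eq_iff)
      then show ?thesis using lin_char_0[OF that] by simp
    qed (simp add: lin_char_out[OF that])
  qed
  then have LC: "LC 0 = {?t}" using triv_lin_char by auto
  have "orb 0 ?t = {?t}" using orb_subset[of 0 ?t] orb_refl[of 0 ?t] LC by auto
  then have orbs: "orbs 0 = {{?t}}" unfolding orbs_def LC by simp
  have "onrm 0 {?t} = 1" by (simp add: onrm_def gl_0_eq card_GL_0)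
  then show ?thesis unfolding Om_def orbs by (simp add: nosum_def osum_def)
qed

definition oneC :: "'a::{finite,field} gr" where "oneC = emb 0 (\<lambda>x. if x \<in> gl 0 then 1 else 0)"

lemma oneC_Omega: "oneC \<in> Omega" unfolding oneC_def by (rule emb_Omega) (simp add: Om_0)

lemma oneC_iff: "b \<in> Omega \<Longrightarrow> gdeg b = 0 \<longleftrightarrow> b = oneC"
  by (auto elim!: OmegaE simp: oneC_def Om_0)

lemma nilrad_0_l: "nilrad 0 l = {0}"
proof (intro equalityI subsetI)
  fix x :: "'a mat" assume "x \<in> nilrad 0 l"
  then have "x i j = 0" for i j unfolding nilrad_def by auto
  then show "x \<in> {0}" by (simp add: fun_eq_iff)
qed simp

lemma nilrad_0_r: "nilrad k 0 = {0}"
proof (intro equalityI subsetI)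
  fix x :: "'a mat" assume x: "x \<in> nilrad k 0"
  have "x i j = 0" for i j
  proof (rule ccontr)
    assume "x i j \<noteq> 0"
    then have "k \<le> j" "j < k" using x unfolding nilrad_def gl_iff by auto
    then show False by simp
  qed
  then show "x \<in> {0}" by (simp add: fun_eq_iff)
qed simp

lemma bdiag_0: "y \<in> gl l \<Longrightarrow> bdiag 0 l x y = y" "x \<in> gl k \<Longrightarrow> bdiag k 0 x y = x"
  by (auto simp: bdiag_def fun_eq_iff gl_def)

lemma tc_unit: "tc 0 l (\<lambda>x. if x \<in> gl 0 then 1 else 0) a c = form l c a"
  "tc l 0 a (\<lambda>x. if x \<in> gl 0 then 1 else 0) c = form l c a"
  by (simp_all add: tc_def form2_def form_def hc_res_alt nilrad_0_l nilrad_0_r bdiag_0 gl_0_eq card_GL_0)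

lemma Tc_unit:
  fixes a c :: "'a::{finite,field} gr"
  assumes "a \<in> Omega" "c \<in> Omega"
  shows "Tc oneC a c = of_bool (a = c)" "Tc a oneC c = of_bool (a = c)"
proof -
  obtain l a' where a: "a' \<in> Om l" "a = emb l a'" "gdeg a = l" using assms by (elim OmegaE)
  have g0: "gdeg (oneC :: 'a gr) = 0" using oneC_iff[OF oneC_Omega] by simp
  have o: "(\<lambda>x. if x \<in> gl 0 then 1 else 0) \<in> Om 0" by (simp add: Om_0)
  show "Tc oneC a c = of_bool (a = c)" "Tc a oneC c = of_bool (a = c)"
  proof -
    show "Tc oneC a c = of_bool (a = c)"
    proof (cases "gdeg c = l")
      case True
      then obtain c' where c: "c' \<in> Om l" "c = emb l c'" using assms by (metis OmegaE)
      have "complex_of_real (Tc oneC a c) = form l c' a'"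
        using Tc_emb[OF o a(1), of c'] c by (simp add: oneC_def a c tc_unit)
      also have "\<dots> = of_bool (a = c)" using Om_orthonormal[OF c(1) a(1)] emb_eq_iff[OF a(1) c(1)] a c by auto
      finally show ?thesis by (cases "a = c") simp_all
    next
      case False
      have "Tc oneC a c = 0" by (rule ccontr) (use Tc_supp[of oneC a c] False a(3) g0 in simp)
      moreover have "a \<noteq> c" using False a(3) by auto
      ultimately show ?thesis by simp
    qed
    show "Tc a oneC c = of_bool (a = c)"
    proof (cases "gdeg c = l")
      case True
      then obtain c' where c: "c' \<in> Om l" "c = emb l c'" using assms by (metis OmegaE)
      have "complex_of_real (Tc a oneC c) = form l c' a'"
        using Tc_emb[OF a(1) o, of c'] c by (simp add: oneC_def a c tc_unit)
      also have "\<dots> = of_bool (a = c)" using Om_orthonormal[OF c(1) a(1)] emb_eq_iff[OF a(1) c(1)] a c by auto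
      finally show ?thesis by (cases "a = c") simp_all
    next
      case False
      have "Tc a oneC c = 0" by (rule ccontr) (use Tc_supp[of a oneC c] False a(3) g0 in simp)
      moreover have "a \<noteq> c" using False a(3) by auto
      ultimately show ?thesis by simp
    qed
  qed
qed

lemma Tc_assoc:
  fixes a b c d :: "'a::{finite,field} gr"
  assumes "a \<in> Omega" "b \<in> Omega" "c \<in> Omega" "d \<in> Omega"
  shows "(\<Sum>x\<in>{x \<in> Omega. gdeg x = gdeg a + gdeg b}. Tc a b x * Tc x c d) =
    (\<Sum>y\<in>{y \<in> Omega. gdeg y = gdeg b + gdeg c}. Tc b c y * Tc a y d)"
proof -
  obtain k a' where a: "a' \<in> Om k" "a = emb k a'" "gdeg a = k" using assms(1) by (elim OmegaE)
  obtain l b' where b: "b' \<in> Om l" "b = emb l b'" "gdeg b = l" using assms(2) by (elim OmegaE)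
  obtain m c' where c: "c' \<in> Om m" "c = emb m c'" "gdeg c = m" using assms(3) by (elim OmegaE)
  obtain n d' where d: "d' \<in> Om n" "d = emb n d'" "gdeg d = n" using assms(4) by (elim OmegaE)
  show ?thesis
  proof (cases "n = k + l + m")
    case False
    have "Tc x c d = 0" if "gdeg x = k + l" for x using Tc_supp[of x c d] that c d False by auto
    moreover have "Tc a y d = 0" if "gdeg y = l + m" for y using Tc_supp[of a y d] that a d False by auto
    ultimately show ?thesis using a b c by simp
  next
    case True
    have d1: "d' \<in> Om (k+l+m)" "d = emb (k+l+m) d'" using d True by auto
    have d2: "d' \<in> Om (k+(l+m))" "d = emb (k+(l+m)) d'" using d1 by (simp_all add: add.assoc)
    have "complex_of_real (\<Sum>x\<in>{x \<in> Omega. gdeg x = gdeg a + gdeg b}. Tc a b x * Tc x c d) = (\<Sum>x\<in>Om (k+l). tc (k+l) m x c' d' * tc k l a' b' x)"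
      unfolding a(3) b(3) unfolding sum_Omega_deg of_real_sum of_real_mult unfolding a(2) b(2) c(2) d1(2)
      by (intro sum.cong refl) (simp only: Tc_emb[OF a(1) b(1)] Tc_emb[OF _ c(1) d1(1)] mult.commute)
    also have "\<dots> = (\<Sum>y\<in>Om (l+m). tc k (l+m) a' y d' * tc l m b' c' y)" by (rule tc_assoc[OF Om_classfun[OF d1(1)]])
    also have "\<dots> = complex_of_real (\<Sum>y\<in>{y \<in> Omega. gdeg y = gdeg b + gdeg c}. Tc b c y * Tc a y d)"
      unfolding c(3) b(3) unfolding sum_Omega_deg of_real_sum of_real_mult unfolding a(2) b(2) c(2) d2(2)
      by (intro sum.cong refl) (simp only: Tc_emb[OF b(1) c(1)] Tc_emb[OF a(1) _ d2(1)] mult.commute)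
    finally show ?thesis by (simp only: of_real_eq_iff)
  qed
qed

lemma form_cnj: "form n g f = cnj (form n f g)" by (simp add: form_def mult.commute)
lemma form2_cnj: "form2 k l g f = cnj (form2 k l f g)" by (simp add: form2_def mult.commute)

lemma form_hc_ind:
  assumes "classfun (k+l) x" shows "form (k+l) (hc_ind k l (\<lambda>x y. a x * b y)) x = cnj (tc k l a b x)"
  unfolding adjunction[OF assms] tc_def by (rule form2_cnj)

lemma cnj_tc: "a \<in> Om k \<Longrightarrow> b \<in> Om l \<Longrightarrow> c \<in> Om (k+l) \<Longrightarrow> cnj (tc k l a b c) = tc k l a b c"
  using Tc_emb[of a k b l c] by (metis complex_cnj_complex_of_real)

lemma form_sum_left: "form n (\<lambda>x. \<Sum>a\<in>A. s a * a x) g = (\<Sum>a\<in>A. s a * form n a g)"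
  unfolding form_def by (simp add: sum_distrib_left sum_distrib_right sum_divide_distrib mult.assoc) (rule sum.swap)

text \<open>Adjunction gives the conjugates of the restriction coefficients; positivity makes these
  real, so product and coproduct share one table.\<close>

lemma hc_ind_expansion:
  assumes "a \<in> Om k" "b \<in> Om l"
  shows "hc_ind k l (\<lambda>x y. a x * b y) z = (\<Sum>c\<in>Om (k+l). tc k l a b c * c z)"
proof -
  have "hc_ind k l (\<lambda>x y. a x * b y) z = (\<Sum>c\<in>Om (k+l). form (k+l) (hc_ind k l (\<lambda>x y. a x * b y)) c * c z)"
    by (rule classfun_expansion[OF hc_ind_classfun])
  then show ?thesis using assms by (simp add: form_hc_ind Om_classfun cnj_tc)
qed

text \<open>The left side becomes an inner product of two induced functions, and the Mackey formula
  expresses it through quadruples of basis elements, one for each of the four blocks. Their degrees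
  run over all ways to fit the prescribed row and column sums.\<close>

lemma Tc_hopf:
  fixes a b c1 c2 :: "'a::{finite,field} gr"
  assumes "a \<in> Omega" "b \<in> Omega" "c1 \<in> Omega" "c2 \<in> Omega"
  shows "(\<Sum>x\<in>{x \<in> Omega. gdeg x = gdeg a + gdeg b}. Tc a b x * Tc c1 c2 x) =
      (\<Sum>(p,r)\<in>{((p1,p2),(r1,r2)). p1 \<in> Omega \<and> p2 \<in> Omega \<and> r1 \<in> Omega \<and> r2 \<in> Omega \<and> gdeg p1 + gdeg p2 = gdeg a \<and>
         gdeg r1 + gdeg r2 = gdeg b \<and> gdeg p1 + gdeg r1 = gdeg c1 \<and> gdeg p2 + gdeg r2 = gdeg c2}.
        Tc (fst p) (snd p) a * Tc (fst r) (snd r) b * Tc (fst p) (fst r) c1 * Tc (snd p) (snd r) c2)" (is "_ = sum ?F ?Q")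
proof -
  obtain k a' where a: "a' \<in> Om k" "a = emb k a'" "gdeg a = k" using assms(1) by (elim OmegaE)
  obtain l b' where b: "b' \<in> Om l" "b = emb l b'" "gdeg b = l" using assms(2) by (elim OmegaE)
  obtain c c1' where c1: "c1' \<in> Om c" "c1 = emb c c1'" "gdeg c1 = c" using assms(3) by (elim OmegaE)
  obtain d c2' where c2: "c2' \<in> Om d" "c2 = emb d c2'" "gdeg c2 = d" using assms(4) by (elim OmegaE)
  show ?thesis
  proof (cases "k + l = c + d")
    case False
    have "Tc c1 c2 x = 0" if "gdeg x = k + l" for x using Tc_supp[of c1 c2 x] that c1 c2 False by auto
    then have "(\<Sum>x\<in>{x \<in> Omega. gdeg x = gdeg a + gdeg b}. Tc a b x * Tc c1 c2 x) = 0"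
      by (intro sum.neutral) (simp add: a(3) b(3))
    moreover have "?Q = {}" using False unfolding a(3) b(3) c1(3) c2(3) by auto
    ultimately show ?thesis by (simp only: sum.empty)
  next
    case True
    have cd: "x \<in> Om (c+d)" if "x \<in> Om (k+l)" for x :: "'a mat \<Rightarrow> complex" using that True by simp
    \<comment> \<open>A term of the Mackey formula carries \<open>k1\<close> and four basis
      elements. For homogeneous elements \<open>k1\<close> is recovered as \<open>gdeg p1\<close>,
      and the remaining degrees are determined by it.\<close>
    define jj where "jj = (\<lambda>(k1, p1 :: 'a mat \<Rightarrow> complex, p2 :: 'a mat \<Rightarrow> complex, r1 :: 'a mat \<Rightarrow> complex, r2 :: 'a mat \<Rightarrow> complex).
      ((emb k1 p1, emb (k-k1) p2), (emb (c-k1) r1, emb (k1+l-c) r2)))"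
    define ii where "ii = (\<lambda>((p1 :: 'a gr, p2 :: 'a gr), (r1 :: 'a gr, r2 :: 'a gr)). (gdeg p1, p1 (gdeg p1), p2 (gdeg p2), r1 (gdeg r1), r2 (gdeg r2)))"
    have "complex_of_real (\<Sum>x\<in>{x \<in> Omega. gdeg x = gdeg a + gdeg b}. Tc a b x * Tc c1 c2 x) = (\<Sum>x\<in>Om (k+l). tc k l a' b' x * tc c d c1' c2' x)"
      unfolding a(3) b(3) unfolding sum_Omega_deg of_real_sum of_real_mult unfolding a(2) b(2) c1(2) c2(2)
    proof (intro sum.cong refl)
      fix x :: "'a mat \<Rightarrow> complex" assume x: "x \<in> Om (k+l)"
      show "complex_of_real (Tc (emb k a') (emb l b') (emb (k+l) x)) * complex_of_real (Tc (emb c c1') (emb d c2') (emb (k+l) x)) =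
        tc k l a' b' x * tc c d c1' c2' x"
        using Tc_emb[OF a(1) b(1) x] Tc_emb[OF c1(1) c2(1) cd[OF x]] True by simp
    qed
    \<comment> \<open>Parseval for the orthonormal basis \<open>Om (k+l)\<close>.\<close>
    also have "\<dots> = form (k+l) (hc_ind k l (\<lambda>x y. a' x * b' y)) (hc_ind c d (\<lambda>x y. c1' x * c2' y))"
    proof -
      have e: "hc_ind k l (\<lambda>x y. a' x * b' y) = (\<lambda>z. \<Sum>x\<in>Om (k+l). tc k l a' b' x * x z)"
        by (rule ext) (rule hc_ind_expansion[OF a(1) b(1)])
      have "form (k+l) x (hc_ind c d (\<lambda>x y. c1' x * c2' y)) = tc c d c1' c2' x" if x: "x \<in> Om (k+l)" for x
        unfolding form_cnj[of _ x] using form_hc_ind[OF Om_classfun[OF cd[OF x]], of c1' c2'] True by simp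
      then show ?thesis unfolding e form_sum_left by simp
    qed
    also have "\<dots> = (\<Sum>k1\<in>dc_indices k l c d. mackey_term k1 (k-k1) (c-k1) (k1+l-c) a' b' c1' c2')"
      by (intro mackey Om_classfun a b c1 c2 True)
    also have "\<dots> = (\<Sum>(k1,p1,p2,r1,r2)\<in>Sigma (dc_indices k l c d) (\<lambda>k1. Om k1 \<times> Om (k-k1) \<times> Om (c-k1) \<times> Om (k1+l-c)).
        tc k1 (k-k1) p1 p2 a' * tc (c-k1) (k1+l-c) r1 r2 b' * (cnj (tc k1 (c-k1) p1 r1 c1') * cnj (tc (k-k1) (k1+l-c) p2 r2 c2')))"
      unfolding mackey_term_def by (simp add: sum.cartesian_product sum.Sigma)
    also have "\<dots> = (\<Sum>z\<in>?Q. complex_of_real (?F z))"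
    proof (rule sum.reindex_bij_witness[where j = jj and i = ii])
      fix z assume "z \<in> Sigma (dc_indices k l c d) (\<lambda>k1. (Om k1 :: ('a mat \<Rightarrow> complex) set) \<times> (Om (k-k1) :: ('a mat \<Rightarrow> complex) set) \<times> (Om (c-k1) :: ('a mat \<Rightarrow> complex) set) \<times> (Om (k1+l-c) :: ('a mat \<Rightarrow> complex) set))"
      then obtain k1 p1 p2 r1 r2 where z: "z = (k1,p1,p2,r1,r2)" "k1 \<in> dc_indices k l c d"
        and O: "p1 \<in> Om k1" "p2 \<in> Om (k-k1)" "r1 \<in> Om (c-k1)" "r2 \<in> Om (k1+l-c)" by auto
      have e: "k1 + (k - k1) = k" "c - k1 + (k1 + l - c) = l" "k1 + (c - k1) = c" "k - k1 + (k1 + l - c) = d"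
        using z(2) True by (auto simp: dc_indices_def)
      show "ii (jj z) = z" using O by (simp add: z ii_def jj_def)
      show "jj z \<in> ?Q" using O e by (simp add: z jj_def emb_Omega a(3) b(3) c1(3) c2(3))
      have "complex_of_real (Tc (emb k1 p1) (emb (k-k1) p2) a) = tc k1 (k-k1) p1 p2 a'"
        "complex_of_real (Tc (emb (c-k1) r1) (emb (k1+l-c) r2) b) = tc (c-k1) (k1+l-c) r1 r2 b'"
        "complex_of_real (Tc (emb k1 p1) (emb (c-k1) r1) c1) = tc k1 (c-k1) p1 r1 c1'"
        "complex_of_real (Tc (emb (k-k1) p2) (emb (k1+l-c) r2) c2) = tc (k-k1) (k1+l-c) p2 r2 c2'"
        using Tc_emb[OF O(1,2), of a'] Tc_emb[OF O(3,4), of b'] Tc_emb[OF O(1,3), of c1'] Tc_emb[OF O(2,4), of c2']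
          a(1) b(1) c1(1) c2(1) unfolding e a(2) b(2) c1(2) c2(2) by blast+
      moreover have "cnj (tc k1 (c-k1) p1 r1 c1') = tc k1 (c-k1) p1 r1 c1'" "cnj (tc (k-k1) (k1+l-c) p2 r2 c2') = tc (k-k1) (k1+l-c) p2 r2 c2'"
        using cnj_tc[OF O(1,3), of c1'] cnj_tc[OF O(2,4), of c2'] c1(1) c2(1) unfolding e by blast+
      ultimately show "complex_of_real (?F (jj z)) =
        (case z of (k1,p1,p2,r1,r2) \<Rightarrow> tc k1 (k-k1) p1 p2 a' * tc (c-k1) (k1+l-c) r1 r2 b' * (cnj (tc k1 (c-k1) p1 r1 c1') * cnj (tc (k-k1) (k1+l-c) p2 r2 c2')))"
        by (simp add: z jj_def)
    next
      fix w assume w: "w \<in> ?Q"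
      obtain p1 p2 r1 r2 where ww: "w = ((p1,p2),(r1,r2))" by (cases w) auto
      have O: "p1 \<in> Omega" "p2 \<in> Omega" "r1 \<in> Omega" "r2 \<in> Omega" and
        e: "gdeg p1 + gdeg p2 = k" "gdeg r1 + gdeg r2 = l" "gdeg p1 + gdeg r1 = c" "gdeg p2 + gdeg r2 = d"
        using w unfolding ww a(3) b(3) c1(3) c2(3) by auto
      have g: "k - gdeg p1 = gdeg p2" "c - gdeg p1 = gdeg r1" "gdeg p1 + l - c = gdeg r2" "gdeg p1 \<in> dc_indices k l c d"
        using e by (auto simp: dc_indices_def)
      have oo: "x (gdeg x) \<in> Om (gdeg x)" "emb (gdeg x) (x (gdeg x)) = x" if "x \<in> Omega" for x :: "'a gr"
        using that by (auto elim!: OmegaE)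
      show "jj (ii w) = w" using O by (simp add: ww g oo ii_def jj_def)
      show "ii w \<in> Sigma (dc_indices k l c d) (\<lambda>k1. Om k1 \<times> Om (k-k1) \<times> Om (c-k1) \<times> Om (k1+l-c))"
        using O by (simp add: ww g oo ii_def)
    qed
    finally show ?thesis by (simp only: of_real_sum[symmetric] of_real_eq_iff)
  qed
qed

interpretation C: selfadjoint "Omega :: 'a::{finite,field} gr set" gdeg Tc oneC
proof
  fix n show "finite {b \<in> Omega :: 'a gr set. gdeg b = n}"
    using bij_betw_finite[OF bij_betw_emb[of n, where 'a = 'a]] by simp
qed (auto simp: Tc_nonneg oneC_Omega oneC_iff Tc_unit Tc_assoc Tc_hopf dest: Tc_supp)

section \<open>Existence and uniqueness of real coordinates\<close>

lemma Omega_hom: "c \<in> Omega \<Longrightarrow> n \<noteq> gdeg c \<Longrightarrow> c n x = 0"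
  by (auto elim!: OmegaE simp: emb_def)

lemma real_coords_Tc: "real_coords Tc Tc (\<lambda>b :: 'a::{finite,field} gr. of_bool (b = oneC)) (\<lambda>b. of_bool (b = oneC))"
  unfolding real_coords_def
proof (intro conjI ballI allI)
  fix a b :: "'a gr" assume ab: "a \<in> Omega" "b \<in> Omega"
  obtain k a' where a: "a' \<in> Om k" "a = emb k a'" "gdeg a = k" using ab(1) by (elim OmegaE)
  obtain l b' where b: "b' \<in> Om l" "b = emb l b'" "gdeg b = l" using ab(2) by (elim OmegaE)
  have sub: "{c. Tc a b c \<noteq> 0} \<subseteq> {c \<in> Omega. gdeg c = k + l}" using Tc_supp a(3) b(3) by blast
  show fin: "finite {c. Tc a b c \<noteq> 0}" by (rule finite_subset[OF sub C.finite_deg])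
  show "{c. Tc a b c \<noteq> 0} \<subseteq> Omega" using sub by blast
  fix n x
  have "(\<Sum>c\<in>{c. Tc a b c \<noteq> 0}. complex_of_real (Tc a b c) * c n x) = (\<Sum>c\<in>{c \<in> Omega. gdeg c = k + l}. complex_of_real (Tc a b c) * c n x)"
    by (rule sum.mono_neutral_left[OF C.finite_deg sub]) auto
  also have "\<dots> = (\<Sum>c\<in>Om (k+l). tc k l a' b' c * emb (k+l) c n x)"
    unfolding sum_Omega_deg by (intro sum.cong refl) (simp add: a(2) b(2) Tc_emb a(1) b(1))
  also have "\<dots> = hmult (tens a b) n x"
  proof (cases "n = k + l")
    case True
    \<comment> \<open>As \<open>a\<close> and \<open>b\<close> are homogeneous, the only splitting
      of \<open>n\<close> with a nonzero term is \<open>k + l\<close>.\<close>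
    have "hmult (tens a b) n x = (\<Sum>k'\<le>n. if k' = k then hc_ind k l (\<lambda>x y. a' x * b' y) x else 0)"
      unfolding hmult_def tens_def using True by (intro sum.cong refl) (auto simp: a(2) b(2) emb_other hc_ind_def)
    also have "\<dots> = hc_ind k l (\<lambda>x y. a' x * b' y) x" using True by simp
    finally show ?thesis using True by (simp add: hc_ind_expansion a(1) b(1))
  next
    case False
    have z: "a k' x * b (n-k') y = 0" if "k' \<le> n" for k' x y
      using False that by (cases "k' = k") (auto simp: a(2) b(2) emb_def)
    have "hmult (tens a b) n x = 0" unfolding hmult_def tens_def
      by (intro sum.neutral ballI) (simp add: hc_ind_def z)
    then show ?thesis using False by (simp add: emb_other)
  qed
  finally show "hmult (tens a b) n x = (\<Sum>c\<in>{c. Tc a b c \<noteq> 0}. complex_of_real (Tc a b c) * c n x)" ..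
next
  fix c :: "'a gr" assume cO: "c \<in> Omega"
  obtain m c' where c: "c' \<in> Om m" "c = emb m c'" "gdeg c = m" using cO by (elim OmegaE)
  let ?P = "{p. Tc (fst p) (snd p) c \<noteq> 0}"
  show fin: "finite ?P" by (rule C.finite_T_supp)
  show "?P \<subseteq> Omega \<times> Omega" by (auto dest: Tc_supp)
  fix k l x y
  let ?F = "\<lambda>p. complex_of_real (Tc (fst p) (snd p) c) * tens (fst p) (snd p) k l x y"
  show "hcomult c k l x y = sum ?F ?P"
  proof (cases "m = k + l")
    case True
    let ?D = "\<lambda>n. {a \<in> Omega :: 'a gr set. gdeg a = n}"
    have c1: "c' \<in> Om (k+l)" "c = emb (k+l) c'" using c True by auto
    have "hcomult c k l x y = (\<Sum>a\<in>Om k. \<Sum>b\<in>Om l. tc k l a b c' * (a x * b y))"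
      unfolding hcomult_def c1(2) emb_same by (rule hc_res_expansion[OF Om_classfun[OF c1(1)]])
    also have "\<dots> = (\<Sum>a\<in>Om k. \<Sum>b\<in>Om l. ?F (emb k a, emb l b))"
      by (intro sum.cong refl) (simp add: c1(2) Tc_emb c1(1) tens_def)
    also have "\<dots> = (\<Sum>a\<in>?D k. \<Sum>b\<in>?D l. ?F (a,b))" by (simp only: sum_Omega_deg)
    also have "\<dots> = sum ?F (?D k \<times> ?D l)" by (simp only: sum.cartesian_product')
    also have "\<dots> = sum ?F ?P"
    proof (rule sum.mono_neutral_cong)
      fix p assume p: "p \<in> ?P - ?D k \<times> ?D l"
      then have "fst p \<in> Omega" "snd p \<in> Omega" "gdeg (fst p) \<noteq> k \<or> gdeg (snd p) \<noteq> l"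
        using Tc_supp[of "fst p" "snd p" c] by (auto simp: mem_Times_iff)
      then have "fst p k x = 0 \<or> snd p l y = 0" using Omega_hom by metis
      then show "?F p = 0" by (auto simp: tens_def)
    next
      fix p assume "p \<in> ?D k \<times> ?D l - ?P" then show "?F p = 0" by simp
    qed (rule finite_cartesian_product C.finite_deg fin refl)+
    finally show ?thesis .
  next
    case False
    have "?F p = 0" if "p \<in> ?P" for p
    proof -
      have s: "fst p \<in> Omega" "snd p \<in> Omega" "gdeg c = gdeg (fst p) + gdeg (snd p)" using that Tc_supp[of "fst p" "snd p" c] by auto
      then have "gdeg (fst p) \<noteq> k \<or> gdeg (snd p) \<noteq> l" using False c(3) by auto
      then have "fst p k x = 0 \<or> snd p l y = 0" using Omega_hom s by metis
      then show ?thesis by (auto simp: tens_def)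
    qed
    then have "sum ?F ?P = 0" by (rule sum.neutral[rule_format])
    moreover have "hcomult c k l x y = 0" using False by (simp add: hcomult_def c(2) emb_other hc_res_def)
    ultimately show ?thesis by simp
  qed
next
  have s: "{b. (of_bool (b = oneC) :: real) \<noteq> 0} = {oneC :: 'a gr}" by auto
  show "finite {b :: 'a gr. (of_bool (b = oneC) :: real) \<noteq> 0}" "{b :: 'a gr. (of_bool (b = oneC) :: real) \<noteq> 0} \<subseteq> Omega"
    unfolding s using oneC_Omega by auto
  fix n and x :: "'a mat"
  show "hunit 1 n x = (\<Sum>b\<in>{b :: 'a gr. (of_bool (b = oneC) :: real) \<noteq> 0}. complex_of_real (of_bool (b = oneC)) * b n x)"
    unfolding s by (simp add: hunit_def oneC_def emb_def)
next
  fix b :: "'a gr" assume b: "b \<in> Omega"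
  show "hcounit b = complex_of_real (of_bool (b = oneC))"
  proof (cases "b = oneC")
    case True then show ?thesis by (simp add: hcounit_def oneC_def)
  next
    case False
    then show ?thesis using Omega_hom[OF b, of 0] oneC_iff[OF b] by (simp add: hcounit_def)
  qed
qed

lemma Omega_form:
  assumes "b \<in> Omega" "c \<in> Omega" shows "form (gdeg c) (b (gdeg c)) (c (gdeg c)) = of_bool (b = c)"
proof -
  obtain m c' where c: "c' \<in> Om m" "c = emb m c'" "gdeg c = m" using assms(2) by (elim OmegaE)
  obtain n b' where b: "b' \<in> Om n" "b = emb n b'" "gdeg b = n" using assms(1) by (elim OmegaE)
  show ?thesis
  proof (cases "n = m")
    case True then show ?thesis using c b Om_orthonormal[of b' m c'] emb_eq_iff[OF b(1) c(1)] by auto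
  next
    case False
    then have "b \<noteq> c" using emb_eq_iff[OF b(1) c(1)] b(2) c(2) by simp
    then show ?thesis using False c b by (simp add: emb_other form_def)
  qed
qed

text \<open>Pairing with an element of \<open>Omega\<close> in its degree recovers its coefficient;
  outside \<open>Omega\<close> both families vanish by assumption.\<close>

lemma Omega_independent:
  fixes s t :: "'a::{finite,field} gr \<Rightarrow> real"
  assumes "finite {c. s c \<noteq> 0}" "{c. s c \<noteq> 0} \<subseteq> Omega" "finite {c. t c \<noteq> 0}" "{c. t c \<noteq> 0} \<subseteq> Omega"
    and eq: "\<And>n x. (\<Sum>c\<in>{c. s c \<noteq> 0}. complex_of_real (s c) * c n x) = (\<Sum>c\<in>{c. t c \<noteq> 0}. complex_of_real (t c) * c n x)"
  shows "s = t"
proof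
  fix c
  have co: "form (gdeg c) (\<lambda>x. \<Sum>b\<in>{c. u c \<noteq> 0}. complex_of_real (u b) * b (gdeg c) x) (c (gdeg c)) = complex_of_real (u c)"
    if "c \<in> Omega" "finite {c. u c \<noteq> 0}" "{c. u c \<noteq> 0} \<subseteq> Omega" for u :: "'a gr \<Rightarrow> real"
  proof -
    have "form (gdeg c) (\<lambda>x. \<Sum>b\<in>{c. u c \<noteq> 0}. complex_of_real (u b) * b (gdeg c) x) (c (gdeg c)) =
       (\<Sum>b\<in>{c. u c \<noteq> 0}. complex_of_real (u b) * form (gdeg c) (b (gdeg c)) (c (gdeg c)))"
      unfolding form_def by (simp add: sum_distrib_left sum_distrib_right sum_divide_distrib mult.assoc) (rule sum.swap)
    also have "\<dots> = (\<Sum>b\<in>{c. u c \<noteq> 0}. if b = c then complex_of_real (u c) else 0)"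
      using that by (intro sum.cong refl) (auto simp: Omega_form)
    finally show ?thesis using that by simp
  qed
  show "s c = t c"
  proof (cases "c \<in> Omega")
    case True
    then show ?thesis using co[OF True assms(1,2)] co[OF True assms(3,4)] eq by simp
  next
    case False
    then have "c \<notin> {c. s c \<noteq> 0}" "c \<notin> {c. t c \<noteq> 0}" using assms(2,4) by blast+
    then show ?thesis by simp
  qed
qed

text \<open>The same pairing argument in the tensor square, where \<open>form2\<close> of products
  factors into two values of \<open>form\<close>.\<close>

lemma Omega2_independent:
  fixes s t :: "'a::{finite,field} gr \<Rightarrow> 'a gr \<Rightarrow> real"
  assumes "finite {p. s (fst p) (snd p) \<noteq> 0}" "{p. s (fst p) (snd p) \<noteq> 0} \<subseteq> Omega \<times> Omega"
      "finite {p. t (fst p) (snd p) \<noteq> 0}" "{p. t (fst p) (snd p) \<noteq> 0} \<subseteq> Omega \<times> Omega"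
    and eq: "\<And>k l x y. (\<Sum>p\<in>{p. s (fst p) (snd p) \<noteq> 0}. complex_of_real (s (fst p) (snd p)) * tens (fst p) (snd p) k l x y) =
       (\<Sum>p\<in>{p. t (fst p) (snd p) \<noteq> 0}. complex_of_real (t (fst p) (snd p)) * tens (fst p) (snd p) k l x y)"
  shows "s a b = t a b"
proof -
  let ?k = "gdeg a" and ?l = "gdeg b"
  have co: "form2 ?k ?l (\<lambda>x y. \<Sum>p\<in>{p. u (fst p) (snd p) \<noteq> 0}. complex_of_real (u (fst p) (snd p)) * tens (fst p) (snd p) ?k ?l x y)
      (\<lambda>x y. a ?k x * b ?l y) = complex_of_real (u a b)"
    if ab: "a \<in> Omega" "b \<in> Omega" and u: "finite {p. u (fst p) (snd p) \<noteq> 0}" "{p. u (fst p) (snd p) \<noteq> 0} \<subseteq> Omega \<times> Omega"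
    for u :: "'a gr \<Rightarrow> 'a gr \<Rightarrow> real"
  proof -
    let ?P = "{p. u (fst p) (snd p) \<noteq> 0}"
    have f: "form2 ?k ?l (\<lambda>x y. p x * r y) (\<lambda>x y. a ?k x * b ?l y) = form ?k p (a ?k) * form ?l r (b ?l)" for p r
    proof -
      have "(\<Sum>x\<in>gl ?k. \<Sum>y\<in>gl ?l. p x * r y * cnj (a ?k x * b ?l y)) = (\<Sum>x\<in>gl ?k. \<Sum>y\<in>gl ?l. (p x * cnj (a ?k x)) * (r y * cnj (b ?l y)))"
        by (intro sum.cong refl) (simp add: mult_ac)
      then show ?thesis by (simp add: form2_def form_def sum_product)
    qed
    have "form2 ?k ?l (\<lambda>x y. \<Sum>p\<in>?P. complex_of_real (u (fst p) (snd p)) * tens (fst p) (snd p) ?k ?l x y) (\<lambda>x y. a ?k x * b ?l y) =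
       (\<Sum>p\<in>?P. complex_of_real (u (fst p) (snd p)) * form2 ?k ?l (\<lambda>x y. fst p ?k x * snd p ?l y) (\<lambda>x y. a ?k x * b ?l y))"
      unfolding form2_def tens_def sum_distrib_right
      by (subst sum_swap3) (simp add: sum_divide_distrib sum_distrib_left mult.assoc)
    also have "\<dots> = (\<Sum>p\<in>?P. if p = (a,b) then complex_of_real (u a b) else 0)"
    proof (intro sum.cong refl)
      fix p assume "p \<in> ?P"
      then have "fst p \<in> Omega" "snd p \<in> Omega" using u by auto
      then show "complex_of_real (u (fst p) (snd p)) * form2 ?k ?l (\<lambda>x y. fst p ?k x * snd p ?l y) (\<lambda>x y. a ?k x * b ?l y) =
         (if p = (a,b) then complex_of_real (u a b) else 0)"
        using ab by (cases p) (auto simp: f Omega_form)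
    qed
    finally show ?thesis using u by simp
  qed
  show ?thesis
  proof (cases "a \<in> Omega \<and> b \<in> Omega")
    case True
    then show ?thesis using co[OF _ _ assms(1,2)] co[OF _ _ assms(3,4)] eq by simp
  next
    case False
    then have "(a,b) \<notin> {p. s (fst p) (snd p) \<noteq> 0}" "(a,b) \<notin> {p. t (fst p) (snd p) \<noteq> 0}" using assms by blast+
    then show ?thesis by simp
  qed
qed

lemma real_coordsD:
  assumes "real_coords mc cc un cu"
  shows "a \<in> Omega \<Longrightarrow> b \<in> Omega \<Longrightarrow> finite {c. mc a b c \<noteq> 0} \<and> {c. mc a b c \<noteq> 0} \<subseteq> Omega \<and>
        (\<forall>n x. hmult (tens a b) n x = (\<Sum>c\<in>{c. mc a b c \<noteq> 0}. complex_of_real (mc a b c) * c n x))"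
    and "c \<in> Omega \<Longrightarrow> finite {p. cc (fst p) (snd p) c \<noteq> 0} \<and> {p. cc (fst p) (snd p) c \<noteq> 0} \<subseteq> Omega \<times> Omega \<and>
        (\<forall>k l x y. hcomult c k l x y =
           (\<Sum>p\<in>{p. cc (fst p) (snd p) c \<noteq> 0}. complex_of_real (cc (fst p) (snd p) c) * tens (fst p) (snd p) k l x y))"
    and "finite {b. un b \<noteq> 0} \<and> {b. un b \<noteq> 0} \<subseteq> Omega \<and>
     (\<forall>n x. hunit 1 n x = (\<Sum>b\<in>{b. un b \<noteq> 0}. complex_of_real (un b) * b n x))"
    and "b \<in> Omega \<Longrightarrow> hcounit b = complex_of_real (cu b)"
  using assms unfolding real_coords_def by simp_all

text \<open>Agreement is claimed exactly on the arguments that \<open>real_coords\<close>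
  constrains. The unit is an element rather than a map, so its coordinates agree everywhere.\<close>

lemma real_coords_unique:
  fixes mc cc mc' cc' :: "'a::{finite,field} gr \<Rightarrow> 'a gr \<Rightarrow> 'a gr \<Rightarrow> real"
  assumes r: "real_coords mc cc un cu" and r': "real_coords mc' cc' un' cu'"
  shows "a \<in> Omega \<Longrightarrow> b \<in> Omega \<Longrightarrow> mc a b c = mc' a b c"
    and "c \<in> Omega \<Longrightarrow> cc a b c = cc' a b c" and "un = un'" and "b \<in> Omega \<Longrightarrow> cu b = cu' b"
proof -
  show "mc a b c = mc' a b c" if ab: "a \<in> Omega" "b \<in> Omega"
  proof -
    have "mc a b = mc' a b"
      by (rule Omega_independent) (use real_coordsD(1)[OF r ab] real_coordsD(1)[OF r' ab] in simp_all)
    then show ?thesis by simp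
  qed
  show "cc a b c = cc' a b c" if c: "c \<in> Omega"
    by (rule Omega2_independent[where s = "\<lambda>a b. cc a b c" and t = "\<lambda>a b. cc' a b c"])
       (use real_coordsD(2)[OF r c] real_coordsD(2)[OF r' c] in simp_all)
  show "un = un'"
    by (rule Omega_independent) (use real_coordsD(3)[OF r] real_coordsD(3)[OF r'] in simp_all)
  show "cu b = cu' b" if b: "b \<in> Omega"
    using real_coordsD(4)[OF r b] real_coordsD(4)[OF r' b] by simp
qed

lemma real_coords_psh:
  fixes mc cc :: "'a::{finite,field} gr \<Rightarrow> 'a gr \<Rightarrow> 'a gr \<Rightarrow> real"
  assumes "real_coords mc cc un cu" shows "real_psh Omega gdeg mc cc un cu"
  by (rule C.based_psh_of_coords) (simp_all add: real_coords_unique[OF assms real_coords_Tc])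

section \<open>An irrational structure constant\<close>

definition trivchar :: "nat \<Rightarrow> 'a::{finite,field} mat \<Rightarrow> complex" where
  "trivchar n = (\<lambda>x. if x \<in> gl n then 1 else 0)"

lemma trivchar_orb: "orb n (trivchar n) = {trivchar n}"
proof -
  have "cact n g (trivchar n) = trivchar n" for g :: "'a mat"
    by (simp add: cact_def trivchar_def fun_eq_iff)
  then show ?thesis by (simp add: orb_def image_constant_conv)
qed

lemma trivchar_orbs: "{trivchar n} \<in> orbs n"
  unfolding orbs_def
proof (rule image_eqI[of _ _ "trivchar n"])
  show "trivchar n \<in> LC n" using triv_lin_char by (simp add: trivchar_def)
qed (simp add: trivchar_orb)

lemma nosum_singleton:
  fixes t :: "'a::{finite,field} mat \<Rightarrow> complex"
  shows "nosum n {t} = (\<lambda>x. t x / complex_of_real (onrm n {t}))"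
  by (simp add: nosum_def osum_def)

lemma tc_trivchar:
  "tc k l (trivchar k) (trivchar l) (trivchar (k+l) :: 'a::{finite,field} mat \<Rightarrow> complex) =
    of_nat (card (gl k :: 'a mat set)) * of_nat (card (gl l :: 'a mat set)) /
    (of_nat (card (GL k :: 'a mat set)) * of_nat (card (GL l :: 'a mat set)))"
proof -
  have 1: "hc_res k l (trivchar (k+l)) x y = 1" if "x \<in> gl k" "y \<in> gl l" for x y :: "'a mat"
  proof -
    have "(\<Sum>u\<in>nilrad k l. trivchar (k+l) (bdiag k l x y + u)) = (\<Sum>u\<in>(nilrad k l :: 'a mat set). 1)"
      by (intro sum.cong refl) (simp add: trivchar_def gl_add nilrad_gl)
    then show ?thesis using that card_nilrad_pos[of k l, where 'a = 'a] by (simp add: hc_res_alt)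
  qed
  have "(\<Sum>x\<in>(gl k :: 'a mat set). \<Sum>y\<in>gl l. hc_res k l (trivchar (k+l)) x y * cnj (trivchar k x * trivchar l y)) =
     (\<Sum>x\<in>(gl k :: 'a mat set). \<Sum>y\<in>(gl l :: 'a mat set). 1)"
    by (intro sum.cong refl) (simp add: 1, simp add: trivchar_def)
  then show ?thesis by (simp add: tc_def form2_def)
qed

text \<open>Restriction takes the trivial character to the trivial one, so before normalization the
  coefficient is |gl_1|^2 / |GL_1|^2. Each normalization in degree n divides by the square root of
  |gl_n| / |GL_n|, and squaring removes the root.\<close>

lemma Tc_trivchar_square:
  defines "w \<equiv> \<lambda>n. emb n (nosum n {trivchar n :: 'a::{finite,field} mat \<Rightarrow> complex})"
  shows "(Tc (w 1) (w 1) (w 2))\<^sup>2 =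
    real (card (GL 2 :: 'a mat set)) * (real (card (gl 1 :: 'a mat set)))\<^sup>2 /
    (real (card (gl 2 :: 'a mat set)) * (real (card (GL 1 :: 'a mat set)))\<^sup>2)"
proof -
  let ?r = "\<lambda>n. onrm n {trivchar n :: 'a mat \<Rightarrow> complex}"
  let ?N = "\<lambda>n. real (card (gl n :: 'a mat set))" and ?G = "\<lambda>n. real (card (GL n :: 'a mat set))"
  have pos: "?N n > 0" "?G n > 0" for n using card_gl_pos[of n, where 'a = 'a] card_GL_pos[of n, where 'a = 'a] by (simp_all add: card_gt_0_iff)
  have r2: "(?r n)\<^sup>2 = ?N n / ?G n" for n using pos by (simp add: onrm_def)
  have O: "nosum n {trivchar n :: 'a mat \<Rightarrow> complex} \<in> Om n" for n unfolding Om_def using trivchar_orbs by blast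
  \<comment> \<open>Degree 2 is written \<open>1+1\<close> to match the form \<open>k + l\<close> in
    \<open>Tc_emb\<close>.\<close>
  have "complex_of_real (Tc (w 1) (w 1) (w (1+1))) =
      tc 1 1 (nosum 1 {trivchar 1}) (nosum 1 {trivchar 1}) (nosum (1+1) {trivchar (1+1) :: 'a mat \<Rightarrow> complex})"
    unfolding w_def by (rule Tc_emb[OF O O O])
  also have "\<dots> = complex_of_real (?N 1 * ?N 1 / (?G 1 * ?G 1) / (?r (1+1) * ?r 1 * ?r 1))"
    unfolding nosum_singleton tc_scale tc_trivchar by simp
  finally have "Tc (w 1) (w 1) (w 2) = ?N 1 * ?N 1 / (?G 1 * ?G 1) / (?r 2 * ?r 1 * ?r 1)"
    by (simp only: of_real_eq_iff one_add_one)
  also have "\<dots> = ?N 1 * ?N 1 / (?G 1 * ?G 1) / (?r 2 * (?N 1 / ?G 1))"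
    unfolding r2[of 1, symmetric] by (simp add: power2_eq_square mult.assoc)
  also have "\<dots> = ?N 1 / ?G 1 / ?r 2" using pos[of 1] by (simp add: field_simps)
  finally have "(Tc (w 1) (w 1) (w 2))\<^sup>2 = (?N 1)\<^sup>2 / (?G 1)\<^sup>2 / (?N 2 / ?G 2)"
    by (simp add: power_divide power_mult_distrib r2)
  then show ?thesis by (simp add: mult.commute)
qed

section \<open>Counting matrices of size one and two\<close>

definition mat2 :: "'a::zero \<Rightarrow> 'a \<Rightarrow> 'a \<Rightarrow> 'a \<Rightarrow> 'a mat" where
  "mat2 a b c d = (\<lambda>i j. if i = 0 \<and> j = 0 then a else if i = 0 \<and> j = 1 then b
     else if i = 1 \<and> j = 0 then c else if i = 1 \<and> j = 1 then d else 0)"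

lemma mat2_eq_iff: "mat2 a b c d = mat2 a' b' c' d' \<longleftrightarrow> a = a' \<and> b = b' \<and> c = c' \<and> d = d'"
proof
  assume e: "mat2 a b c d = mat2 a' b' c' d'"
  have "mat2 a b c d i j = mat2 a' b' c' d' i j" for i j by (simp add: e)
  from this[of 0 0] this[of 0 1] this[of 1 0] this[of 1 1] show "a = a' \<and> b = b' \<and> c = c' \<and> d = d'"
    by (simp add: mat2_def)
qed simp

lemma mat2_gl: "mat2 a b c d \<in> gl 2" by (auto simp: mat2_def gl_def)

lemma gl2_mat2: "A \<in> gl 2 \<Longrightarrow> A = mat2 (A 0 0) (A 0 1) (A 1 0) (A 1 1)"
proof (intro ext)
  fix i j assume A: "A \<in> gl 2"
  show "A i j = mat2 (A 0 0) (A 0 1) (A 1 0) (A 1 1) i j"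
  proof (cases "i < 2 \<and> j < 2")
    case True
    then have "(i = 0 \<or> i = 1) \<and> (j = 0 \<or> j = 1)" by auto
    then show ?thesis by (auto simp: mat2_def)
  next
    case False then show ?thesis using A by (auto simp: mat2_def gl_def)
  qed
qed

lemma mmul_mat2: "mmul 2 (mat2 a b c d) (mat2 a' b' c' d') =
    mat2 (a * a' + b * c') (a * b' + b * d') (c * a' + d * c') (c * b' + d * d')"
  by (subst gl2_mat2[OF mmul_gl]) (simp add: mmul_def mat2_def numeral_2_eq_2)

lemma idm_mat2: "idm 2 = mat2 1 0 0 1"
  by (subst gl2_mat2[OF idm_gl]) (simp add: idm_def)

lemma mat2_GL: "a * d - b * c \<noteq> 0 \<Longrightarrow> mat2 a b c d \<in> GL 2" for a :: "'a::{finite,field}"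
proof -
  assume D: "a * d - b * c \<noteq> 0"
  define D where "D = a * d - b * c"
  have "d / D * a + - b / D * c = (a * d - b * c) / D" "- c / D * b + a / D * d = (a * d - b * c) / D"
    by (simp_all add: diff_divide_distrib mult.commute)
  note this[folded D_def]
  moreover have "D \<noteq> 0" using \<open>a * d - b * c \<noteq> 0\<close> by (simp add: D_def)
  ultimately have "mmul 2 (mat2 (d / D) (- b / D) (- c / D) (a / D)) (mat2 a b c d) = idm 2"
    unfolding mmul_mat2 idm_mat2 mat2_eq_iff by simp
  then show ?thesis by (rule GL_leftI(1)[OF mat2_gl mat2_gl])
qed

lemma card_gl_1: "card (gl 1 :: 'a::{finite,zero} mat set) = card (UNIV :: 'a set)"
proof -
  have "bij_betw (\<lambda>A. A 0 0) (gl 1 :: 'a mat set) UNIV"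
    by (rule bij_betwI[of _ _ _ "\<lambda>a i j. if i = 0 \<and> j = 0 then a else 0"]) (auto simp: gl_def fun_eq_iff)
  then show ?thesis by (rule bij_betw_same_card)
qed

lemma card_gl_2: "card (gl 2 :: 'a::{finite,zero} mat set) = card (UNIV :: 'a set) ^ 4"
proof -
  have "bij_betw (\<lambda>A. (A 0 0, A 0 1, A 1 0, A 1 1)) (gl 2 :: 'a mat set) (UNIV \<times> UNIV \<times> UNIV \<times> UNIV)"
  proof (rule bij_betwI[of _ _ _ "\<lambda>(a,b,c,d). mat2 a b c d"])
    show "(\<lambda>(a,b,c,d). mat2 a b c d) (A 0 0, A 0 1, A 1 0, A 1 1) = A" if "A \<in> gl 2" for A :: "'a mat"
      unfolding prod.case by (rule gl2_mat2[OF that, symmetric])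
  qed (auto simp: mat2_gl, auto simp: mat2_def)
  then have "card (gl 2 :: 'a mat set) = card (UNIV \<times> UNIV \<times> UNIV \<times> UNIV :: ('a \<times> 'a \<times> 'a \<times> 'a) set)"
    by (rule bij_betw_same_card)
  then show ?thesis by (simp add: card_cartesian_product power4_eq_xxxx mult.assoc del: UNIV_Times_UNIV)
qed

lemma card_GL_1: "card (GL 1 :: 'a::{finite,field} mat set) = card (UNIV :: 'a set) - 1"
proof -
  have "bij_betw (\<lambda>A. A 0 0) (GL 1 :: 'a mat set) (UNIV - {0})"
  proof (rule bij_betwI[of _ _ _ "\<lambda>a i j. if i = 0 \<and> j = 0 then a else 0"])
    show "(\<lambda>A. A 0 0) \<in> (GL 1 :: 'a mat set) \<rightarrow> UNIV - {0}"
    proof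
      fix A :: "'a mat" assume "A \<in> GL 1"
      then have "mmul 1 A (minv 1 A) 0 0 = idm 1 0 0" by (simp add: minv_r)
      then show "A 0 0 \<in> UNIV - {0}" by (auto simp: mmul_def idm_def)
    qed
    show "(\<lambda>a i j. if i = 0 \<and> j = 0 then a else 0) \<in> UNIV - {0} \<rightarrow> (GL 1 :: 'a mat set)"
    proof
      fix a :: 'a assume "a \<in> UNIV - {0}"
      then show "(\<lambda>i j. if i = 0 \<and> j = 0 then a else 0) \<in> GL 1"
        by (intro GL_leftI(1)[of _ _ "\<lambda>i j. if i = 0 \<and> j = 0 then 1 / a else 0"]) (auto simp: gl_def mmul_def idm_def fun_eq_iff)
    qed
  qed (auto simp: fun_eq_iff gl_def dest!: GL_gl)
  then have "card (GL 1 :: 'a mat set) = card (UNIV - {0 :: 'a})" by (rule bij_betw_same_card)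
  then show ?thesis by (simp add: card_Diff_singleton)
qed

text \<open>\<open>g\<close> parametrizes the matrices with nonzero upper left entry and nonzero
  Schur complement \<open>e\<close>; all are invertible, and the antidiagonal permutation matrix is
  not among them. The upper bound is strict because the zero matrix is singular.\<close>

lemma card_GL_2_bounds:
  defines "q \<equiv> card (UNIV :: 'a::{finite,field} set)"
  shows "(q - 1)\<^sup>2 * q\<^sup>2 < card (GL 2 :: 'a mat set)" "card (GL 2 :: 'a mat set) < q ^ 4"
proof -
  let ?X = "(UNIV - {0}) \<times> UNIV \<times> UNIV \<times> (UNIV - {0}) :: ('a \<times> 'a \<times> 'a \<times> 'a) set"
  define g where "g = (\<lambda>(a, b, c, e :: 'a). mat2 a b c (e + c * b / a))"
  have "inj_on g ?X" by (auto simp: inj_on_def g_def mat2_eq_iff)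
  then have card: "card (g ` ?X) = (q - 1)\<^sup>2 * q\<^sup>2"
    by (simp add: card_image card_cartesian_product card_Diff_singleton q_def power2_eq_square)
  have sub: "g ` ?X \<subseteq> GL 2"
  proof
    fix A assume "A \<in> g ` ?X"
    then obtain a b c e where nz: "a \<noteq> 0" "e \<noteq> 0" and A: "A = mat2 a b c (e + c * b / a)" by (auto simp: g_def)
    have "a * (e + c * b / a) - b * c = a * e" using nz by (simp add: distrib_left mult.commute)
    then show "A \<in> GL 2" unfolding A using nz by (intro mat2_GL) simp
  qed
  have "mat2 0 1 1 0 \<in> GL 2 - g ` ?X"
    by (auto simp: g_def mat2_eq_iff intro: mat2_GL)
  then have "g ` ?X \<subset> GL 2" using sub by blast
  then have "card (g ` ?X) < card (GL 2 :: 'a mat set)" by (rule psubset_card_mono[OF finite_GL])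
  then show "(q - 1)\<^sup>2 * q\<^sup>2 < card (GL 2 :: 'a mat set)" by (simp add: card)
  have "mat2 0 0 0 0 \<notin> (GL 2 :: 'a mat set)"
  proof
    assume G: "mat2 0 0 0 0 \<in> (GL 2 :: 'a mat set)"
    obtain a b c d where "minv 2 (mat2 0 0 0 (0::'a)) = mat2 a b c d" using gl2_mat2[OF minv_gl[OF G]] by blast
    then show False using minv_r[OF G] by (simp add: mmul_mat2 idm_mat2 mat2_eq_iff)
  qed
  then have "GL 2 \<subset> (gl 2 :: 'a mat set)" using GL_gl mat2_gl by blast
  then have "card (GL 2 :: 'a mat set) < card (gl 2 :: 'a mat set)" by (rule psubset_card_mono[OF finite_gl])
  then show "card (GL 2 :: 'a mat set) < q ^ 4" by (simp add: card_gl_2 q_def)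
qed

lemma exists_nonintegral_Tc:
  "\<exists>a\<in>Omega. \<exists>c\<in>Omega. \<forall>z::int. Tc a a (c :: 'a::{finite,field} gr) \<noteq> of_int z"
proof -
  define w where "w = (\<lambda>n. emb n (nosum n {trivchar n :: 'a mat \<Rightarrow> complex}))"
  define q where "q = card (UNIV :: 'a set)"
  let ?g = "card (GL 2 :: 'a mat set)"
  have q2: "q \<ge> 2" using card_field_gt_1[where 'a = 'a] by (simp add: q_def)
  have wO: "w n \<in> Omega" for n unfolding w_def Om_def by (rule emb_Omega) (use trivchar_orbs in \<open>auto simp: Om_def\<close>)
  define v where "v = Tc (w 1) (w 1) (w 2)"
  have v2: "v\<^sup>2 = real ?g * (real q)\<^sup>2 / ((real q)^4 * (real q - 1)\<^sup>2)"
    using Tc_trivchar_square[where 'a = 'a] q2 by (simp add: v_def w_def card_gl_1[where 'a = 'a, unfolded q_def[symmetric]] card_gl_2 card_GL_1[where 'a = 'a, unfolded q_def[symmetric]] q_def[symmetric] of_nat_diff del: One_nat_def)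
  have p: "(real q)\<^sup>2 > 0" "(real q - 1)\<^sup>2 > 0" using q2 by auto
  have v3: "v\<^sup>2 = real ?g / ((real q)\<^sup>2 * (real q - 1)\<^sup>2)"
  proof -
    have "x * s / (s * s * r) = x / (s * r)" if "s > 0" for x s r :: real using that by simp
    from this[OF p(1)] show ?thesis unfolding v2 by (simp add: power4_eq_xxxx power2_eq_square mult.assoc)
  qed
  have "real ((q - 1)\<^sup>2 * q\<^sup>2) < real ?g" "real ?g < real (q ^ 4)"
    using card_GL_2_bounds[where 'a = 'a, folded q_def] by (simp_all only: of_nat_less_iff)
  then have b: "(real q)\<^sup>2 * (real q - 1)\<^sup>2 < real ?g" "real ?g < (real q)^4" using q2 by (simp_all add: of_nat_diff mult.commute)
  have "v\<^sup>2 > 1" unfolding v3 using b(1) p by (simp add: less_divide_eq)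
  moreover have "v\<^sup>2 < 4"
  proof -
    have "real q \<le> 2 * (real q - 1)" using q2 by simp
    then have "(real q)\<^sup>2 \<le> (2 * (real q - 1))\<^sup>2" using q2 by (intro power_mono) auto
    also have "\<dots> = 4 * (real q - 1)\<^sup>2" by (simp only: power_mult_distrib) simp
    finally have "(real q)\<^sup>2 * (real q)\<^sup>2 \<le> (real q)\<^sup>2 * (4 * (real q - 1)\<^sup>2)" by (intro mult_left_mono) auto
    then have "real ?g < 4 * ((real q)\<^sup>2 * (real q - 1)\<^sup>2)" using b(2) by (simp add: power4_eq_xxxx power2_eq_square mult_ac)
    then show ?thesis unfolding v3 using p by (simp add: divide_less_eq)
  qed
  ultimately have "v \<noteq> of_int z" for z :: int
  proof (intro notI)
    assume a: "1 < v\<^sup>2" "v\<^sup>2 < 4" "v = of_int z"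
    then have "real_of_int 1 < real_of_int (z\<^sup>2)" "real_of_int (z\<^sup>2) < real_of_int 4" by simp_all
    then have z: "1 < z\<^sup>2" "z\<^sup>2 < 4" by (simp_all only: of_int_less_iff)
    have "\<bar>z\<bar> < 2" using z(2) by (intro power2_less_imp_less[of "\<bar>z\<bar>" 2]) auto
    moreover have "1 < \<bar>z\<bar>" using z(1) by (intro power2_less_imp_less[of 1 "\<bar>z\<bar>"]) auto
    ultimately show False by simp
  qed
  then show ?thesis using wO unfolding v_def by blast
qed

lemma not_descending:
  fixes mc cc :: "'a::{finite,field} gr \<Rightarrow> 'a gr \<Rightarrow> 'a gr \<Rightarrow> real"
  assumes "real_coords mc cc un cu" shows "\<not> descending TYPE('c) Omega gdeg mc cc un cu"
proof
  assume "descending TYPE('c) Omega gdeg mc cc un cu"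
  then obtain Psi :: "'c set" and ccA and phi :: "'c \<Rightarrow> 'a gr" where phi: "bij_betw phi Psi Omega"
    and cc: "\<forall>a\<in>Psi. \<forall>b\<in>Psi. \<forall>c\<in>Psi. cc (phi a) (phi b) (phi c) = of_int (ccA a b c)"
    unfolding descending_def by blast
  obtain a c :: "'a gr" where ac: "a \<in> Omega" "c \<in> Omega" "\<forall>z::int. Tc a a c \<noteq> of_int z"
    using exists_nonintegral_Tc by blast
  then obtain a' c' where "a' \<in> Psi" "c' \<in> Psi" "a = phi a'" "c = phi c'" using phi unfolding bij_betw_def by blast
  then have "cc a a c = of_int (ccA a' a' c')" using cc by simp
  then show False using ac real_coords_unique(2)[OF assms real_coords_Tc ac(2)] by metis
qed

theorem mainTheorem4:
  fixes mc cc :: "'a::{finite,field} gr \<Rightarrow> 'a gr \<Rightarrow> 'a gr \<Rightarrow> real"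
    and un cu :: "'a gr \<Rightarrow> real"
  shows "(\<exists>mc' cc' :: 'a gr \<Rightarrow> 'a gr \<Rightarrow> 'a gr \<Rightarrow> real. \<exists>un' cu' :: 'a gr \<Rightarrow> real.
            real_coords mc' cc' un' cu') \<and>
         (real_coords mc cc un cu \<longrightarrow>
            real_psh Omega gdeg mc cc un cu \<and>
            \<not> descending TYPE('c) Omega gdeg mc cc un cu)"
  using real_coords_Tc real_coords_psh not_descending by blast

end
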